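(* Let $\vec p_0=(\phi_0,\phi_1,\phi_2)^T\in X$ be non-negative with $\|\vec p_0\|_X=1$, and let $\vec p(\cdot,t)=\mathcal{T}(t)\vec p_0$ be the solution of the Cauchy problem $\dot{\vec p}(t)=\mathcal{A}\vec p(t)$, $\vec p(0)=\vec p_0$. Then $\vec p(\cdot,t)$ converges exponentially to the steady-state solution $\vec p_e=(p_{e0},p_{e1},p_{e2})^T$ given by $$p_{e0}=\frac{1}{(1+\lambda_1C_0)(1+\lambda_2C_1)},\qquad p_{e1}(x)=\lambda_1p_{e0}\,e^{-\int_0^x(\lambda_2+\mu_1(s))\,ds},$$ $$p_{e2}(x)=\lambda_2p_{e0}\,e^{-\int_0^x\mu_2(s)\,ds}+\lambda_1\lambda_2p_{e0}\,e^{-\int_0^x\mu_2(s)\,ds}\int_0^Le^{-\int_0^{y}(\lambda_2+\mu_1(s))\,ds}\,dy,$$ where $C_0=\int_0^Le^{-\int_0^x(\lambda_2+\mu_1(s))\,ds}\,dx$ and $C_1=\int_0^Le^{-\int_0^x\mu_2(s)\,ds}\,dx$; that is, $$\|\vec p(\cdot,t)-\vec p_e(\cdot)\|_X\le M_0e^{-\varepsilon_0t},\qquad t\ge 0,$$ for some constants $\varepsilon_0>0$ and $M_0\ge1$.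
   Context: Let $0<L<\infty$, $\lambda_1>0$, $\lambda_2>0$. For $i=1,2$ let $\mu_i(x)\ge 0$, $x\in[0,L]$, be repair rates satisfying: $\int_0^l\mu_i(x)\,dx<\infty$ for every $0<l<L$; $\int_0^L\mu_i(x)\,dx=\infty$; and there is a positive integer $N$ such that $\lim_{x\to L}\mu_i(x)(L-x)^N<\infty$ for $i=1,2$. Let $X=\mathbb{R}\times L^1(0,L)\times L^1(0,L)$ with norm $\|(p_0,p_1,p_2)\|_X=|p_0|+\|p_1\|_{L^1(0,L)}+\|p_2\|_{L^1(0,L)}$ and the componentwise (a.e.) order. The operator $\mathcal{A}:D(\mathcal{A})\subset X\to X$ acts on $\vec p=(p_0,p_1,p_2)^T$ by $$\mathcal{A}\vec p=\begin{pmatrix}-(\lambda_1+\lambda_2)p_0+\int_0^L\mu_1(x)p_1(x)\,dx+\int_0^L\mu_2(x)p_2(x)\,dx\\ -p_1'(x)-(\mu_1(x)+\lambda_2)p_1(x)\\ -p_2'(x)-\mu_2(x)p_2(x)\end{pmatrix},$$ with domain $$D(\mathcal{A})=\Big\{\vec p\in X:\ p_i\in W^{1,1}(0,L),\ \mu_ip_i\in L^1(0,L),\ i=1,2,\ \ p_1(0)=\lambda_1p_0,\ \ p_2(0)=\lambda_2p_0+\lambda_2\int_0^Lp_1(x)\,dx\Big\}.$$ This operator generates a positive $C_0$-semigroup of contractions on $X$, denoted $\mathcal{T}(t)$; for general $\vec p_0\in X$ the solution of the Cauchy problem is the mild one, $\mathcal{T}(t)\vec p_0$. *)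

theory Defs
  imports "HOL-Analysis.Analysis"
begin

text \<open>
  Elements of \<open>X = \<real> \<times> L\<^sup>1(0,L) \<times> L\<^sup>1(0,L)\<close> are represented by triples consisting of a number and
  two Lebesgue integrable functions; \<open>eqX\<close> (equality almost everywhere) plays the role of equality
  in \<open>X\<close>. Values of the functions outside \<open>{0..L}\<close> are ignored throughout. The Lebesgue measure is
  the completed one, so \<open>spaceX\<close> is closed under \<open>eqX\<close>.
\<close>

type_synonym state = "real \<times> (real \<Rightarrow> real) \<times> (real \<Rightarrow> real)"

definition spaceX :: "real \<Rightarrow> state set" where
  "spaceX L = {(a, f, g). set_integrable lebesgue {0..L} f \<and> set_integrable lebesgue {0..L} g}"

fun normX :: "real \<Rightarrow> state \<Rightarrow> real" where
  "normX L (a, f, g) =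
     \<bar>a\<bar> + (LINT x:{0..L}|lebesgue. \<bar>f x\<bar>) + (LINT x:{0..L}|lebesgue. \<bar>g x\<bar>)"

fun eqX :: "real \<Rightarrow> state \<Rightarrow> state \<Rightarrow> bool" where
  "eqX L (a, f, g) (b, u, v) \<longleftrightarrow>
     a = b \<and> (AE x\<in>{0..L} in lebesgue. f x = u x) \<and> (AE x\<in>{0..L} in lebesgue. g x = v x)"

fun nonnegX :: "real \<Rightarrow> state \<Rightarrow> bool" where
  "nonnegX L (a, f, g) \<longleftrightarrow>
     0 \<le> a \<and> (AE x\<in>{0..L} in lebesgue. 0 \<le> f x) \<and> (AE x\<in>{0..L} in lebesgue. 0 \<le> g x)"

definition zeroX :: state where
  "zeroX = (0, \<lambda>x. 0, \<lambda>x. 0)"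

fun addX :: "state \<Rightarrow> state \<Rightarrow> state" where
  "addX (a, f, g) (b, u, v) = (a + b, \<lambda>x. f x + u x, \<lambda>x. g x + v x)"

fun scaleX :: "real \<Rightarrow> state \<Rightarrow> state" where
  "scaleX c (a, f, g) = (c * a, \<lambda>x. c * f x, \<lambda>x. c * g x)"

fun diffX :: "state \<Rightarrow> state \<Rightarrow> state" where
  "diffX (a, f, g) (b, u, v) = (a - b, \<lambda>x. f x - u x, \<lambda>x. g x - v x)"


text \<open>
  \<open>W\<^sup>1\<^sup>,\<^sup>1(0,L)\<close> is defined through weak derivatives, tested against \<open>C\<^sup>1\<close> functions with compact
  support in the open interval. \<open>C1c L \<phi> \<phi>'\<close> says that \<open>\<phi>\<close> (extended by zero to the line) is such a
  test function and \<open>\<phi>'\<close> is its derivative.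
\<close>

definition C1c :: "real \<Rightarrow> (real \<Rightarrow> real) \<Rightarrow> (real \<Rightarrow> real) \<Rightarrow> bool" where
  "C1c L \<phi> \<phi>' \<longleftrightarrow>
     continuous_on UNIV \<phi>' \<and> (\<forall>x. (\<phi> has_real_derivative \<phi>' x) (at x)) \<and>
     (\<exists>a b. 0 < a \<and> b < L \<and> (\<forall>x. x \<notin> {a..b} \<longrightarrow> \<phi> x = 0))"

definition has_weak_deriv :: "real \<Rightarrow> (real \<Rightarrow> real) \<Rightarrow> (real \<Rightarrow> real) \<Rightarrow> bool" where
  "has_weak_deriv L f g \<longleftrightarrow>
     set_integrable lebesgue {0..L} g \<and>
     (\<forall>\<phi> \<phi>'. C1c L \<phi> \<phi>' \<longrightarrow>
        (LINT x:{0..L}|lebesgue. f x * \<phi>' x) = - (LINT x:{0..L}|lebesgue. g x * \<phi> x))"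

definition W11 :: "real \<Rightarrow> (real \<Rightarrow> real) set" where
  "W11 L = {f. set_integrable lebesgue {0..L} f \<and> (\<exists>g. has_weak_deriv L f g)}"

text \<open>For \<open>f\<close> in \<open>W11 L\<close> the weak derivative is determined almost everywhere.\<close>

definition weak_deriv :: "real \<Rightarrow> (real \<Rightarrow> real) \<Rightarrow> real \<Rightarrow> real" where
  "weak_deriv L f = (SOME g. has_weak_deriv L f g)"

text \<open>
  \<open>f(0)\<close> for \<open>f\<close> in \<open>W11 L\<close> is the value at \<open>0\<close> of the continuous representative of \<open>f\<close> on
  the closed interval.
\<close>

definition trace0 :: "real \<Rightarrow> (real \<Rightarrow> real) \<Rightarrow> real" where
  "trace0 L f = (THE c. \<exists>u. continuous_on {0..L} u \<and>
     (AE x\<in>{0..L} in lebesgue. f x = u x) \<and> u 0 = c)"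


definition domA ::
  "real \<Rightarrow> real \<Rightarrow> real \<Rightarrow> (real \<Rightarrow> real) \<Rightarrow> (real \<Rightarrow> real) \<Rightarrow> state set" where
  "domA L lam\<^sub>1 lam\<^sub>2 \<mu>\<^sub>1 \<mu>\<^sub>2 = {(p\<^sub>0, p\<^sub>1, p\<^sub>2).
     p\<^sub>1 \<in> W11 L \<and> p\<^sub>2 \<in> W11 L \<and>
     set_integrable lebesgue {0..L} (\<lambda>x. \<mu>\<^sub>1 x * p\<^sub>1 x) \<and>
     set_integrable lebesgue {0..L} (\<lambda>x. \<mu>\<^sub>2 x * p\<^sub>2 x) \<and>
     trace0 L p\<^sub>1 = lam\<^sub>1 * p\<^sub>0 \<and>
     trace0 L p\<^sub>2 = lam\<^sub>2 * p\<^sub>0 + lam\<^sub>2 * (LINT x:{0..L}|lebesgue. p\<^sub>1 x)}"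

fun opA ::
  "real \<Rightarrow> real \<Rightarrow> real \<Rightarrow> (real \<Rightarrow> real) \<Rightarrow> (real \<Rightarrow> real) \<Rightarrow> state \<Rightarrow> state" where
  "opA L lam\<^sub>1 lam\<^sub>2 \<mu>\<^sub>1 \<mu>\<^sub>2 (p\<^sub>0, p\<^sub>1, p\<^sub>2) =
     (- (lam\<^sub>1 + lam\<^sub>2) * p\<^sub>0 + (LINT x:{0..L}|lebesgue. \<mu>\<^sub>1 x * p\<^sub>1 x) + (LINT x:{0..L}|lebesgue. \<mu>\<^sub>2 x * p\<^sub>2 x),
      \<lambda>x. - weak_deriv L p\<^sub>1 x - (\<mu>\<^sub>1 x + lam\<^sub>2) * p\<^sub>1 x,
      \<lambda>x. - weak_deriv L p\<^sub>2 x - \<mu>\<^sub>2 x * p\<^sub>2 x)"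


text \<open>
  The operators \<open>T t\<close> act on representatives; linearity together with boundedness makes them
  compatible with \<open>eqX\<close>. Only \<open>t \<ge> 0\<close> matters.
\<close>

definition C0_semigroup :: "real \<Rightarrow> (real \<Rightarrow> state \<Rightarrow> state) \<Rightarrow> bool" where
  "C0_semigroup L T \<longleftrightarrow>
     (\<forall>t\<ge>0. \<forall>p\<in>spaceX L. T t p \<in> spaceX L) \<and>
     (\<forall>t\<ge>0. \<forall>p\<in>spaceX L. \<forall>q\<in>spaceX L. eqX L (T t (addX p q)) (addX (T t p) (T t q))) \<and>
     (\<forall>t\<ge>0. \<forall>c. \<forall>p\<in>spaceX L. eqX L (T t (scaleX c p)) (scaleX c (T t p))) \<and>
     (\<forall>t\<ge>0. \<exists>K. \<forall>p\<in>spaceX L. normX L (T t p) \<le> K * normX L p) \<and>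
     (\<forall>p\<in>spaceX L. eqX L (T 0 p) p) \<and>
     (\<forall>s\<ge>0. \<forall>t\<ge>0. \<forall>p\<in>spaceX L. eqX L (T (s + t) p) (T s (T t p))) \<and>
     (\<forall>p\<in>spaceX L. ((\<lambda>t. normX L (diffX (T t p) p)) \<longlongrightarrow> 0) (at_right 0))"

definition positive_semigroup :: "real \<Rightarrow> (real \<Rightarrow> state \<Rightarrow> state) \<Rightarrow> bool" where
  "positive_semigroup L T \<longleftrightarrow> (\<forall>t\<ge>0. \<forall>p\<in>spaceX L. nonnegX L p \<longrightarrow> nonnegX L (T t p))"

definition contraction_semigroup :: "real \<Rightarrow> (real \<Rightarrow> state \<Rightarrow> state) \<Rightarrow> bool" where
  "contraction_semigroup L T \<longleftrightarrow> (\<forall>t\<ge>0. \<forall>p\<in>spaceX L. normX L (T t p) \<le> normX L p)"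

text \<open>
  The generator of \<open>T\<close> is the operator \<open>A\<close> with domain \<open>D\<close>: the right derivative of \<open>T t p\<close> at
  \<open>t = 0\<close> exists in \<open>X\<close> exactly for \<open>p\<close> in \<open>D\<close>, and then equals \<open>A p\<close>.
\<close>

definition generates ::
  "real \<Rightarrow> state set \<Rightarrow> (state \<Rightarrow> state) \<Rightarrow> (real \<Rightarrow> state \<Rightarrow> state) \<Rightarrow> bool" where
  "generates L D A T \<longleftrightarrow>
     (\<forall>p\<in>spaceX L. \<forall>q\<in>spaceX L.
        ((\<lambda>h. normX L (diffX (scaleX (1 / h) (diffX (T h p) p)) q)) \<longlongrightarrow> 0) (at_right 0)
        \<longleftrightarrow> p \<in> D \<and> eqX L q (A p))"


definition survival1 :: "real \<Rightarrow> (real \<Rightarrow> real) \<Rightarrow> real \<Rightarrow> real" where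
  "survival1 lam\<^sub>2 \<mu>\<^sub>1 x = exp (- (LINT s:{0..x}|lebesgue. lam\<^sub>2 + \<mu>\<^sub>1 s))"

definition survival2 :: "(real \<Rightarrow> real) \<Rightarrow> real \<Rightarrow> real" where
  "survival2 \<mu>\<^sub>2 x = exp (- (LINT s:{0..x}|lebesgue. \<mu>\<^sub>2 s))"

definition steady_state ::
  "real \<Rightarrow> real \<Rightarrow> real \<Rightarrow> (real \<Rightarrow> real) \<Rightarrow> (real \<Rightarrow> real) \<Rightarrow> state" where
  "steady_state L lam\<^sub>1 lam\<^sub>2 \<mu>\<^sub>1 \<mu>\<^sub>2 =
     (let C\<^sub>0 = (LINT x:{0..L}|lebesgue. survival1 lam\<^sub>2 \<mu>\<^sub>1 x);
          C\<^sub>1 = (LINT x:{0..L}|lebesgue. survival2 \<mu>\<^sub>2 x);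
          p\<^sub>e\<^sub>0 = 1 / ((1 + lam\<^sub>1 * C\<^sub>0) * (1 + lam\<^sub>2 * C\<^sub>1))
      in (p\<^sub>e\<^sub>0,
          \<lambda>x. lam\<^sub>1 * p\<^sub>e\<^sub>0 * survival1 lam\<^sub>2 \<mu>\<^sub>1 x,
          \<lambda>x. lam\<^sub>2 * p\<^sub>e\<^sub>0 * survival2 \<mu>\<^sub>2 x
              + lam\<^sub>1 * lam\<^sub>2 * p\<^sub>e\<^sub>0 * survival2 \<mu>\<^sub>2 x * (LINT y:{0..L}|lebesgue. survival1 lam\<^sub>2 \<mu>\<^sub>1 y)))"

end

theory Submission
  imports Defs
begin

text \<open>
  While no failure clock rings, which has probability at least \<open>exp (- (lam\<^sub>1 + lam\<^sub>2) * 2 * L)\<close> over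
  a time span \<open>2 * L\<close>, every component under repair is repaired, since ages are bounded by \<open>L\<close>.
  Hence the semigroup operator at time \<open>2 * L\<close> maps each non-negative state of norm one to a state
  whose zeroth entry exceeds a fixed positive number (a Doeblin minorization). On the
  difference of two such states the operator is therefore a strict contraction, and iterating it
  yields exponential convergence to the invariant steady state. The minorization
  comes from pairing the orbit with an explicit subsolution of the backward equation; the resulting
  inequality is summed along the steps of an Euler scheme, first for initial states in the domain
  of the generator and then, by density, for all non-negative ones. Testing against weights is
  integration by parts, where the boundary term at \<open>L\<close> vanishes because \<open>\<mu>\<^sub>i p\<^sub>i\<close> is
  integrable and \<open>\<mu>\<^sub>i\<close> is not.
\<close>


subsection \<open>Integration by parts for primitives\<close>

text \<open>Two obstacles shape the proof. Elements of the domain are classes with weak derivatives,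
  and the boundary conditions speak of traces; the du Bois-Reymond lemma turns both into statements
  about primitives, where Fubini replaces the product rule. The rates are unbounded near
  \<open>L\<close>, so no estimate may depend on their size. Giving the zeroth entry the weight 1
  and the ages a weight below 1 lets repair enter with the sign of
  \<open>\<mu> * (1 - weight)\<close>, so it can be discarded in lower bounds however large it is.
  The weight has to be C^1 to be tested against, so the indicator of \<open>L \<le> s + x\<close>
  (\<open>s\<close> the remaining time) is replaced by a quadratic ramp that is zero up to
  \<open>L\<close> and one at \<open>3 * L\<close>. For ages in \<open>{0..L}\<close> it vanishes
  when no time is left and is at least 1/4 when \<open>2 * L\<close> is left. This is the origin of
  the time \<open>2 * L\<close> and of the factor 1/4 in the constant
  \<open>exp (- 2 * L * (l\<^sub>1 + l\<^sub>2)) / 4\<close>.\<close>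

lemma set_integrable_lebesgue_on:
  fixes f :: "real \<Rightarrow> real"
  assumes "S \<in> sets lebesgue"
  shows "set_integrable lebesgue S f \<longleftrightarrow> integrable (lebesgue_on S) f"
  using assms by (simp add: set_integrable_def integrable_restrict_space)

lemma set_integral_lebesgue_on:
  fixes f :: "real \<Rightarrow> real"
  assumes "S \<in> sets lebesgue"
  shows "(LINT x:S|lebesgue. f x) = integral\<^sup>L (lebesgue_on S) f"
  using assms by (simp add: set_lebesgue_integral_def integral_restrict_space)

lemma AE_lebesgue_on:
  assumes "S \<in> sets lebesgue"
  shows "(AE x\<in>S in lebesgue. P x) \<longleftrightarrow> (AE x in lebesgue_on S. P x)"
  using assms by (simp add: AE_restrict_space_iff)

lemma AE_lebesgue_on_Icc:
  fixes a b :: real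
  shows "(AE x\<in>{a..b} in lebesgue. P x) \<longleftrightarrow> (AE x in lebesgue_on {a..b}. P x)"
  by (rule AE_lebesgue_on) simp

lemma integrable_continuous_mult:
  fixes f w :: "real \<Rightarrow> real"
  assumes f: "integrable (lebesgue_on {a..b}) f" and w: "continuous_on {a..b} w"
  shows "integrable (lebesgue_on {a..b}) (\<lambda>x. w x * f x)"
proof -
  have "bounded (w ` {a..b})"
    using w compact_continuous_image compact_imp_bounded by blast
  then obtain B where B: "\<And>x. x \<in> {a..b} \<Longrightarrow> \<bar>w x\<bar> \<le> B"
    unfolding bounded_iff by (metis imageI real_norm_def)
  have [measurable]: "w \<in> borel_measurable (lebesgue_on {a..b})"
    using w by (simp add: continuous_imp_measurable_on_sets_lebesgue)
  have [measurable]: "f \<in> borel_measurable (lebesgue_on {a..b})"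
    using f by simp
  show ?thesis
  proof (rule Bochner_Integration.integrable_bound[where f="\<lambda>x. B * f x"])
    show "AE x in lebesgue_on {a..b}. norm (w x * f x) \<le> norm (B * f x)"
    proof (rule AE_I2)
      fix x assume "x \<in> space (lebesgue_on {a..b})"
      then have "\<bar>w x\<bar> \<le> \<bar>B\<bar>" using B[of x] by fastforce
      then show "norm (w x * f x) \<le> norm (B * f x)"
        by (simp add: abs_mult mult_right_mono)
    qed
  qed (use f in auto)
qed

lemma integral_indicator_lebesgue_on:
  fixes f :: "real \<Rightarrow> real"
  assumes "T \<subseteq> S" "S \<in> sets lebesgue" "T \<in> sets lebesgue"
  shows "(LINT x|lebesgue_on S. indicator T x * f x) = (LINT x|lebesgue_on T. f x)"
proof -
  have *: "(\<lambda>x. indicator S x *\<^sub>R (indicator T x * f x)) = (\<lambda>x. indicator T x *\<^sub>R f x)"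
    using assms(1) by (auto simp: fun_eq_iff split: split_indicator)
  show ?thesis
    using assms(2,3) by (simp only: integral_restrict_space sets.Int_space_eq2 *)
qed

lemma integrable_indicator_lebesgue_on:
  fixes f :: "real \<Rightarrow> real"
  assumes "T \<subseteq> S" "S \<in> sets lebesgue" "T \<in> sets lebesgue" and f: "integrable (lebesgue_on T) f"
  shows "integrable (lebesgue_on S) (\<lambda>x. indicator T x * f x)"
proof -
  have *: "(\<lambda>x. indicator S x *\<^sub>R (indicator T x * f x)) = (\<lambda>x. indicator T x *\<^sub>R f x)"
    using assms(1) by (auto simp: fun_eq_iff split: split_indicator)
  show ?thesis
    using f assms(2,3) by (simp only: integrable_restrict_space sets.Int_space_eq2 *)
qed

lemma integral_FTC_lebesgue_on:
  fixes w w' :: "real \<Rightarrow> real"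
  assumes "a \<le> b" "\<And>x. x \<in> {a..b} \<Longrightarrow> (w has_real_derivative w' x) (at x within {a..b})"
    and "continuous_on {a..b} w'"
  shows "(LINT x|lebesgue_on {a..b}. w' x) = w b - w a"
proof -
  have "(w' has_integral (w b - w a)) {a..b}"
    using assms by (intro fundamental_theorem_of_calculus)
      (auto simp: has_real_derivative_iff_has_vector_derivative)
  then show ?thesis
    using assms(3) continuous_imp_integrable_real[of a b w']
    by (simp add: lebesgue_integral_eq_integral integral_unique)
qed

text \<open>Fubini on the triangle \<open>y \<le> x\<close> of the square: for fixed
  \<open>y\<close> the inner integral of \<open>w'\<close> over \<open>{y..b}\<close> is
  \<open>w b - w y\<close>. All smoothness sits on \<open>w\<close>; \<open>g\<close> is merely
  integrable.\<close>

lemma integral_by_parts_primitive: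
  fixes g w w' :: "real \<Rightarrow> real"
  assumes ab: "a \<le> b" and g: "integrable (lebesgue_on {a..b}) g"
    and w: "\<And>x. x \<in> {a..b} \<Longrightarrow> (w has_real_derivative w' x) (at x within {a..b})"
    and w': "continuous_on {a..b} w'"
  shows "(LINT x|lebesgue_on {a..b}. w' x * (LINT y|lebesgue_on {a..x}. g y))
    = w b * (LINT y|lebesgue_on {a..b}. g y) - (LINT x|lebesgue_on {a..b}. w x * g x)"
proof -
  define M where "M = lebesgue_on {a..b}"
  interpret M: finite_measure M
    unfolding M_def by (rule finite_measure_lebesgue_on) simp
  interpret P: pair_sigma_finite M M ..
  have cw: "continuous_on {a..b} w"
    using w by (meson DERIV_continuous continuous_on_eq_continuous_within)
  have sp: "space M = {a..b}" by (simp add: M_def)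
  have gi: "integrable M g" and w'i: "integrable M w'"
    using g w' by (simp_all add: M_def continuous_imp_integrable_real)
  \<comment> \<open>The factors carry the completed sigma-algebra, so the projections become
    real-valued measurable functions only after composition with this identity.\<close>
  have idm: "(\<lambda>x. x) \<in> borel_measurable M"
    unfolding M_def by (intro continuous_imp_measurable_on_sets_lebesgue) auto
  have m1 [measurable]: "fst \<in> borel_measurable (M \<Otimes>\<^sub>M M)" "snd \<in> borel_measurable (M \<Otimes>\<^sub>M M)"
    using measurable_comp[OF measurable_fst idm, of M] measurable_comp[OF measurable_snd idm, of M]
    by (simp_all add: o_def)
  have [measurable]: "g \<in> borel_measurable M" "w' \<in> borel_measurable M"
    using gi w'i by auto
  have prodi: "integrable (M \<Otimes>\<^sub>M M) (\<lambda>p. w' (fst p) * g (snd p))"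
  proof (rule P.Fubini_integrable)
    show "integrable M (\<lambda>x. \<integral>y. norm (w' (fst (x, y)) * g (snd (x, y))) \<partial>M)"
      using w'i by (simp add: abs_mult)
  qed (use gi in \<open>auto simp: case_prod_unfold\<close>)
  define h where "h = (\<lambda>x y. of_bool (y \<le> x) * (w' x * g y))"
  have hi: "integrable (M \<Otimes>\<^sub>M M) (case_prod h)"
    by (rule Bochner_Integration.integrable_bound[OF prodi])
      (auto simp: h_def case_prod_unfold)
  have "(LINT x|M. w' x * (LINT y|lebesgue_on {a..x}. g y)) = (LINT x|M. LINT y|M. h x y)"
  proof (rule Bochner_Integration.integral_cong[OF refl])
    fix x assume "x \<in> space M"
    then have x: "{a..x} \<subseteq> {a..b}" by (auto simp: sp)
    have "(LINT y|M. h x y) = w' x * (LINT y|M. indicator {a..x} y * g y)"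
      unfolding integral_mult_right_zero[symmetric]
      by (rule Bochner_Integration.integral_cong[OF refl]) (auto simp: h_def sp)
    then show "w' x * (LINT y|lebesgue_on {a..x}. g y) = (LINT y|M. h x y)"
      using integral_indicator_lebesgue_on[OF x, of g] by (simp add: M_def)
  qed
  also have "\<dots> = (LINT y|M. LINT x|M. h x y)"
    using P.Fubini_integral[OF hi] by simp
  also have "\<dots> = (LINT y|M. w b * g y - w y * g y)"
  proof (rule Bochner_Integration.integral_cong[OF refl])
    fix y assume "y \<in> space M"
    then have y: "a \<le> y" "y \<le> b" and ys: "{y..b} \<subseteq> {a..b}" by (auto simp: sp)
    have "(LINT x|M. h x y) = (LINT x|M. indicator {y..b} x * w' x) * g y"
      unfolding integral_mult_left_zero[symmetric]
      by (rule Bochner_Integration.integral_cong[OF refl]) (auto simp: h_def sp)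
    also have "(LINT x|M. indicator {y..b} x * w' x) = (LINT x|lebesgue_on {y..b}. w' x)"
      using integral_indicator_lebesgue_on[OF ys, of w'] by (simp add: M_def)
    also have "\<dots> = w b - w y"
      by (rule integral_FTC_lebesgue_on[OF y(2)])
        (use w w' ys y in \<open>auto intro: has_field_derivative_subset[of w _ _ "{a..b}"] continuous_on_subset\<close>)
    finally show "(LINT x|M. h x y) = w b * g y - w y * g y"
      by (simp add: algebra_simps)
  qed
  also have "\<dots> = w b * (LINT y|M. g y) - (LINT y|M. w y * g y)"
    using gi integrable_continuous_mult[OF g cw] by (simp add: M_def)
  finally show ?thesis by (simp add: M_def)
qed


subsection \<open>Approximation in the mean by continuous functions\<close>

text \<open>Only continuity is asked, so that truncations such as \<open>max 0\<close> stay in the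
  class; the passage to C^1 functions is left to \<open>C1c_approx\<close>. No order of
  \<open>c\<close> and \<open>d\<close> is imposed: an empty \<open>{c..d}\<close> just means the
  zero function.\<close>

definition compact_supp_cont :: "real \<Rightarrow> real \<Rightarrow> (real \<Rightarrow> real) \<Rightarrow> bool" where
  "compact_supp_cont a b \<psi> \<longleftrightarrow> continuous_on UNIV \<psi> \<and>
     (\<exists>c d. a < c \<and> d < b \<and> (\<forall>x. x \<notin> {c..d} \<longrightarrow> \<psi> x = 0))"

lemma compact_supp_cont_add:
  assumes "compact_supp_cont a b \<psi>" "compact_supp_cont a b \<xi>"
  shows "compact_supp_cont a b (\<lambda>x. \<psi> x + \<xi> x)"
proof -
  obtain c d c' d' where *: "a < c" "d < b" "a < c'" "d' < b"
    and 0: "\<And>x. x \<notin> {c..d} \<Longrightarrow> \<psi> x = 0" "\<And>x. x \<notin> {c'..d'} \<Longrightarrow> \<xi> x = 0"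
    using assms unfolding compact_supp_cont_def by metis
  have "\<psi> x + \<xi> x = 0" if "x \<notin> {min c c'..max d d'}" for x
    using that 0[of x] by (auto simp: min_def max_def split: if_splits)
  moreover have "a < min c c'" "max d d' < b" using * by auto
  ultimately show ?thesis
    using assms unfolding compact_supp_cont_def by (blast intro: continuous_on_add)
qed

lemma compact_supp_cont_comp:
  assumes "compact_supp_cont a b \<psi>" "continuous_on UNIV k" "k 0 = 0"
  shows "compact_supp_cont a b (\<lambda>x. k (\<psi> x))"
proof -
  have "continuous_on UNIV (\<lambda>x. k (\<psi> x))"
    using assms unfolding compact_supp_cont_def
    by (metis continuous_on_compose2 subset_UNIV)
  then show ?thesis
    using assms unfolding compact_supp_cont_def by metis
qed

lemma compact_supp_cont_integrable:
  "compact_supp_cont a b \<psi> \<Longrightarrow> integrable (lebesgue_on {c..d}) \<psi>"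
  unfolding compact_supp_cont_def
  by (intro continuous_imp_integrable_real) (auto intro: continuous_on_subset)

text \<open>Inner regularity yields a closed \<open>T\<close> inside the part of \<open>A\<close> in
  the open interval, with small loss of measure. The tents
  \<open>max 0 (1 - n * infdist x T)\<close> decrease to the indicator of \<open>T\<close>, so
  dominated convergence applies; being compact, \<open>T\<close> keeps a distance from
  \<open>a\<close> and \<open>b\<close>, which confines the supports for large
  \<open>n\<close>.\<close>

lemma L1_approx_indicator:
  assumes ab: "a < b" and A: "A \<in> sets (lebesgue_on {a..b})" and e: "e > 0"
  shows "\<exists>\<psi>. compact_supp_cont a b \<psi> \<and> (LINT x|lebesgue_on {a..b}. \<bar>indicator A x - \<psi> x\<bar>) < e"
proof -
  define M where "M = lebesgue_on {a..b}"
  interpret M: finite_measure M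
    unfolding M_def by (rule finite_measure_lebesgue_on) simp
  have Al: "A \<in> sets lebesgue" and Aab: "A \<subseteq> {a..b}"
    using A by (auto simp: sets_restrict_space)
  define A' where "A' = A \<inter> {a<..<b}"
  have A'l: "A' \<in> sets lebesgue" using Al unfolding A'_def by (intro sets.Int) auto
  obtain T where T: "closed T" "T \<subseteq> A'" "A' - T \<in> lmeasurable" "emeasure lebesgue (A' - T) < ennreal (e/2)"
    using sets_lebesgue_inner_closed[OF A'l, of "e/2"] e by auto
  have Tl: "T \<in> sets lebesgue" using T(1) by (simp add: borel_closed)
  have A'M: "A' \<in> sets M" and TM: "T \<in> sets M"
    using A'l Tl T(2) by (auto simp: M_def sets_restrict_space_iff A'_def)
  have [measurable]: "A \<in> sets M" "A' \<in> sets M" "T \<in> sets M"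
    using A A'M TM by (auto simp: M_def)
  have AA': "AE x in M. indicator A x = (indicator A' x :: real)"
  proof -
    have "AE x in lebesgue. x \<noteq> a \<and> x \<noteq> b"
      by (intro AE_conjI AE_completion AE_lborel_singleton)
    then have "AE x in M. x \<noteq> a \<and> x \<noteq> b"
      unfolding M_def by (subst AE_restrict_space_iff) auto
    then show ?thesis
    proof eventually_elim
      fix x assume "x \<noteq> a \<and> x \<noteq> b"
      then show "indicator A x = (indicator A' x :: real)"
        using Aab by (fastforce simp: A'_def indicator_def)
    qed
  qed
  have AT: "(LINT x|M. \<bar>indicator A x - indicator T x\<bar>) < e/2"
  proof -
    have "(LINT x|M. \<bar>indicator A x - indicator T x\<bar>) = (LINT x|M. indicator (A' - T) x :: real)"
      proof (rule integral_cong_AE)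
      show "AE x in M. \<bar>indicator A x - indicator T x\<bar> = (indicator (A' - T) x :: real)"
        using AA' by eventually_elim (use T(2) in \<open>auto split: split_indicator\<close>)
    qed auto
    also have "\<dots> = measure lebesgue (A' - T)"
      using measure_restrict_space[of "{a..b}" lebesgue "A' - T"] A'M TM
      by (simp add: M_def A'_def Int_absorb2 subset_iff)
    also have "\<dots> < e/2"
      using T(4) emeasure_eq_measure2[OF T(3)] by (simp add: ennreal_less_iff)
    finally show ?thesis .
  qed
  show ?thesis
  proof (cases "T = {}")
    case True
    have "compact_supp_cont a b (\<lambda>x. 0)"
      using ab by (auto simp: compact_supp_cont_def intro!: exI[of _ "(a+b)/2"])
    then show ?thesis using AT True e by (intro exI[of _ "\<lambda>x. 0"]) (simp add: M_def)
  next
    case False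
    have "compact T"
      using T(1,2) bounded_subset[of "{a..b}" T] by (force simp: compact_eq_bounded_closed A'_def)
    then obtain s t where st: "s \<in> T" "t \<in> T" "\<And>x. x \<in> T \<Longrightarrow> s \<le> x \<and> x \<le> t"
      using compact_attains_inf[of T] compact_attains_sup[of T] False by metis
    have sab: "a < s" "t < b" using st T(2) by (auto simp: A'_def)
    define \<psi> where "\<psi> = (\<lambda>(n::nat) x. max 0 (1 - real n * infdist x T))"
    have \<psi>c: "continuous_on S (\<psi> n)" for n S
      unfolding \<psi>_def by (intro continuous_intros)
    have \<psi>b: "\<bar>\<psi> n x\<bar> \<le> 1" for n x
      by (auto simp: \<psi>_def infdist_nonneg)
    have lim: "(\<lambda>n. \<psi> n x) \<longlonglongrightarrow> indicator T x" for x
    proof (cases "x \<in> T")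
      case False
      then have p: "infdist x T > 0"
        using T(1) \<open>T \<noteq> {}\<close> infdist_pos_not_in_closed by blast
      obtain n0 :: nat where "1 / infdist x T < n0" using reals_Archimedean2 by blast
      then have "\<psi> n x = 0" if "n \<ge> n0" for n
      proof -
        have "1 / infdist x T \<le> real n" using that \<open>1 / infdist x T < n0\<close> by linarith
        then show ?thesis using p by (auto simp: \<psi>_def field_simps)
      qed
      then show ?thesis
        using False by (intro tendsto_eventually) (auto simp: eventually_sequentially)
    qed (simp add: \<psi>_def)
    have [measurable]: "\<psi> n \<in> borel_measurable M" for n
      unfolding M_def by (intro continuous_imp_measurable_on_sets_lebesgue \<psi>c) auto
    have "(\<lambda>n. LINT x|M. \<bar>indicator A x - \<psi> n x\<bar>) \<longlonglongrightarrow> (LINT x|M. \<bar>indicator A x - indicator T x\<bar>)"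
    proof (rule integral_dominated_convergence[where w="\<lambda>_. 2"])
      show "AE x in M. norm \<bar>indicat_real A x - \<psi> n x\<bar> \<le> 2" for n
      proof (rule AE_I2)
        fix x show "norm \<bar>indicat_real A x - \<psi> n x\<bar> \<le> 2"
          using \<psi>b[of n x] by (auto split: split_indicator)
      qed
    qed (auto intro!: tendsto_intros lim)
    then have "\<forall>\<^sub>F n in sequentially. (LINT x|M. \<bar>indicator A x - \<psi> n x\<bar>) < e"
      by (rule order_tendstoD(2)) (use AT e in linarith)
    moreover have "\<forall>\<^sub>F n in sequentially. compact_supp_cont a b (\<psi> n)"
    proof -
      \<comment> \<open>Half of the smaller gap between \<open>T\<close> and the end points. Outside
        \<open>{(a+s)/2..(b+t)/2}\<close> the distance to \<open>T\<close> is at least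
        \<open>\<eta>\<close>, so the tent is zero there once
        \<open>n \<ge> 1 / \<eta>\<close>.\<close>
      define \<eta> where "\<eta> = min ((s - a)/2) ((b - t)/2)"
      have \<eta>: "\<eta> > 0" using sab by (simp add: \<eta>_def)
      obtain n0 :: nat where n0: "1 / \<eta> < n0" using reals_Archimedean2 by blast
      have "compact_supp_cont a b (\<psi> n)" if n: "n \<ge> n0" for n
      proof -
        have "\<psi> n x = 0" if x: "x \<notin> {(a+s)/2..(b+t)/2}" for x
        proof -
          have "\<eta> \<le> dist x y" if "y \<in> T" for y
          proof -
            have "(s - a)/2 \<le> y - x \<or> (b - t)/2 \<le> x - y"
              using x st(3)[OF that] by (auto simp: field_simps)
            moreover have "\<eta> \<le> (s - a)/2" "\<eta> \<le> (b - t)/2"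
              unfolding \<eta>_def by (rule min.cobounded1, rule min.cobounded2)
            ultimately show ?thesis unfolding dist_real_def by linarith
          qed
          then have "\<eta> \<le> infdist x T"
            using False by (auto simp: infdist_def intro!: cINF_greatest)
          moreover have "1 \<le> real n * \<eta>"
          proof -
            have "1 / \<eta> \<le> real n" using n n0 by linarith
            then show ?thesis using \<eta> by (simp add: field_simps)
          qed
          ultimately have "1 \<le> real n * infdist x T"
            by (meson mult_left_mono of_nat_0_le_iff order_trans)
          then show ?thesis by (simp add: \<psi>_def)
        qed
        then show ?thesis
          unfolding compact_supp_cont_def using sab \<psi>c by (intro conjI exI[of _ "(a+s)/2"] exI[of _ "(b+t)/2"]) auto
      qed
      then show ?thesis by (auto simp: eventually_sequentially)
    qed
    ultimately have "\<forall>\<^sub>F n in sequentially. compact_supp_cont a b (\<psi> n) \<and> (LINT x|M. \<bar>indicator A x - \<psi> n x\<bar>) < e"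
      by eventually_elim auto
    then show ?thesis unfolding M_def using eventually_happens'[OF sequentially_bot] by blast
  qed
qed

lemma L1_approx_continuous:
  assumes ab: "a < b" and f: "integrable (lebesgue_on {a..b}) f" and e: "e > 0"
  shows "\<exists>\<psi>. compact_supp_cont a b \<psi> \<and> (LINT x|lebesgue_on {a..b}. \<bar>f x - \<psi> x\<bar>) < e"
  using f e
proof (induction f arbitrary: e rule: integrable_induct)
  case (base A c)
  \<comment> \<open>The divisor \<open>\<bar>c\<bar> + 1\<close> instead of
    \<open>\<bar>c\<bar>\<close> also covers \<open>c = 0\<close>.\<close>
  obtain \<psi> where \<psi>: "compact_supp_cont a b \<psi>"
    "(LINT x|lebesgue_on {a..b}. \<bar>indicator A x - \<psi> x\<bar>) < e / (\<bar>c\<bar> + 1)"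
    using L1_approx_indicator[OF ab base(1), of "e / (\<bar>c\<bar> + 1)"] base by auto
  have "(LINT x|lebesgue_on {a..b}. \<bar>indicator A x *\<^sub>R c - c * \<psi> x\<bar>)
    = \<bar>c\<bar> * (LINT x|lebesgue_on {a..b}. \<bar>indicator A x - \<psi> x\<bar>)"
    unfolding integral_mult_right_zero[symmetric]
    by (rule Bochner_Integration.integral_cong[OF refl]) (simp add: abs_mult[symmetric] algebra_simps)
  also have "\<dots> \<le> (\<bar>c\<bar> + 1) * (LINT x|lebesgue_on {a..b}. \<bar>indicator A x - \<psi> x\<bar>)"
    by (intro mult_right_mono) auto
  also have "\<dots> < e" using \<psi>(2) by (simp add: field_simps)
  finally show ?case
    using compact_supp_cont_comp[OF \<psi>(1), of "\<lambda>x. c * x"]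
    by (intro exI[of _ "\<lambda>x. c * \<psi> x"]) (auto intro!: continuous_intros)
next
  case (add f g)
  obtain \<psi> \<xi> where \<psi>: "compact_supp_cont a b \<psi>" "(LINT x|lebesgue_on {a..b}. \<bar>f x - \<psi> x\<bar>) < e/2"
    and \<xi>: "compact_supp_cont a b \<xi>" "(LINT x|lebesgue_on {a..b}. \<bar>g x - \<xi> x\<bar>) < e/2"
    using add(3,4) add.prems half_gt_zero by metis
  note [simp] = add(1,2) compact_supp_cont_integrable[OF \<psi>(1)] compact_supp_cont_integrable[OF \<xi>(1)]
  have "(LINT x|lebesgue_on {a..b}. \<bar>f x + g x - (\<psi> x + \<xi> x)\<bar>)
    \<le> (LINT x|lebesgue_on {a..b}. \<bar>f x - \<psi> x\<bar> + \<bar>g x - \<xi> x\<bar>)"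
    by (intro integral_mono) auto
  also have "\<dots> < e" using \<psi>(2) \<xi>(2) by simp
  finally show ?case using compact_supp_cont_add[OF \<psi>(1) \<xi>(1)] by blast
next
  case (lim f s)
  note [simp] = lim.hyps(1,4)
  have [measurable]: "f \<in> borel_measurable (lebesgue_on {a..b})"
    "\<And>i. s i \<in> borel_measurable (lebesgue_on {a..b})"
    by (rule borel_measurable_integrable, fact)+
  have "(\<lambda>i. LINT x|lebesgue_on {a..b}. \<bar>f x - s i x\<bar>) \<longlonglongrightarrow> (LINT x|lebesgue_on {a..b}. 0)"
  proof (rule integral_dominated_convergence[where w="\<lambda>x. 3 * \<bar>f x\<bar>"])
    show "AE x in lebesgue_on {a..b}. (\<lambda>i. \<bar>f x - s i x\<bar>) \<longlonglongrightarrow> 0"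
    proof (rule AE_I2)
      fix x assume "x \<in> space (lebesgue_on {a..b})"
      from tendsto_rabs[OF tendsto_diff[OF tendsto_const[of "f x"] lim.hyps(2)[OF this]]]
      show "(\<lambda>i. \<bar>f x - s i x\<bar>) \<longlonglongrightarrow> 0" by simp
    qed
    show "AE x in lebesgue_on {a..b}. norm \<bar>f x - s i x\<bar> \<le> 3 * \<bar>f x\<bar>" for i
      by (rule AE_I2) (use lim.hyps(3)[of _ i] in fastforce)
  qed auto
  then have "\<forall>\<^sub>F i in sequentially. (LINT x|lebesgue_on {a..b}. \<bar>f x - s i x\<bar>) < e/2"
    using lim.prems by (intro order_tendstoD(2)) auto
  then obtain i where i: "(LINT x|lebesgue_on {a..b}. \<bar>f x - s i x\<bar>) < e/2"
    using eventually_happens'[OF sequentially_bot] by blast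
  obtain \<psi> where \<psi>: "compact_supp_cont a b \<psi>" "(LINT x|lebesgue_on {a..b}. \<bar>s i x - \<psi> x\<bar>) < e/2"
    using lim.IH[of "e/2" i] lim.prems by auto
  note [simp] = compact_supp_cont_integrable[OF \<psi>(1)]
  have "(LINT x|lebesgue_on {a..b}. \<bar>f x - \<psi> x\<bar>)
    \<le> (LINT x|lebesgue_on {a..b}. \<bar>f x - s i x\<bar> + \<bar>s i x - \<psi> x\<bar>)"
    by (intro integral_mono) auto
  also have "\<dots> < e" using \<psi>(2) i by simp
  finally show ?case using \<psi>(1) by blast
qed

text \<open>The sign of \<open>h\<close> is an L^1 limit, hence along a subsequence an almost
  everywhere limit, of test functions. Clipping them to \<open>[-1,1]\<close> by \<open>k\<close>
  fixes the values of \<open>sgn\<close>, keeps them test functions since \<open>k 0 = 0\<close>,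
  and makes \<open>\<bar>h\<bar>\<close> a dominating function; the limit of the vanishing integrals
  is the integral of \<open>\<bar>h\<bar>\<close>.\<close>

lemma AE_zero_if_integral_test_zero:
  assumes ab: "a < b" and h: "integrable (lebesgue_on {a..b}) h"
    and 0: "\<And>\<psi>. compact_supp_cont a b \<psi> \<Longrightarrow> (LINT x|lebesgue_on {a..b}. h x * \<psi> x) = 0"
  shows "AE x in lebesgue_on {a..b}. h x = 0"
proof -
  define M where "M = lebesgue_on {a..b}"
  interpret M: finite_measure M
    unfolding M_def by (rule finite_measure_lebesgue_on) simp
  have hM [simp]: "integrable M h" using h by (simp add: M_def)
  then have [measurable]: "h \<in> borel_measurable M" by (rule borel_measurable_integrable)
  have sg [simp]: "integrable M (\<lambda>x. sgn (h x))"
    by (rule M.integrable_const_bound[where B=1]) (auto simp: sgn_real_def)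
  have "\<exists>\<psi>. compact_supp_cont a b \<psi> \<and> (LINT x|M. \<bar>sgn (h x) - \<psi> x\<bar>) < 1 / real (Suc n)" for n
    using L1_approx_continuous[OF ab sg[unfolded M_def], of "1 / real (Suc n)"] by (auto simp: M_def)
  then obtain \<psi> where \<psi>: "\<And>n. compact_supp_cont a b (\<psi> n)"
    "\<And>n. (LINT x|M. \<bar>sgn (h x) - \<psi> n x\<bar>) < 1 / real (Suc n)"
    by metis
  have \<psi>i [simp]: "integrable M (\<psi> n)" for n
    using compact_supp_cont_integrable[OF \<psi>(1)] by (simp add: M_def)
  then have [measurable]: "\<psi> n \<in> borel_measurable M" for n by (rule borel_measurable_integrable)
  have "(\<lambda>n. LINT x|M. norm (sgn (h x) - \<psi> n x)) \<longlonglongrightarrow> 0"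
  proof (rule tendsto_sandwich[OF _ _ tendsto_const LIMSEQ_inverse_real_of_nat])
    show "\<forall>\<^sub>F n in sequentially. (LINT x|M. norm (sgn (h x) - \<psi> n x)) \<le> inverse (real (Suc n))"
      using \<psi>(2) by (intro always_eventually) (auto simp: inverse_eq_divide less_imp_le)
  qed auto
  then obtain r :: "nat \<Rightarrow> nat" where r: "AE x in M. (\<lambda>n. sgn (h x) - \<psi> (r n) x) \<longlonglongrightarrow> 0"
    using tendsto_L1_AE_subseq[of M "\<lambda>n x. sgn (h x) - \<psi> n x"] by auto
  define k :: "real \<Rightarrow> real" where "k = (\<lambda>y. max (-1) (min 1 y))"
  have kc: "continuous_on UNIV k" unfolding k_def by (intro continuous_intros)
  have [measurable]: "k \<in> borel_measurable borel" using kc by (rule borel_measurable_continuous_onI)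
  have "(\<lambda>n. LINT x|M. h x * k (\<psi> (r n) x)) \<longlonglongrightarrow> (LINT x|M. \<bar>h x\<bar>)"
  proof (rule integral_dominated_convergence[where w="\<lambda>x. \<bar>h x\<bar>"])
    show "AE x in M. (\<lambda>n. h x * k (\<psi> (r n) x)) \<longlonglongrightarrow> \<bar>h x\<bar>"
      using r
    proof eventually_elim
      fix x assume "(\<lambda>n. sgn (h x) - \<psi> (r n) x) \<longlonglongrightarrow> 0"
      from tendsto_diff[OF tendsto_const[of "sgn (h x)"] this]
      have "(\<lambda>n. \<psi> (r n) x) \<longlonglongrightarrow> sgn (h x)" by simp
      then have "(\<lambda>n. k (\<psi> (r n) x)) \<longlonglongrightarrow> k (sgn (h x))"
        using kc by (auto intro: continuous_on_tendsto_compose)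
      moreover have "h x * k (sgn (h x)) = \<bar>h x\<bar>" by (auto simp: k_def sgn_real_def)
      ultimately show "(\<lambda>n. h x * k (\<psi> (r n) x)) \<longlonglongrightarrow> \<bar>h x\<bar>"
        using tendsto_mult[OF tendsto_const[of "h x"]] by metis
    qed
    have "\<bar>h x * k y\<bar> \<le> \<bar>h x\<bar>" for x y
      using mult_left_mono[of "\<bar>k y\<bar>" 1 "\<bar>h x\<bar>"] by (auto simp: k_def abs_mult)
    then show "AE x in M. norm (h x * k (\<psi> (r n) x)) \<le> \<bar>h x\<bar>" for n by auto
  qed auto
  moreover have "(LINT x|M. h x * k (\<psi> (r n) x)) = 0" for n
    using 0[OF compact_supp_cont_comp[OF \<psi>(1) kc]] by (simp add: M_def k_def)
  ultimately have "(LINT x|M. \<bar>h x\<bar>) = 0"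
    by (simp add: LIMSEQ_const_iff)
  then have "AE x in M. h x = 0"
    using integral_nonneg_eq_0_iff_AE[of M "\<lambda>x. \<bar>h x\<bar>"] by simp
  then show ?thesis by (simp only: M_def)
qed


subsection \<open>Weak derivatives\<close>

text \<open>The antiderivative that is zero at 0 is also zero at \<open>L\<close> because the mean
  is zero. It is constant to the left and to the right of the support of \<open>\<psi>\<close>,
  hence zero on both sides.\<close>

lemma compact_supp_cont_antiderivative:
  assumes \<psi>: "compact_supp_cont 0 L \<psi>" and L: "0 < L"
    and 0: "(LINT x|lebesgue_on {0..L}. \<psi> x) = 0"
  shows "\<exists>\<phi>. C1c L \<phi> \<psi> \<and> \<phi> 0 = 0 \<and> \<phi> L = 0"
proof -
  obtain c d where cd: "0 < c" "d < L" "\<And>x. x \<notin> {c..d} \<Longrightarrow> \<psi> x = 0"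
    and cont: "continuous_on UNIV \<psi>"
    using \<psi> unfolding compact_supp_cont_def by metis
  have "isCont \<psi> x" for x using cont by (simp add: continuous_on_eq_continuous_at)
  then obtain F where F: "\<And>x. (F has_real_derivative \<psi> x) (at x)"
    using einterval_antiderivative[of "-\<infinity>" "\<infinity>" \<psi>]
    by (auto simp: has_real_derivative_iff_has_vector_derivative)
  define \<phi> where "\<phi> = (\<lambda>x. F x - F 0)"
  have D: "(\<phi> has_real_derivative \<psi> x) (at x)" for x
    unfolding \<phi>_def by (auto intro!: derivative_eq_intros F)
  have "\<phi> L - \<phi> 0 = 0"
    using integral_FTC_lebesgue_on[of 0 L \<phi> \<psi>] L 0 D cont
    by (auto intro: has_field_derivative_at_within continuous_on_subset)
  then have L0: "\<phi> L = 0" "\<phi> 0 = 0" by (simp_all add: \<phi>_def)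
  have const: "\<phi> x = \<phi> y" if xy: "x < y" and z: "\<And>z. x < z \<Longrightarrow> z < y \<Longrightarrow> \<psi> z = 0" for x y
    using MVT2[OF xy, of \<phi> \<psi>] D z by force
  have "\<phi> x = 0" if x: "x \<notin> {min c (L/2)..max d (L/2)}" for x
  proof (cases "x < min c (L/2)")
    case True
    show ?thesis
      using const[of x 0] const[of 0 x] L0 True cd by (cases x "0::real" rule: linorder_cases) auto
  next
    case False
    then have "x > d" "x > L/2" using x by auto
    then show ?thesis
      using const[of x L] const[of L x] L0 cd L by (cases x L rule: linorder_cases) auto
  qed
  moreover have "0 < min c (L/2)" "max d (L/2) < L" using L cd by auto
  ultimately have "C1c L \<phi> \<psi>"
    unfolding C1c_def using cont D by blast
  then show ?thesis using L0 by blast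
qed

lemma C1c_endpoints:
  assumes "C1c L \<phi> \<phi>'"
  shows "\<phi> 0 = 0" "\<phi> L = 0"
  using assms unfolding C1c_def by force+

lemma C1c_compact_supp_cont:
  assumes "C1c L \<phi> \<phi>'"
  shows "compact_supp_cont 0 L \<phi>"
  using assms unfolding C1c_def compact_supp_cont_def
  by (meson DERIV_isCont continuous_at_imp_continuous_on)

lemma C1c_integral_by_parts:
  assumes L: "0 < L" and \<phi>: "C1c L \<phi> \<phi>'" and g: "integrable (lebesgue_on {0..L}) g"
  shows "(LINT x|lebesgue_on {0..L}. \<phi>' x * (LINT y|lebesgue_on {0..x}. g y))
    = - (LINT x|lebesgue_on {0..L}. \<phi> x * g x)"
proof -
  have "(\<phi> has_real_derivative \<phi>' x) (at x within {0..L})" for x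
    using \<phi> unfolding C1c_def by (auto intro: has_field_derivative_at_within)
  moreover have "continuous_on {0..L} \<phi>'"
    using \<phi> unfolding C1c_def by (auto intro: continuous_on_subset)
  ultimately show ?thesis
    using integral_by_parts_primitive[of 0 L g \<phi> \<phi>'] L g C1c_endpoints[OF \<phi>] by simp
qed

lemma has_weak_deriv_iff:
  "has_weak_deriv L f g \<longleftrightarrow> integrable (lebesgue_on {0..L}) g \<and>
     (\<forall>\<phi> \<phi>'. C1c L \<phi> \<phi>' \<longrightarrow>
        (LINT x|lebesgue_on {0..L}. f x * \<phi>' x) = - (LINT x|lebesgue_on {0..L}. g x * \<phi> x))"
  by (simp add: has_weak_deriv_def set_integrable_lebesgue_on set_integral_lebesgue_on)

lemma continuous_on_primitive:
  fixes g :: "real \<Rightarrow> real"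
  assumes "integrable (lebesgue_on {0..L}) g"
  shows "continuous_on {0..L} (\<lambda>x. c + (LINT y|lebesgue_on {0..x}. g y))"
  by (intro continuous_intros indefinite_integral_continuous_real assms)

text \<open>Converse of \<open>du_Bois_Reymond\<close>. The constant drops out since the derivative
  of a test function has integral zero.\<close>

lemma has_weak_deriv_primitive:
  assumes L: "0 < L" and g: "integrable (lebesgue_on {0..L}) g"
    and fm: "f \<in> borel_measurable (lebesgue_on {0..L})"
    and f: "AE x in lebesgue_on {0..L}. f x = c + (LINT y|lebesgue_on {0..x}. g y)"
  shows "has_weak_deriv L f g"
  unfolding has_weak_deriv_iff
proof (intro conjI allI impI g)
  fix \<phi> \<phi>' assume \<phi>: "C1c L \<phi> \<phi>'"
  let ?G = "\<lambda>x. LINT y|lebesgue_on {0..x}. g y"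
  have c\<phi>': "continuous_on {0..L} \<phi>'"
    using \<phi> unfolding C1c_def by (auto intro: continuous_on_subset)
  have G: "continuous_on {0..L} ?G"
    using continuous_on_primitive[OF g, of 0] by simp
  have *: "(\<phi> has_real_derivative \<phi>' x) (at x within {0..L})" for x
    using \<phi> unfolding C1c_def by (auto intro: has_field_derivative_at_within)
  have "(LINT x|lebesgue_on {0..L}. f x * \<phi>' x) = integral\<^sup>L (lebesgue_on {0..L}) (\<lambda>x. c * \<phi>' x + \<phi>' x * ?G x)"
  proof (rule integral_cong_AE)
    show "(\<lambda>x. f x * \<phi>' x) \<in> borel_measurable (lebesgue_on {0..L})"
      by (intro borel_measurable_times fm continuous_imp_measurable_on_sets_lebesgue c\<phi>') auto
    show "(\<lambda>x. c * \<phi>' x + \<phi>' x * ?G x) \<in> borel_measurable (lebesgue_on {0..L})"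
      by (intro continuous_imp_measurable_on_sets_lebesgue continuous_intros c\<phi>' G) auto
    show "AE x in lebesgue_on {0..L}. f x * \<phi>' x = c * \<phi>' x + \<phi>' x * ?G x"
      using f by eventually_elim (simp add: algebra_simps)
  qed
  also have "\<dots> = c * (LINT x|lebesgue_on {0..L}. \<phi>' x) + (LINT x|lebesgue_on {0..L}. \<phi>' x * ?G x)"
    using c\<phi>' G by (subst Bochner_Integration.integral_add)
      (auto intro!: continuous_imp_integrable_real continuous_intros)
  also have "(LINT x|lebesgue_on {0..L}. \<phi>' x) = 0"
    using integral_FTC_lebesgue_on[of 0 L \<phi> \<phi>'] * c\<phi>' C1c_endpoints[OF \<phi>] L by simp
  finally show "(LINT x|lebesgue_on {0..L}. f x * \<phi>' x) = - (LINT x|lebesgue_on {0..L}. g x * \<phi> x)"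
    using C1c_integral_by_parts[OF L \<phi> g] by (simp add: mult.commute)
qed

text \<open>After subtraction of the primitive of \<open>g\<close>, the remainder \<open>h\<close>
  annihilates every test function of mean zero, as those are derivatives of test functions. Any
  \<open>\<psi>\<close> becomes one of mean zero by subtracting a multiple of a fixed
  \<open>\<psi>1\<close>, which determines the constant.\<close>

lemma du_Bois_Reymond:
  assumes L: "0 < L" and f: "integrable (lebesgue_on {0..L}) f" and w: "has_weak_deriv L f g"
  shows "\<exists>c. AE x in lebesgue_on {0..L}. f x = c + (LINT y|lebesgue_on {0..x}. g y)"
proof -
  define M where "M = lebesgue_on {0..L}"
  interpret M: finite_measure M
    unfolding M_def by (rule finite_measure_lebesgue_on) simp
  have g: "integrable (lebesgue_on {0..L}) g" using w by (simp add: has_weak_deriv_iff)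
  define h where "h = (\<lambda>x. f x - (LINT y|lebesgue_on {0..x}. g y))"
  have G: "continuous_on {0..L} (\<lambda>x. LINT y|lebesgue_on {0..x}. g y)"
    using continuous_on_primitive[OF g, of 0] by simp
  have hi: "integrable M h"
    unfolding h_def M_def using f continuous_imp_integrable_real[OF G] by simp
  have cc: "continuous_on {0..L} \<psi>" if "compact_supp_cont 0 L \<psi>" for \<psi>
    using that unfolding compact_supp_cont_def by (auto intro: continuous_on_subset)
  have mi: "integrable M (\<lambda>x. \<psi> x * u x)" if "compact_supp_cont 0 L \<psi>" "integrable M u" for \<psi> u
    using integrable_continuous_mult[OF _ cc[OF that(1)]] that(2) by (simp add: M_def)
  have zero: "(LINT x|M. \<psi> x * h x) = 0"
    if \<psi>: "compact_supp_cont 0 L \<psi>" and 0: "(LINT x|M. \<psi> x) = 0" for \<psi>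
  proof -
    obtain \<phi> where \<phi>: "C1c L \<phi> \<psi>"
      using compact_supp_cont_antiderivative[OF \<psi> L] 0 by (auto simp: M_def)
    have "(LINT x|M. \<psi> x * h x) = (LINT x|M. \<psi> x * f x) - (LINT x|M. \<psi> x * (LINT y|lebesgue_on {0..x}. g y))"
      unfolding h_def right_diff_distrib
      using mi[OF \<psi>] f continuous_imp_integrable_real[OF G]
      by (intro Bochner_Integration.integral_diff) (auto simp: M_def)
    also have "\<dots> = 0"
      using w \<phi> C1c_integral_by_parts[OF L \<phi> g] by (simp add: has_weak_deriv_iff M_def mult.commute)
    finally show ?thesis .
  qed
  have mM: "measure M (space M) = L" using L by (simp add: M_def measure_restrict_space)
  \<comment> \<open>Being closer to the constant 1 than \<open>L\<close>, the integral of 1,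
    \<open>\<psi>1\<close> cannot have mean zero.\<close>
  obtain \<psi>1 where \<psi>1: "compact_supp_cont 0 L \<psi>1" "(LINT x|M. \<bar>1 - \<psi>1 x\<bar>) < L"
    using L1_approx_continuous[of 0 L "\<lambda>_. 1" L] L by (auto simp: M_def)
  note i1 [simp] = compact_supp_cont_integrable[OF \<psi>1(1), of 0 L, folded M_def]
  define I where "I = (LINT x|M. \<psi>1 x)"
  have "L - I = (LINT x|M. 1 - \<psi>1 x)" by (simp add: I_def mM)
  also have "\<dots> \<le> (LINT x|M. \<bar>1 - \<psi>1 x\<bar>)" by (intro integral_mono) auto
  finally have I: "I \<noteq> 0" using \<psi>1(2) by auto
  define c where "c = (LINT x|M. \<psi>1 x * h x) / I"
  have "AE x in M. h x - c = 0"
    unfolding M_def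
  proof (rule AE_zero_if_integral_test_zero[OF L])
    show "integrable (lebesgue_on {0..L}) (\<lambda>x. h x - c)" using hi by (simp add: M_def)
    fix \<psi> assume \<psi>: "compact_supp_cont 0 L \<psi>"
    note i [simp] = compact_supp_cont_integrable[OF \<psi>, of 0 L, folded M_def]
    define J where "J = (LINT x|M. \<psi> x)"
    have \<psi>2: "compact_supp_cont 0 L (\<lambda>x. \<psi> x + (- (J / I)) * \<psi>1 x)"
      by (intro compact_supp_cont_add \<psi> compact_supp_cont_comp[OF \<psi>1(1), of "\<lambda>x. - (J / I) * x"])
        (use I in \<open>auto intro!: continuous_intros\<close>)
    have "(LINT x|M. \<psi> x + (- (J / I)) * \<psi>1 x) = 0"
      using I by (simp add: J_def[symmetric] I_def[symmetric])
    from zero[OF \<psi>2 this]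
    have "(LINT x|M. \<psi> x * h x + (- (J / I)) * (\<psi>1 x * h x)) = 0"
      by (simp add: algebra_simps)
    then have "(LINT x|M. \<psi> x * h x) = J * c"
      using mi[OF \<psi> hi] mi[OF \<psi>1(1) hi] I by (simp add: c_def)
    moreover have "(LINT x|M. (h x - c) * \<psi> x) = (LINT x|M. \<psi> x * h x) - c * J"
      using mi[OF \<psi> hi] by (simp add: algebra_simps J_def)
    ultimately show "(LINT x|lebesgue_on {0..L}. (h x - c) * \<psi> x) = 0"
      by (simp add: M_def)
  qed
  then have "AE x in M. f x = c + (LINT y|lebesgue_on {0..x}. g y)"
    by eventually_elim (simp add: h_def)
  then show ?thesis unfolding M_def by blast
qed

text \<open>The sliding average over \<open>[x, x + h]\<close> is C^1 and, by the mean value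
  theorem, equals a value of \<open>\<psi>\<close> nearby. Exhibiting \<open>\<xi>\<close> gives
  uniform closeness and at the same time lets bounds such as non-negativity pass from
  \<open>\<psi>\<close> to \<open>\<phi>\<close>.\<close>

lemma C1c_approx:
  assumes \<psi>: "compact_supp_cont 0 L \<psi>" and e: "e > 0"
  shows "\<exists>\<phi> \<phi>'. C1c L \<phi> \<phi>' \<and> (\<forall>x. \<exists>\<xi>. \<phi> x = \<psi> \<xi> \<and> \<bar>\<psi> \<xi> - \<psi> x\<bar> < e)"
proof -
  obtain c d where cd: "0 < c" "d < L" "\<And>x. x \<notin> {c..d} \<Longrightarrow> \<psi> x = 0"
    and cont: "continuous_on UNIV \<psi>"
    using \<psi> unfolding compact_supp_cont_def by metis
  have isc: "isCont \<psi> x" for x using cont by (simp add: continuous_on_eq_continuous_at)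
  then obtain F where F: "\<And>x. (F has_real_derivative \<psi> x) (at x)"
    using einterval_antiderivative[of "-\<infinity>" "\<infinity>" \<psi>]
    by (auto simp: has_real_derivative_iff_has_vector_derivative)
  have "uniformly_continuous_on {c-1..d+1} \<psi>"
    using cont by (intro compact_uniformly_continuous) (auto intro: continuous_on_subset)
  then obtain \<delta> where \<delta>: "\<delta> > 0" "\<And>x y. x \<in> {c-1..d+1} \<Longrightarrow> y \<in> {c-1..d+1} \<Longrightarrow> dist y x < \<delta> \<Longrightarrow> dist (\<psi> y) (\<psi> x) < e"
    using e unfolding uniformly_continuous_on_def by metis
  \<comment> \<open>Each bound has its task: \<open>\<delta>\<close> for uniform continuity, 1 for
    staying in \<open>{c-1..d+1}\<close>, and \<open>c/2\<close> since averaging moves the left end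
    of the support by up to \<open>h\<close>.\<close>
  define h where "h = min (min (\<delta>/2) (1/2)) (c/2)"
  have h: "h > 0" "h < \<delta>" "h < 1" "h \<le> c/2" using \<delta> cd(1) by (auto simp: h_def min_def)
  define \<phi> where "\<phi> = (\<lambda>x. (F (x + h) - F x) / h)"
  define \<phi>' where "\<phi>' = (\<lambda>x. (\<psi> (x + h) - \<psi> x) / h)"
  have D: "(\<phi> has_real_derivative \<phi>' x) (at x)" for x
    unfolding \<phi>_def \<phi>'_def using h
    by (auto intro!: derivative_eq_intros F DERIV_chain2[OF F])
  have mv: "\<exists>\<xi>. x < \<xi> \<and> \<xi> < x + h \<and> \<phi> x = \<psi> \<xi>" for x
    using MVT2[of x "x + h" F \<psi>] h F by (auto simp: \<phi>_def)
  have "\<phi> x = 0" if "x \<notin> {c/2..d}" for x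
    using mv[of x] that cd(3) h by force
  moreover have "continuous_on UNIV \<phi>'"
    unfolding \<phi>'_def using h by (intro continuous_intros continuous_on_compose2[OF cont] cont) auto
  ultimately have "C1c L \<phi> \<phi>'"
    unfolding C1c_def using cd D by (intro conjI allI exI[of _ "c/2"] exI[of _ d]) auto
  moreover have "\<exists>\<xi>. \<phi> x = \<psi> \<xi> \<and> \<bar>\<psi> \<xi> - \<psi> x\<bar> < e" for x
  proof -
    obtain \<xi> where \<xi>: "x < \<xi>" "\<xi> < x + h" "\<phi> x = \<psi> \<xi>" using mv by blast
    have "\<bar>\<psi> \<xi> - \<psi> x\<bar> < e"
    proof (cases "x \<in> {c-1..d}")
      case True
      then show ?thesis
        using \<delta>(2)[of x \<xi>] \<xi> h by (auto simp: dist_real_def)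
    next
      case False
      then have "\<psi> x = 0" "\<psi> \<xi> = 0" using cd(3) \<xi> h by force+
      then show ?thesis using e by simp
    qed
    then show ?thesis using \<xi> by blast
  qed
  ultimately show ?thesis by blast
qed

text \<open>The difference is a weak derivative of zero and so annihilates all C^1 test functions.
  For continuous ones \<open>C1c_approx\<close> leaves an error of at most \<open>e\<close> times
  its L^1 norm, with \<open>e\<close> arbitrary.\<close>

lemma weak_deriv_unique:
  assumes L: "0 < L" and "has_weak_deriv L f g" "has_weak_deriv L f h"
  shows "AE x in lebesgue_on {0..L}. g x = h x"
proof -
  have gi: "integrable (lebesgue_on {0..L}) g" "integrable (lebesgue_on {0..L}) h"
    using assms by (auto simp: has_weak_deriv_iff)
  have *: "has_weak_deriv L (\<lambda>_. 0) (\<lambda>x. g x - h x)"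
    unfolding has_weak_deriv_iff
  proof (intro conjI allI impI)
    fix \<phi> \<phi>' assume \<phi>: "C1c L \<phi> \<phi>'"
    have "continuous_on {0..L} \<phi>"
      using C1c_compact_supp_cont[OF \<phi>] unfolding compact_supp_cont_def by (auto intro: continuous_on_subset)
    then have i: "integrable (lebesgue_on {0..L}) (\<lambda>x. g x * \<phi> x)" "integrable (lebesgue_on {0..L}) (\<lambda>x. h x * \<phi> x)"
      using gi integrable_continuous_mult[of 0 L g \<phi>] integrable_continuous_mult[of 0 L h \<phi>]
      by (simp_all add: mult.commute)
    have eq: "(LINT x|lebesgue_on {0..L}. g x * \<phi> x) = (LINT x|lebesgue_on {0..L}. h x * \<phi> x)"
    proof -
      have "(LINT x|lebesgue_on {0..L}. f x * \<phi>' x) = - (LINT x|lebesgue_on {0..L}. u x * \<phi> x)"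
        if "has_weak_deriv L f u" for u
        using that \<phi> unfolding has_weak_deriv_iff by blast
      from this[OF assms(2)] this[OF assms(3)] show ?thesis by linarith
    qed
    have "(LINT x|lebesgue_on {0..L}. (g x - h x) * \<phi> x) = 0"
      unfolding left_diff_distrib using i eq by simp
    then show "(LINT x|lebesgue_on {0..L}. 0 * \<phi>' x) = - (LINT x|lebesgue_on {0..L}. (g x - h x) * \<phi> x)"
      by simp
  qed (use gi in auto)
  have k0: "(LINT x|lebesgue_on {0..L}. (g x - h x) * \<phi> x) = 0" if "C1c L \<phi> \<phi>'" for \<phi> \<phi>'
  proof -
    have "(LINT x|lebesgue_on {0..L}. 0 * \<phi>' x) = - (LINT x|lebesgue_on {0..L}. (g x - h x) * \<phi> x)"
      using * that unfolding has_weak_deriv_iff by blast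
    then show ?thesis by simp
  qed
  have "AE x in lebesgue_on {0..L}. g x - h x = 0"
  proof (rule AE_zero_if_integral_test_zero[OF L])
    fix \<psi> assume \<psi>: "compact_supp_cont 0 L \<psi>"
    let ?I = "LINT x|lebesgue_on {0..L}. (g x - h x) * \<psi> x"
    let ?K = "LINT x|lebesgue_on {0..L}. \<bar>g x - h x\<bar>"
    have int: "integrable (lebesgue_on {0..L}) (\<lambda>x. (g x - h x) * \<xi> x)" if "compact_supp_cont 0 L \<xi>" for \<xi>
    proof -
      have "continuous_on {0..L} \<xi>"
        using that unfolding compact_supp_cont_def by (auto intro: continuous_on_subset)
      then show ?thesis
        using integrable_continuous_mult[of 0 L "\<lambda>x. g x - h x" \<xi>] gi by (simp add: mult.commute)
    qed
    have "\<bar>?I\<bar> \<le> e * ?K" if e: "e > 0" for e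
    proof -
      obtain \<phi> \<phi>' where \<phi>: "C1c L \<phi> \<phi>'" "\<And>x. \<exists>\<xi>. \<phi> x = \<psi> \<xi> \<and> \<bar>\<psi> \<xi> - \<psi> x\<bar> < e"
        using C1c_approx[OF \<psi> e] by blast
      have le: "\<bar>(g x - h x) * \<psi> x - (g x - h x) * \<phi> x\<bar> \<le> e * \<bar>g x - h x\<bar>" for x
      proof -
        have "\<bar>\<psi> x - \<phi> x\<bar> \<le> e" using \<phi>(2)[of x] by (auto simp: abs_minus_commute)
        then show ?thesis
          by (simp add: right_diff_distrib[symmetric] abs_mult mult.commute[of e] mult_left_mono)
      qed
      note i = int[OF \<psi>] int[OF C1c_compact_supp_cont[OF \<phi>(1)]]
      have "?I = (LINT x|lebesgue_on {0..L}. (g x - h x) * \<psi> x - (g x - h x) * \<phi> x)"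
        using i k0[OF \<phi>(1)] by simp
      also have "\<bar>\<dots>\<bar> \<le> (LINT x|lebesgue_on {0..L}. e * \<bar>g x - h x\<bar>)"
        by (rule order_trans[OF integral_abs_bound integral_mono])
          (use i gi le in \<open>auto intro!: integrable_abs Bochner_Integration.integrable_diff\<close>)
      finally show ?thesis using gi by simp
    qed
    then have "\<forall>\<^sub>F e in at_right 0. \<bar>?I\<bar> \<le> e * ?K"
      by (auto simp: eventually_at_filter)
    moreover have "((\<lambda>e. e * ?K) \<longlongrightarrow> 0 * ?K) (at_right 0)" by (intro tendsto_intros)
    ultimately have "\<bar>?I\<bar> \<le> 0 * ?K"
      by (intro tendsto_lowerbound) auto
    then show "?I = 0" by simp
  qed (use gi in auto)
  then show ?thesis by eventually_elim simp
qed


subsection \<open>Traces and boundary values\<close>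

lemma AE_zero_continuous:
  fixes u :: "real \<Rightarrow> real"
  assumes "a < b" "continuous_on {a..b} u" "AE x in lebesgue_on {a..b}. u x = 0" "x \<in> {a..b}"
  shows "u x = 0"
proof -
  have i0: "integral\<^sup>L (lebesgue_on {a..b}) (\<lambda>x. \<bar>u x\<bar>) = 0"
    by (rule integral_eq_zero_AE) (use assms(3) in auto)
  have "continuous_on {a..b} (\<lambda>x. \<bar>u x\<bar>)"
    using assms(2) by (intro continuous_intros)
  from iffD1[OF integralL_eq_0_iff[OF this assms(1) abs_ge_zero] i0]
  have "\<bar>u x\<bar> = 0" using assms(4) by blast
  then show ?thesis by simp
qed

lemma trace0_eq:
  assumes L: "0 < L" and u: "continuous_on {0..L} u" and fu: "AE x in lebesgue_on {0..L}. f x = u x"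
  shows "trace0 L f = u 0"
  unfolding trace0_def
proof (rule the_equality)
  show "\<exists>v. continuous_on {0..L} v \<and> (AE x\<in>{0..L} in lebesgue. f x = v x) \<and> v 0 = u 0"
    unfolding AE_lebesgue_on_Icc using u fu by blast
  fix c assume "\<exists>v. continuous_on {0..L} v \<and> (AE x\<in>{0..L} in lebesgue. f x = v x) \<and> v 0 = c"
  then obtain v where v: "continuous_on {0..L} v" "AE x in lebesgue_on {0..L}. f x = v x" "v 0 = c"
    unfolding AE_lebesgue_on_Icc by blast
  have "AE x in lebesgue_on {0..L}. v x - u x = 0"
    using fu v(2) by eventually_elim simp
  then have "v 0 - u 0 = 0"
    using AE_zero_continuous[OF L, of "\<lambda>x. v x - u x" 0] u v(1) L by (auto intro!: continuous_intros)
  then show "c = u 0" using v(3) by simp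
qed

text \<open>Here the choice in \<open>weak_deriv\<close> and the description in
  \<open>trace0\<close> acquire their meaning: the du Bois-Reymond constant is the value at 0 of the
  continuous representative, because a primitive over \<open>{0..0}\<close> vanishes.\<close>

lemma W11_D:
  assumes L: "0 < L" and f: "f \<in> W11 L"
  shows "integrable (lebesgue_on {0..L}) f" "has_weak_deriv L f (weak_deriv L f)"
    "integrable (lebesgue_on {0..L}) (weak_deriv L f)"
    "AE x in lebesgue_on {0..L}. f x = trace0 L f + (LINT y|lebesgue_on {0..x}. weak_deriv L f y)"
proof -
  show i: "integrable (lebesgue_on {0..L}) f"
    using f by (simp add: W11_def set_integrable_lebesgue_on)
  show w: "has_weak_deriv L f (weak_deriv L f)"
    using f someI_ex[of "has_weak_deriv L f"] by (simp add: W11_def weak_deriv_def)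
  show g: "integrable (lebesgue_on {0..L}) (weak_deriv L f)"
    using w by (simp add: has_weak_deriv_iff)
  obtain c where c: "AE x in lebesgue_on {0..L}. f x = c + (LINT y|lebesgue_on {0..x}. weak_deriv L f y)"
    using du_Bois_Reymond[OF L i w] by blast
  have "integral\<^sup>L (lebesgue_on {0..0}) (weak_deriv L f) = 0"
    by (rule integral_eq_zero_null_sets) auto
  then have "trace0 L f = c"
    using trace0_eq[OF L continuous_on_primitive[OF g] c] by simp
  then show "AE x in lebesgue_on {0..L}. f x = trace0 L f + (LINT y|lebesgue_on {0..x}. weak_deriv L f y)"
    using c by simp
qed

lemma W11_I:
  assumes L: "0 < L" and g: "integrable (lebesgue_on {0..L}) g" and f: "integrable (lebesgue_on {0..L}) f"
    and fg: "AE x in lebesgue_on {0..L}. f x = c + (LINT y|lebesgue_on {0..x}. g y)"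
  shows "f \<in> W11 L" "AE x in lebesgue_on {0..L}. weak_deriv L f x = g x" "trace0 L f = c"
proof -
  have w: "has_weak_deriv L f g"
    using has_weak_deriv_primitive[OF L g _ fg] f by auto
  show W: "f \<in> W11 L"
    using w f unfolding W11_def by (auto simp: set_integrable_lebesgue_on)
  show "AE x in lebesgue_on {0..L}. weak_deriv L f x = g x"
    using weak_deriv_unique[OF L W11_D(2)[OF L W] w] .
  have "integral\<^sup>L (lebesgue_on {0..0}) g = 0"
    by (rule integral_eq_zero_null_sets) auto
  then show "trace0 L f = c"
    using trace0_eq[OF L continuous_on_primitive[OF g] fg] by simp
qed

text \<open>Rates are given as integrable only on \<open>{0..l}\<close> with \<open>l < L\<close>.
  Countably many such intervals and the single point \<open>L\<close> cover \<open>{0..L}\<close>,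
  which recovers measurability there.\<close>

lemma borel_measurable_Icc_exhaust:
  fixes g :: "real \<Rightarrow> real"
  assumes L: "0 < L" and g: "\<And>l. l < L \<Longrightarrow> g \<in> borel_measurable (lebesgue_on {0..l})"
  shows "g \<in> borel_measurable (lebesgue_on {0..L})"
proof (rule measurable_piecewise_restrict[of "insert {L} (range (\<lambda>n. {0..L - L / real (Suc (Suc n))}))"])
  show "space (lebesgue_on {0..L}) \<subseteq> \<Union> (insert {L} (range (\<lambda>n. {0..L - L / real (Suc (Suc n))})))"
  proof
    fix x assume "x \<in> space (lebesgue_on {0..L})"
    then have x: "0 \<le> x" "x \<le> L" by auto
    show "x \<in> \<Union> (insert {L} (range (\<lambda>n. {0..L - L / real (Suc (Suc n))})))"
    proof (cases "x = L")
      case False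
      then obtain n :: nat where n: "L / (L - x) < n" using reals_Archimedean2 by blast
      have "L - x > 0" using False x by simp
      then have "L < real n * (L - x)" using n by (simp add: field_simps)
      also have "\<dots> \<le> real (Suc (Suc n)) * (L - x)" using \<open>L - x > 0\<close> by (intro mult_right_mono) auto
      finally have "L / real (Suc (Suc n)) < L - x" by (simp add: field_simps)
      then show ?thesis using x by (intro UnionI[of "{0..L - L / real (Suc (Suc n))}"]) auto
    qed auto
  qed
  fix \<Omega> assume "\<Omega> \<in> insert {L} (range (\<lambda>n. {0..L - L / real (Suc (Suc n))}))"
  then consider "\<Omega> = {L}" | n :: nat where "\<Omega> = {0..L - L / real (Suc (Suc n))}" by auto
  note cas = this
  show "\<Omega> \<inter> space (lebesgue_on {0..L}) \<in> sets (lebesgue_on {0..L})"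
    using cas by cases (auto simp: sets_restrict_space_iff)
  show "g \<in> borel_measurable (restrict_space (lebesgue_on {0..L}) \<Omega>)"
    using cas
  proof cases
    case 1
    then have "restrict_space (lebesgue_on {0..L}) \<Omega> = lebesgue_on {L}"
      using L by (subst restrict_restrict_space) auto
    then show ?thesis
      by (simp add: continuous_imp_measurable_on_sets_lebesgue)
  next
    case (2 n)
    have "{0..L} \<inter> \<Omega> = {0..L - L / real (Suc (Suc n))}" using 2 L by auto
    then have "restrict_space (lebesgue_on {0..L}) \<Omega> = lebesgue_on {0..L - L / real (Suc (Suc n))}"
      using 2 by (subst restrict_restrict_space) auto
    moreover have "L - L / real (Suc (Suc n)) < L" using L by simp
    ultimately show ?thesis
      using g by simp
  qed
qed auto

text \<open>Used for \<open>\<mu>\<^sub>1\<close>, for \<open>\<mu>\<^sub>2\<close>, and for the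
  total rate \<open>l\<^sub>2 + \<mu>\<^sub>1\<close> at which the first repair state is
  left.\<close>

locale hazard_rate =
  fixes L :: real and m :: "real \<Rightarrow> real"
  assumes L: "0 < L" and m_nonneg: "x \<in> {0..L} \<Longrightarrow> 0 \<le> m x"
    and m_loc: "0 < l \<Longrightarrow> l < L \<Longrightarrow> integrable (lebesgue_on {0..l}) m"
    and m_inf: "(\<integral>\<^sup>+x. ennreal (m x) \<partial>lebesgue_on {0..L}) = \<infinity>"
begin

section \<open>Functions in the domain at the right end point\<close>

lemma m_loc0: "x < L \<Longrightarrow> integrable (lebesgue_on {0..x}) m"
proof -
  assume x: "x < L"
  have "integrable (lebesgue_on {0..max x (L/2)}) m" using x L by (intro m_loc) auto
  then show ?thesis by (rule integrable_subinterval) auto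
qed

lemma m_measurable [measurable]: "m \<in> borel_measurable (lebesgue_on {0..L})"
  using borel_measurable_Icc_exhaust[OF L] m_loc0 borel_measurable_integrable by blast

text \<open>If the continuous representative were non-zero at \<open>L\<close>, it would exceed some
  \<open>e > 0\<close> in modulus on an interval \<open>{l..L}\<close>. There \<open>m\<close> is at
  most \<open>\<bar>m x * f x\<bar> / e\<close>, and on \<open>{0..l}\<close> it is integrable
  anyway, so its integral over \<open>{0..L}\<close> would be finite.\<close>

lemma W11_end_zero:
  assumes f: "f \<in> W11 L" and mf: "integrable (lebesgue_on {0..L}) (\<lambda>x. m x * f x)"
  shows "trace0 L f + (LINT y|lebesgue_on {0..L}. weak_deriv L f y) = 0"
proof (rule ccontr)
  define u where "u = (\<lambda>x. trace0 L f + (LINT y|lebesgue_on {0..x}. weak_deriv L f y))"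
  assume "trace0 L f + (LINT y|lebesgue_on {0..L}. weak_deriv L f y) \<noteq> 0"
  then have n: "u L \<noteq> 0" by (simp add: u_def)
  have c: "continuous_on {0..L} u"
    unfolding u_def using continuous_on_primitive[OF W11_D(3)[OF L f]] .
  define e where "e = \<bar>u L\<bar> / 2"
  have e: "e > 0" using n by (simp add: e_def)
  obtain d where d: "d > 0" "\<And>x. x \<in> {0..L} \<Longrightarrow> dist x L < d \<Longrightarrow> dist (u x) (u L) < e"
    using c e L unfolding continuous_on_iff by (metis atLeastAtMost_iff less_imp_le order_refl)
  define l where "l = max (L/2) (L - d/2)"
  have l: "0 < l" "l < L" using L d(1) by (auto simp: l_def)
  have big: "e \<le> \<bar>u x\<bar>" if "x \<in> {l..L}" for x
  proof -
    have "dist (u x) (u L) < e" using d that l by (auto simp: l_def dist_real_def)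
    moreover have "\<bar>u L\<bar> - \<bar>u x\<bar> \<le> \<bar>u x - u L\<bar>"
      using abs_triangle_ineq2[of "u L" "u x"] by (simp add: abs_minus_commute)
    ultimately show ?thesis unfolding e_def dist_real_def by linarith
  qed
  have "AE x in lebesgue_on {0..L}. \<bar>m x\<bar> \<le> \<bar>indicator {0..l} x * m x\<bar> + \<bar>m x * f x\<bar> / e"
  proof (rule lebesgue_on_mono[OF W11_D(4)[OF L f]])
    fix x assume "f x = trace0 L f + (LINT y|lebesgue_on {0..x}. weak_deriv L f y)" and x: "x \<in> {0..L}"
    then have fx: "f x = u x" by (simp add: u_def)
    show "\<bar>m x\<bar> \<le> \<bar>indicator {0..l} x * m x\<bar> + \<bar>m x * f x\<bar> / e"
    proof (cases "x \<le> l")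
      case True
      then show ?thesis using x e by simp
    next
      case False
      then have "e \<le> \<bar>f x\<bar>" using big[of x] fx x by simp
      then have "\<bar>m x\<bar> * e \<le> \<bar>m x * f x\<bar>" by (simp add: abs_mult mult_left_mono)
      then show ?thesis using e False by (simp add: field_simps)
    qed
  qed
  moreover have "integrable (lebesgue_on {0..L}) (\<lambda>x. \<bar>indicator {0..l} x * m x\<bar> + \<bar>m x * f x\<bar> / e)"
    using l mf by (intro Bochner_Integration.integrable_add integrable_abs integrable_divide
        integrable_indicator_lebesgue_on m_loc) auto
  ultimately have "integrable (lebesgue_on {0..L}) m"
    by (intro Bochner_Integration.integrable_bound[of _ _ m]) auto
  then have "(\<integral>\<^sup>+x. ennreal (m x) \<partial>lebesgue_on {0..L}) = ennreal (LINT x|lebesgue_on {0..L}. m x)"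
    using m_nonneg by (intro nn_integral_eq_integral) auto
  then show False using m_inf by simp
qed

text \<open>The term at \<open>L\<close> is \<open>w L\<close> times the end value from
  \<open>W11_end_zero\<close>, hence zero for every weight. Only the term at 0 survives, and it is
  the one that the boundary conditions evaluate.\<close>

lemma W11_by_parts:
  assumes f: "f \<in> W11 L" and mf: "integrable (lebesgue_on {0..L}) (\<lambda>x. m x * f x)"
    and w: "\<And>x. x \<in> {0..L} \<Longrightarrow> (w has_real_derivative w' x) (at x within {0..L})"
    and w': "continuous_on {0..L} w'"
  shows "(LINT x|lebesgue_on {0..L}. w x * weak_deriv L f x)
    = - w 0 * trace0 L f - (LINT x|lebesgue_on {0..L}. w' x * f x)"
proof -
  let ?G = "\<lambda>x. LINT y|lebesgue_on {0..x}. weak_deriv L f y"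
  note g = W11_D(3)[OF L f]
  have G: "continuous_on {0..L} ?G" using continuous_on_primitive[OF g, of 0] by simp
  have fm: "f \<in> borel_measurable (lebesgue_on {0..L})" using W11_D(1)[OF L f] by auto
  have "(LINT x|lebesgue_on {0..L}. w' x * f x) = (LINT x|lebesgue_on {0..L}. trace0 L f * w' x + w' x * ?G x)"
  proof (rule integral_cong_AE)
    show "(\<lambda>x. w' x * f x) \<in> borel_measurable (lebesgue_on {0..L})"
      by (intro borel_measurable_times fm continuous_imp_measurable_on_sets_lebesgue w') auto
    show "(\<lambda>x. trace0 L f * w' x + w' x * ?G x) \<in> borel_measurable (lebesgue_on {0..L})"
      by (intro continuous_imp_measurable_on_sets_lebesgue continuous_intros w' G) auto
    show "AE x in lebesgue_on {0..L}. w' x * f x = trace0 L f * w' x + w' x * ?G x"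
      using W11_D(4)[OF L f] by eventually_elim (simp add: algebra_simps)
  qed
  also have "\<dots> = trace0 L f * (LINT x|lebesgue_on {0..L}. w' x) + (LINT x|lebesgue_on {0..L}. w' x * ?G x)"
    using w' G by (subst Bochner_Integration.integral_add)
      (auto intro!: continuous_imp_integrable_real continuous_intros)
  also have "(LINT x|lebesgue_on {0..L}. w' x) = w L - w 0"
    using L w w' by (intro integral_FTC_lebesgue_on) auto
  also have "(LINT x|lebesgue_on {0..L}. w' x * ?G x)
    = w L * ?G L - (LINT x|lebesgue_on {0..L}. w x * weak_deriv L f x)"
    using L by (intro integral_by_parts_primitive g w w') auto
  also have "?G L = - trace0 L f" using W11_end_zero[OF f mf] by simp
  finally show ?thesis by (simp add: algebra_simps)
qed

end


subsection \<open>Survival functions\<close>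

text \<open>Monotone convergence along right ends increasing to \<open>L\<close>; the point
  \<open>L\<close> itself is a null set. The denominator starts at 2 so that even the first right
  end is positive, as the local integrability assumption requires.\<close>

lemma nn_integral_Icc_limit:
  fixes g :: "real \<Rightarrow> real"
  assumes L: "0 < L" and g0: "\<And>x. x \<in> {0..L} \<Longrightarrow> 0 \<le> g x"
    and gm [measurable]: "g \<in> borel_measurable (lebesgue_on {0..L})"
    and gi: "\<And>l. 0 < l \<Longrightarrow> l < L \<Longrightarrow> integrable (lebesgue_on {0..l}) g"
  shows "(\<lambda>n. ennreal (LINT x|lebesgue_on {0..L - L / real (Suc (Suc n))}. g x))
    \<longlonglongrightarrow> (\<integral>\<^sup>+x. ennreal (g x) \<partial>lebesgue_on {0..L})"
proof -
  define xs where "xs = (\<lambda>n. L - L / real (Suc (Suc n)))"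
  define M where "M = lebesgue_on {0..L}"
  have gM [measurable]: "g \<in> borel_measurable M" by (simp add: M_def)
  have xs: "0 < xs n" "xs n < L" for n using L by (auto simp: xs_def field_simps intro: add_pos_nonneg)
  have mono: "xs i \<le> xs j" if "i \<le> j" for i j
    using L that by (auto simp: xs_def intro!: divide_left_mono)
  have AM [measurable]: "{0..xs n} \<in> sets M" for n
    using xs[of n] by (auto simp: M_def sets_restrict_space_iff)
  define f where "f = (\<lambda>n x. ennreal (indicator {0..xs n} x * g x))"
  have fm [measurable]: "f n \<in> borel_measurable M" for n
    unfolding f_def by measurable
  have "incseq f"
  proof (intro incseq_SucI le_funI)
    fix n x show "f n x \<le> f (Suc n) x"
      using mono[of n "Suc n"] by (auto simp: f_def split: split_indicator)
  qed
  then have lim: "(\<lambda>n. integral\<^sup>N M (f n)) \<longlonglongrightarrow> (\<integral>\<^sup>+x. (SUP n. f n x) \<partial>M)"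
    using nn_integral_monotone_convergence_SUP[OF \<open>incseq f\<close> fm]
    by (simp add: LIMSEQ_SUP incseq_nn_integral)
  have fn: "integral\<^sup>N M (f n) = ennreal (LINT x|lebesgue_on {0..xs n}. g x)" for n
  proof -
    have sub: "{0..xs n} \<subseteq> {0..L}" using xs[of n] by auto
    have i: "integrable M (\<lambda>x. indicator {0..xs n} x * g x)"
      unfolding M_def using sub gi[OF xs] by (intro integrable_indicator_lebesgue_on) auto
    have "integral\<^sup>N M (f n) = ennreal (LINT x|M. indicator {0..xs n} x * g x)"
      unfolding f_def
      by (rule nn_integral_eq_integral[OF i]) (use g0 in \<open>auto simp: M_def split: split_indicator\<close>)
    then show ?thesis
      using integral_indicator_lebesgue_on[OF sub, of g] by (simp add: M_def)
  qed
  have "AE x in lebesgue. x \<noteq> L" by (intro AE_completion AE_lborel_singleton)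
  then have neL: "AE x in M. x \<noteq> L"
    unfolding M_def by (subst AE_restrict_space_iff) auto
  have "(\<integral>\<^sup>+x. (SUP n. f n x) \<partial>M) = (\<integral>\<^sup>+x. ennreal (g x) \<partial>M)"
  proof (rule nn_integral_cong_AE, unfold M_def, rule lebesgue_on_mono[OF neL[unfolded M_def]])
    fix x assume x: "x \<noteq> L" "x \<in> {0..L}"
    obtain n :: nat where n: "L / (L - x) < n" using reals_Archimedean2 by blast
    have "L - x > 0" using x by simp
    then have "L < real n * (L - x)" using n by (simp add: field_simps)
    also have "\<dots> \<le> real (Suc (Suc n)) * (L - x)" using \<open>L - x > 0\<close> by (intro mult_right_mono) auto
    finally have "L / real (Suc (Suc n)) < L - x" by (simp add: field_simps)
    then have fx: "f n x = ennreal (g x)" using x by (auto simp: f_def xs_def)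
    show "(SUP n. f n x) = ennreal (g x)"
    proof (rule antisym)
      show "(SUP n. f n x) \<le> ennreal (g x)"
        by (rule SUP_least) (auto simp: f_def split: split_indicator)
      show "ennreal (g x) \<le> (SUP n. f n x)"
        unfolding fx[symmetric] by (rule SUP_upper) simp
    qed
  qed
  then have "(\<lambda>n. ennreal (LINT x|lebesgue_on {0..xs n}. g x)) \<longlonglongrightarrow> (\<integral>\<^sup>+x. ennreal (g x) \<partial>M)"
    using lim by (simp only: fn)
  then show ?thesis unfolding M_def xs_def .
qed

text \<open>On a partition so fine that \<open>M\<close> grows by at most \<open>\<epsilon>\<close>
  per cell, the squared increments add up to at most \<open>\<epsilon> * (M l - M 0)\<close>. This
  takes the place of differentiation for functions driven by a merely integrable rate.\<close>

lemma constant_if_square_increments: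
  fixes D M :: "real \<Rightarrow> real"
  assumes l: "0 \<le> l" and M: "continuous_on {0..l} M"
    and mono: "\<And>x y. 0 \<le> x \<Longrightarrow> x \<le> y \<Longrightarrow> y \<le> l \<Longrightarrow> M x \<le> M y"
    and D: "\<And>x y. 0 \<le> x \<Longrightarrow> x \<le> y \<Longrightarrow> y \<le> l \<Longrightarrow> \<bar>D y - D x\<bar> \<le> (M y - M x)\<^sup>2"
  shows "D l = D 0"
proof (cases "l = 0")
  case False
  then have l: "0 < l" using l by simp
  have "\<bar>D l - D 0\<bar> \<le> \<epsilon> * (M l - M 0)" if \<epsilon>: "\<epsilon> > 0" for \<epsilon>
  proof -
    have "uniformly_continuous_on {0..l} M"
      using M by (rule compact_uniformly_continuous) simp
    then obtain d where d: "d > 0" "\<And>x y. x \<in> {0..l} \<Longrightarrow> y \<in> {0..l} \<Longrightarrow> dist y x < d \<Longrightarrow> dist (M y) (M x) < \<epsilon>"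
      using \<epsilon> unfolding uniformly_continuous_on_def by metis
    obtain n :: nat where n: "l / d < n" using reals_Archimedean2 by blast
    have n0: "n > 0" using n l d(1) by (cases n) (auto simp: field_simps)
    have nd: "l / n < d" using n n0 d(1) by (simp add: field_simps)
    define x where "x = (\<lambda>i::nat. l * real i / n)"
    have x: "0 \<le> x i" "x i \<le> x (Suc i)" "x (Suc i) - x i = l / n" for i
      using l n0 by (auto simp: x_def field_simps)
    have xl: "x i \<le> l" if "i \<le> n" for i
      using that n0 l by (simp add: x_def field_simps)
    have "\<bar>D (x k) - D 0\<bar> \<le> \<epsilon> * (M (x k) - M 0)" if "k \<le> n" for k
      using that
    proof (induction k)
      case 0
      show ?case by (simp add: x_def)
    next
      case (Suc k)
      have le: "x (Suc k) \<le> l" "x k \<le> l" using xl[OF Suc.prems] x(2)[of k] by auto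
      have "dist (M (x (Suc k))) (M (x k)) < \<epsilon>"
        using d(2)[of "x k" "x (Suc k)"] x[of k] x(1)[of "Suc k"] le nd by (auto simp: dist_real_def)
      then have s: "M (x (Suc k)) - M (x k) \<le> \<epsilon>" by (simp add: dist_real_def)
      have p: "0 \<le> M (x (Suc k)) - M (x k)" using mono[of "x k" "x (Suc k)"] x[of k] le by simp
      have "\<bar>D (x (Suc k)) - D (x k)\<bar> \<le> (M (x (Suc k)) - M (x k))\<^sup>2"
        using D[of "x k" "x (Suc k)"] x[of k] le by simp
      also have "\<dots> \<le> \<epsilon> * (M (x (Suc k)) - M (x k))"
        using s p by (simp add: power2_eq_square mult_right_mono)
      finally have "\<bar>D (x (Suc k)) - D (x k)\<bar> \<le> \<epsilon> * (M (x (Suc k)) - M (x k))" .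
      moreover have "\<bar>D (x k) - D 0\<bar> \<le> \<epsilon> * (M (x k) - M 0)" using Suc by simp
      ultimately show ?case by (simp add: algebra_simps)
    qed
    from this[of n] show ?thesis using n0 by (simp add: x_def)
  qed
  then have "\<forall>\<^sub>F e in at_right 0. \<bar>D l - D 0\<bar> \<le> e * (M l - M 0)"
    by (auto simp: eventually_at_filter)
  moreover have "((\<lambda>e. e * (M l - M 0)) \<longlongrightarrow> 0 * (M l - M 0)) (at_right 0)" by (intro tendsto_intros)
  ultimately have "\<bar>D l - D 0\<bar> \<le> 0 * (M l - M 0)"
    by (intro tendsto_lowerbound) auto
  then show ?thesis by simp
qed simp

context hazard_rate
begin

section \<open>Cumulative hazard and the exponential survival law\<close>

definition cum :: "real \<Rightarrow> real" where
  "cum x = (LINT s|lebesgue_on {0..x}. m s)"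

text \<open>At \<open>L\<close> the rate is not integrable and the Bochner integral takes its
  default value 0, so \<open>surv L\<close> is 1 and not the limit 0. Hence the facts below are
  restricted to arguments below \<open>L\<close> or hold almost everywhere.\<close>

definition surv :: "real \<Rightarrow> real" where
  "surv x = exp (- cum x)"

lemma cum_diff:
  assumes "0 \<le> x" "x \<le> y" "y < L"
  shows "cum y - cum x = (LINT s|lebesgue_on {x..y}. m s)" "cum x \<le> cum y"
proof -
  show eq: "cum y - cum x = (LINT s|lebesgue_on {x..y}. m s)"
    using Equivalence_Measurable_On_Borel.integral_combine[OF m_loc0[OF assms(3)] assms(1,2)]
    by (simp add: cum_def)
  have "0 \<le> (LINT s|lebesgue_on {x..y}. m s)"
    using m_nonneg assms by (intro integral_nonneg_AE AE_I2) auto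
  then show "cum x \<le> cum y" using eq by simp
qed

lemma cum_0 [simp]: "cum 0 = 0" "surv 0 = 1"
proof -
  show "cum 0 = 0"
    unfolding cum_def by (rule integral_eq_zero_null_sets) auto
  then show "surv 0 = 1" by (simp add: surv_def)
qed

lemma cum_nonneg: "0 \<le> x \<Longrightarrow> x < L \<Longrightarrow> 0 \<le> cum x"
  using cum_diff(2)[of 0 x] by simp

lemma continuous_cum: "l < L \<Longrightarrow> continuous_on {0..l} cum"
  unfolding cum_def[abs_def] by (intro indefinite_integral_continuous_real m_loc0)

lemma continuous_surv: "l < L \<Longrightarrow> continuous_on {0..l} surv"
  unfolding surv_def[abs_def] by (intro continuous_intros continuous_cum)

lemma surv_bounds: "0 \<le> x \<Longrightarrow> x < L \<Longrightarrow> 0 < surv x \<and> surv x \<le> 1"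
  using cum_nonneg by (simp add: surv_def)

lemma surv_antimono: "0 \<le> x \<Longrightarrow> x \<le> y \<Longrightarrow> y < L \<Longrightarrow> surv y \<le> surv x"
  using cum_diff(2) by (simp add: surv_def)

lemma integrable_m_surv:
  assumes "l < L"
  shows "integrable (lebesgue_on {0..l}) (\<lambda>x. m x * surv x)"
  using integrable_continuous_mult[OF m_loc0[OF assms] continuous_surv[OF assms]]
  by (simp only: mult.commute)

text \<open>Over a cell from \<open>x\<close> to \<open>y\<close> with hazard increment
  \<open>d\<close>, both the drop of \<open>surv\<close> and the integral of \<open>m * surv\<close>
  lie between \<open>surv y * d\<close> and \<open>surv x * d\<close>. They differ by at most
  \<open>(surv x - surv y) * d \<le> d\<^sup>2\<close>, so their accumulated difference is constant
  by \<open>constant_if_square_increments\<close>.\<close>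

lemma integral_m_surv:
  assumes l: "0 \<le> l" "l < L"
  shows "(LINT x|lebesgue_on {0..l}. m x * surv x) = 1 - surv l"
proof -
  define D where "D = (\<lambda>x. surv x + (LINT s|lebesgue_on {0..x}. m s * surv s))"
  have "\<bar>D y - D x\<bar> \<le> (cum y - cum x)\<^sup>2" if xy: "0 \<le> x" "x \<le> y" "y \<le> l" for x y
  proof -
    have yL: "y < L" using xy l by simp
    define d where "d = cum y - cum x"
    have d: "d \<ge> 0" "d = (LINT s|lebesgue_on {x..y}. m s)"
      using cum_diff[OF xy(1,2) yL] by (auto simp: d_def)
    define I where "I = (LINT s|lebesgue_on {x..y}. m s * surv s)"
    have sub: "{x..y} \<subseteq> {0..y}" using xy by auto
    note i = integrable_subinterval[OF m_loc0[OF yL] sub] integrable_subinterval[OF integrable_m_surv[OF yL] sub]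
    have DI: "D y - D x = surv y - surv x + I"
      using Equivalence_Measurable_On_Borel.integral_combine[OF integrable_m_surv[OF yL] xy(1,2)]
      by (simp add: D_def I_def)
    have "I \<le> (LINT s|lebesgue_on {x..y}. surv x * m s)" unfolding I_def
    proof (rule integral_mono)
      fix s assume "s \<in> space (lebesgue_on {x..y})"
      then show "m s * surv s \<le> surv x * m s"
        using surv_antimono[of x s] m_nonneg[of s] xy yL by (simp add: mult.commute mult_left_mono)
    qed (use i in auto)
    then have I1: "I \<le> surv x * d" using d by simp
    have "(LINT s|lebesgue_on {x..y}. surv y * m s) \<le> I" unfolding I_def
    proof (rule integral_mono)
      fix s assume "s \<in> space (lebesgue_on {x..y})"
      then show "surv y * m s \<le> m s * surv s"
        using surv_antimono[of s y] m_nonneg[of s] xy yL by (simp add: mult.commute mult_left_mono)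
    qed (use i in auto)
    then have I2: "surv y * d \<le> I" using d by simp
    \<comment> \<open>Both forms are kept: \<open>1 - exp (- d) \<le> d\<close> bounds the drop from
      above in terms of \<open>surv x\<close>, and \<open>exp d - 1 \<ge> d\<close> from below in
      terms of \<open>surv y\<close>.\<close>
    have e1: "surv y = surv x * exp (- d)" and e2: "surv x = surv y * exp d"
      by (simp_all add: surv_def d_def exp_add[symmetric])
    have b: "0 < surv y" "surv y \<le> surv x" "surv x \<le> 1"
      using surv_bounds[of x] surv_bounds[of y] surv_antimono[of x y] xy yL by auto
    have "surv x - surv y \<le> surv x * d"
      using exp_ge_add_one_self[of "- d"] b unfolding e1
      by (metis (no_types, opaque_lifting) add.commute add_uminus_conv_diff diff_le_eq le_diff_eq less_imp_le mult.right_neutral mult_left_mono order.trans right_diff_distrib)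
    moreover have "surv y * d \<le> surv x - surv y"
    proof -
      have "surv y * (1 + d) \<le> surv y * exp d"
        using exp_ge_add_one_self[of d] b by (intro mult_left_mono) auto
      then show ?thesis using e2 by (simp add: algebra_simps)
    qed
    ultimately have "\<bar>D y - D x\<bar> \<le> (surv x - surv y) * d"
      using I1 I2 DI by (auto simp: algebra_simps abs_le_iff)
    also have "\<dots> \<le> d * d"
    proof (rule mult_right_mono)
      have "surv x * d \<le> 1 * d" using b d by (intro mult_right_mono) auto
      then show "surv x - surv y \<le> d" using \<open>surv x - surv y \<le> surv x * d\<close> by simp
    qed (use d in simp)
    finally show ?thesis by (simp add: d_def power2_eq_square)
  qed
  then have "D l = D 0"
    using cum_diff(2) l by (intro constant_if_square_increments[of l cum D] continuous_cum) auto
  moreover have "(LINT s|lebesgue_on {0..0}. m s * surv s) = 0"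
    by (rule integral_eq_zero_null_sets) auto
  ultimately show ?thesis by (simp add: D_def)
qed

lemma surv_measurable [measurable]: "surv \<in> borel_measurable (lebesgue_on {0..L})"
proof (rule borel_measurable_Icc_exhaust[OF L])
  fix l assume "l < L"
  then show "surv \<in> borel_measurable (lebesgue_on {0..l})"
    by (intro continuous_imp_measurable_on_sets_lebesgue[OF continuous_surv]) auto
qed

lemma AE_less_L: "AE x in lebesgue_on {0..L}. x < L"
proof -
  have "AE x in lebesgue. x \<noteq> L" by (intro AE_completion AE_lborel_singleton)
  then have "AE x in lebesgue_on {0..L}. x \<noteq> L"
    by (subst AE_restrict_space_iff) auto
  then show ?thesis by (rule lebesgue_on_mono) simp
qed

lemma surv_integrable: "integrable (lebesgue_on {0..L}) surv"
proof -
  interpret finite_measure "lebesgue_on {0..L}"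
    by (rule finite_measure_lebesgue_on) simp
  have "AE x in lebesgue_on {0..L}. norm (surv x) \<le> 1"
    using AE_less_L by (rule lebesgue_on_mono) (use surv_bounds in fastforce)
  then show ?thesis
    by (rule integrable_const_bound) (rule surv_measurable)
qed

text \<open>The lifetime with hazard \<open>m\<close> has total probability one: up to
  \<open>l < L\<close> the mass is \<open>1 - surv l\<close>, and \<open>surv\<close> tends to zero
  because the cumulative hazard diverges.\<close>

lemma m_surv_has_integral: "has_bochner_integral (lebesgue_on {0..L}) (\<lambda>x. m x * surv x) 1"
proof (rule has_bochner_integral_nn_integral)
  let ?xs = "\<lambda>n. L - L / real (Suc (Suc n))"
  have xs: "0 \<le> ?xs n" "?xs n < L" for n using L by (auto simp: field_simps)
  have "(\<lambda>n. ennreal (cum (?xs n))) \<longlonglongrightarrow> \<infinity>"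
    using nn_integral_Icc_limit[OF L m_nonneg m_measurable m_loc] m_inf by (simp add: cum_def)
  have "(\<lambda>n. surv (?xs n)) \<longlonglongrightarrow> 0"
  proof (rule order_tendstoI)
    fix e :: real assume "e < 0"
    then show "\<forall>\<^sub>F n in sequentially. e < surv (?xs n)"
      by (intro always_eventually allI) (auto simp: surv_def intro: less_trans)
  next
    fix e :: real assume e: "0 < e"
    have "\<forall>\<^sub>F n in sequentially. ennreal (- ln e) < ennreal (cum (?xs n))"
      using \<open>(\<lambda>n. ennreal (cum (?xs n))) \<longlonglongrightarrow> \<infinity>\<close> by (rule order_tendstoD(1)) simp
    then show "\<forall>\<^sub>F n in sequentially. surv (?xs n) < e"
    proof eventually_elim
      case (elim n)
      then have "- ln e < cum (?xs n)" by (meson ennreal_leI leI leD)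
      then have "exp (- cum (?xs n)) < exp (ln e)" by (intro exp_less_mono) linarith
      then show ?case using e by (simp add: surv_def)
    qed
  qed
  then have lim1: "(\<lambda>n. ennreal (1 - surv (?xs n))) \<longlonglongrightarrow> ennreal (1 - 0)"
    by (intro tendsto_intros)
  have lim2: "(\<lambda>n. ennreal (1 - surv (?xs n))) \<longlonglongrightarrow> (\<integral>\<^sup>+x. ennreal (m x * surv x) \<partial>lebesgue_on {0..L})"
  proof -
    have "(\<lambda>n. ennreal (LINT x|lebesgue_on {0..?xs n}. m x * surv x))
      \<longlonglongrightarrow> (\<integral>\<^sup>+x. ennreal (m x * surv x) \<partial>lebesgue_on {0..L})"
    proof (rule nn_integral_Icc_limit[OF L])
      fix x assume "x \<in> {0..L}"
      then show "0 \<le> m x * surv x" using m_nonneg by (simp add: surv_def)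
    next
      show "integrable (lebesgue_on {0..l}) (\<lambda>x. m x * surv x)" if "0 < l" "l < L" for l
        using integrable_m_surv[OF that(2)] .
    qed (intro borel_measurable_times m_measurable surv_measurable)
    then show ?thesis by (simp only: integral_m_surv[OF xs])
  qed
  show "(\<integral>\<^sup>+x. ennreal (m x * surv x) \<partial>lebesgue_on {0..L}) = ennreal 1"
    using LIMSEQ_unique[OF lim1 lim2] by simp
  show "AE x in lebesgue_on {0..L}. 0 \<le> m x * surv x"
    using m_nonneg by (intro AE_I2) (auto simp: surv_def)
qed (intro borel_measurable_times m_measurable surv_measurable zero_le_one)+

text \<open>These are the stationary age profiles: they solve \<open>f' = - m * f\<close>, and the
  inflow \<open>c\<close> at age zero equals the total outflow, the integral of
  \<open>m * f\<close>. Equality is asked only almost everywhere, as the value of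
  \<open>surv\<close> at \<open>L\<close> is artificial.\<close>

lemma scaled_surv:
  assumes f: "AE x in lebesgue_on {0..L}. f x = c * surv x"
    and fm: "f \<in> borel_measurable (lebesgue_on {0..L})"
  shows "f \<in> W11 L" "AE x in lebesgue_on {0..L}. weak_deriv L f x = - (m x * f x)"
    "trace0 L f = c" "integrable (lebesgue_on {0..L}) (\<lambda>x. m x * f x)"
    "(LINT x|lebesgue_on {0..L}. m x * f x) = c" "integrable (lebesgue_on {0..L}) f"
    "(LINT x|lebesgue_on {0..L}. f x) = c * (LINT x|lebesgue_on {0..L}. surv x)"
proof -
  have ms: "integrable (lebesgue_on {0..L}) (\<lambda>x. m x * surv x)" "(LINT x|lebesgue_on {0..L}. m x * surv x) = 1"
    using m_surv_has_integral by (auto simp: has_bochner_integral_iff)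
  have mf: "AE x in lebesgue_on {0..L}. m x * f x = c * (m x * surv x)"
    using f by eventually_elim simp
  have [measurable]: "f \<in> borel_measurable (lebesgue_on {0..L})" by fact
  have "integrable (lebesgue_on {0..L}) (\<lambda>x. m x * f x) \<longleftrightarrow> integrable (lebesgue_on {0..L}) (\<lambda>x. c * (m x * surv x))"
    by (rule integrable_cong_AE[OF _ _ mf]) measurable
  then show "integrable (lebesgue_on {0..L}) (\<lambda>x. m x * f x)" using ms by simp
  have "(LINT x|lebesgue_on {0..L}. m x * f x) = (LINT x|lebesgue_on {0..L}. c * (m x * surv x))"
    by (rule integral_cong_AE[OF _ _ mf]) measurable
  then show "(LINT x|lebesgue_on {0..L}. m x * f x) = c" using ms by simp
  have "integrable (lebesgue_on {0..L}) f \<longleftrightarrow> integrable (lebesgue_on {0..L}) (\<lambda>x. c * surv x)"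
    by (rule integrable_cong_AE[OF _ _ f]) measurable
  then show fi: "integrable (lebesgue_on {0..L}) f" using surv_integrable by simp
  have "(LINT x|lebesgue_on {0..L}. f x) = (LINT x|lebesgue_on {0..L}. c * surv x)"
    by (rule integral_cong_AE[OF _ _ f]) measurable
  then show "(LINT x|lebesgue_on {0..L}. f x) = c * (LINT x|lebesgue_on {0..L}. surv x)" by simp
  let ?g = "\<lambda>x. - c * (m x * surv x)"
  have gi: "integrable (lebesgue_on {0..L}) ?g" using ms by simp
  have "AE x in lebesgue_on {0..L}. f x = c * surv x \<and> x < L" using f AE_less_L by eventually_elim simp
  then have "AE x in lebesgue_on {0..L}. f x = c + (LINT y|lebesgue_on {0..x}. ?g y)"
    by (rule lebesgue_on_mono) (simp add: integral_m_surv algebra_simps)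
  note W = W11_I[OF L gi fi this]
  show "f \<in> W11 L" "trace0 L f = c" using W by auto
  show "AE x in lebesgue_on {0..L}. weak_deriv L f x = - (m x * f x)"
    using W(2) f by eventually_elim simp
qed

end


subsection \<open>The generator and its steady state\<close>

lemma spaceX_iff:
  "(a, f, g) \<in> spaceX L \<longleftrightarrow> integrable (lebesgue_on {0..L}) f \<and> integrable (lebesgue_on {0..L}) g"
  by (simp add: spaceX_def set_integrable_lebesgue_on)

lemma normX_eq:
  "normX L (a, f, g) = \<bar>a\<bar> + (LINT x|lebesgue_on {0..L}. \<bar>f x\<bar>) + (LINT x|lebesgue_on {0..L}. \<bar>g x\<bar>)"
  by (simp add: set_integral_lebesgue_on)

lemma eqX_iff:
  "eqX L (a, f, g) (b, u, v) \<longleftrightarrow>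
     a = b \<and> (AE x in lebesgue_on {0..L}. f x = u x) \<and> (AE x in lebesgue_on {0..L}. g x = v x)"
  unfolding eqX.simps AE_lebesgue_on_Icc ..

lemma nonnegX_iff:
  "nonnegX L (a, f, g) \<longleftrightarrow>
     0 \<le> a \<and> (AE x in lebesgue_on {0..L}. 0 \<le> f x) \<and> (AE x in lebesgue_on {0..L}. 0 \<le> g x)"
  unfolding nonnegX.simps AE_lebesgue_on_Icc ..

lemma domA_iff:
  "(p\<^sub>0, p\<^sub>1, p\<^sub>2) \<in> domA L l\<^sub>1 l\<^sub>2 \<mu>\<^sub>1 \<mu>\<^sub>2 \<longleftrightarrow> p\<^sub>1 \<in> W11 L \<and> p\<^sub>2 \<in> W11 L \<and>
     integrable (lebesgue_on {0..L}) (\<lambda>x. \<mu>\<^sub>1 x * p\<^sub>1 x) \<and>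
     integrable (lebesgue_on {0..L}) (\<lambda>x. \<mu>\<^sub>2 x * p\<^sub>2 x) \<and>
     trace0 L p\<^sub>1 = l\<^sub>1 * p\<^sub>0 \<and>
     trace0 L p\<^sub>2 = l\<^sub>2 * p\<^sub>0 + l\<^sub>2 * (LINT x|lebesgue_on {0..L}. p\<^sub>1 x)"
  by (simp add: domA_def set_integrable_lebesgue_on set_integral_lebesgue_on)

lemma opA_eq:
  "opA L l\<^sub>1 l\<^sub>2 \<mu>\<^sub>1 \<mu>\<^sub>2 (p\<^sub>0, p\<^sub>1, p\<^sub>2) =
     (- (l\<^sub>1 + l\<^sub>2) * p\<^sub>0 + (LINT x|lebesgue_on {0..L}. \<mu>\<^sub>1 x * p\<^sub>1 x) + (LINT x|lebesgue_on {0..L}. \<mu>\<^sub>2 x * p\<^sub>2 x),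
      \<lambda>x. - weak_deriv L p\<^sub>1 x - (\<mu>\<^sub>1 x + l\<^sub>2) * p\<^sub>1 x,
      \<lambda>x. - weak_deriv L p\<^sub>2 x - \<mu>\<^sub>2 x * p\<^sub>2 x)"
  by (simp add: set_integral_lebesgue_on)

text \<open>The duality pairing with an element \<open>(c, u, v)\<close> of the dual space; all
  information about the semigroup is extracted through it.\<close>

fun pairX :: "real \<Rightarrow> real \<Rightarrow> (real \<Rightarrow> real) \<Rightarrow> (real \<Rightarrow> real) \<Rightarrow> state \<Rightarrow> real" where
  "pairX L c u v (a, f, g) =
     c * a + (LINT x|lebesgue_on {0..L}. u x * f x) + (LINT x|lebesgue_on {0..L}. v x * g x)"

locale repair_system = H1: hazard_rate L \<mu>\<^sub>1 + H2: hazard_rate L \<mu>\<^sub>2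
  for L :: real and \<mu>\<^sub>1 \<mu>\<^sub>2 :: "real \<Rightarrow> real" +
  fixes l\<^sub>1 l\<^sub>2 :: real
  assumes l_pos: "0 < l\<^sub>1" "0 < l\<^sub>2"
begin

abbreviation "D \<equiv> domA L l\<^sub>1 l\<^sub>2 \<mu>\<^sub>1 \<mu>\<^sub>2"
abbreviation "A \<equiv> opA L l\<^sub>1 l\<^sub>2 \<mu>\<^sub>1 \<mu>\<^sub>2"

lemma L_pos: "0 < L" by (rule H1.L)

lemma domA_spaceX: "q \<in> D \<Longrightarrow> q \<in> spaceX L"
  using W11_D(1)[OF L_pos] by (cases q) (auto simp: domA_iff spaceX_iff)

lemma opA_spaceX: "q \<in> D \<Longrightarrow> A q \<in> spaceX L"
proof (cases q)
  case (fields q0 q1 q2)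
  assume q: "q \<in> D"
  then have *: "integrable (lebesgue_on {0..L}) (\<lambda>x. \<mu>\<^sub>1 x * q1 x)" "integrable (lebesgue_on {0..L}) (\<lambda>x. \<mu>\<^sub>2 x * q2 x)"
    "integrable (lebesgue_on {0..L}) q1" "integrable (lebesgue_on {0..L}) (weak_deriv L q1)"
    "integrable (lebesgue_on {0..L}) (weak_deriv L q2)"
    using W11_D(1,3)[OF L_pos] by (auto simp: fields domA_iff)
  show ?thesis
    unfolding fields opA_eq spaceX_iff distrib_right using * by auto
qed

text \<open>This computes the adjoint, i.e. the backward operator. A repair at rate
  \<open>\<mu>\<^sub>i\<close> jumps to the weight \<open>c\<close>, and a failure during the first
  repair jumps at rate \<open>l\<^sub>2\<close> to \<open>v 0\<close>. That last term comes from the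
  nonlocal boundary condition for \<open>q2\<close>, whose trace contains the integral of
  \<open>q1\<close>; the other trace terms join the coefficient of \<open>q0\<close>.\<close>

lemma pairX_opA:
  assumes q: "(q0, q1, q2) \<in> D"
    and u: "\<And>x. x \<in> {0..L} \<Longrightarrow> (u has_real_derivative u' x) (at x within {0..L})"
    and u': "continuous_on {0..L} u'"
    and v: "\<And>x. x \<in> {0..L} \<Longrightarrow> (v has_real_derivative v' x) (at x within {0..L})"
    and v': "continuous_on {0..L} v'"
  shows "pairX L c u v (A (q0, q1, q2)) =
      (- (l\<^sub>1 + l\<^sub>2) * c + l\<^sub>1 * u 0 + l\<^sub>2 * v 0) * q0
    + (LINT x|lebesgue_on {0..L}. (u' x + \<mu>\<^sub>1 x * (c - u x) - l\<^sub>2 * u x + l\<^sub>2 * v 0) * q1 x)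
    + (LINT x|lebesgue_on {0..L}. (v' x + \<mu>\<^sub>2 x * (c - v x)) * q2 x)"
    and "integrable (lebesgue_on {0..L}) (\<lambda>x. (u' x + \<mu>\<^sub>1 x * (c - u x) - l\<^sub>2 * u x + l\<^sub>2 * v 0) * q1 x)"
    and "integrable (lebesgue_on {0..L}) (\<lambda>x. (v' x + \<mu>\<^sub>2 x * (c - v x)) * q2 x)"
proof -
  have W: "q1 \<in> W11 L" "q2 \<in> W11 L"
    and m1: "integrable (lebesgue_on {0..L}) (\<lambda>x. \<mu>\<^sub>1 x * q1 x)"
    and m2: "integrable (lebesgue_on {0..L}) (\<lambda>x. \<mu>\<^sub>2 x * q2 x)"
    and t: "trace0 L q1 = l\<^sub>1 * q0" "trace0 L q2 = l\<^sub>2 * q0 + l\<^sub>2 * (LINT x|lebesgue_on {0..L}. q1 x)"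
    using q by (auto simp: domA_iff)
  have cu: "continuous_on {0..L} u" and cv: "continuous_on {0..L} v"
    using u v by (meson DERIV_continuous continuous_on_eq_continuous_within)+
  have q1: "integrable (lebesgue_on {0..L}) q1" "integrable (lebesgue_on {0..L}) (weak_deriv L q1)"
    and q2: "integrable (lebesgue_on {0..L}) q2" "integrable (lebesgue_on {0..L}) (weak_deriv L q2)"
    using W11_D(1,3)[OF L_pos] W by auto
  note ic = integrable_continuous_mult
  note i1 = ic[OF q1(1) u'] ic[OF q1(1) cu] ic[OF q1(2) cu] ic[OF m1 cu]
  note i2 = ic[OF q2(1) v'] ic[OF q2(2) cv] ic[OF m2 cv]
  have e1: "(\<lambda>x. (u' x + \<mu>\<^sub>1 x * (c - u x) - l\<^sub>2 * u x + l\<^sub>2 * v 0) * q1 x)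
    = (\<lambda>x. u' x * q1 x + c * (\<mu>\<^sub>1 x * q1 x) - u x * (\<mu>\<^sub>1 x * q1 x) - l\<^sub>2 * (u x * q1 x) + (l\<^sub>2 * v 0) * q1 x)"
    by (simp add: fun_eq_iff algebra_simps)
  have e2: "(\<lambda>x. (v' x + \<mu>\<^sub>2 x * (c - v x)) * q2 x)
    = (\<lambda>x. v' x * q2 x + c * (\<mu>\<^sub>2 x * q2 x) - v x * (\<mu>\<^sub>2 x * q2 x))"
    by (simp add: fun_eq_iff algebra_simps)
  show "integrable (lebesgue_on {0..L}) (\<lambda>x. (u' x + \<mu>\<^sub>1 x * (c - u x) - l\<^sub>2 * u x + l\<^sub>2 * v 0) * q1 x)"
    unfolding e1 using i1 m1 q1 by simp
  show "integrable (lebesgue_on {0..L}) (\<lambda>x. (v' x + \<mu>\<^sub>2 x * (c - v x)) * q2 x)"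
    unfolding e2 using i2 m2 q2 by simp
  have a1: "(\<lambda>x. u x * (- weak_deriv L q1 x - (\<mu>\<^sub>1 x + l\<^sub>2) * q1 x))
    = (\<lambda>x. - (u x * weak_deriv L q1 x) - u x * (\<mu>\<^sub>1 x * q1 x) - l\<^sub>2 * (u x * q1 x))"
    by (simp add: fun_eq_iff algebra_simps)
  have a2: "(\<lambda>x. v x * (- weak_deriv L q2 x - \<mu>\<^sub>2 x * q2 x))
    = (\<lambda>x. - (v x * weak_deriv L q2 x) - v x * (\<mu>\<^sub>2 x * q2 x))"
    by (simp add: fun_eq_iff algebra_simps)
  note b1 = H1.W11_by_parts[OF W(1) m1 u u'] and b2 = H2.W11_by_parts[OF W(2) m2 v v']
  show "pairX L c u v (A (q0, q1, q2)) =
      (- (l\<^sub>1 + l\<^sub>2) * c + l\<^sub>1 * u 0 + l\<^sub>2 * v 0) * q0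
    + (LINT x|lebesgue_on {0..L}. (u' x + \<mu>\<^sub>1 x * (c - u x) - l\<^sub>2 * u x + l\<^sub>2 * v 0) * q1 x)
    + (LINT x|lebesgue_on {0..L}. (v' x + \<mu>\<^sub>2 x * (c - v x)) * q2 x)"
    unfolding opA_eq pairX.simps a1 a2 e1 e2
    using i1 i2 m1 m2 q1 q2 b1 b2 t by (simp add: algebra_simps)
qed

text \<open>The first repair state ends by repair or by a further failure, so its stationary profile
  follows the survival function of the summed rate, which is \<open>survival1\<close>.\<close>

sublocale HS: hazard_rate L "\<lambda>x. l\<^sub>2 + \<mu>\<^sub>1 x"
proof
  show "0 \<le> l\<^sub>2 + \<mu>\<^sub>1 x" if "x \<in> {0..L}" for x
    using H1.m_nonneg[OF that] l_pos by simp
  show "integrable (lebesgue_on {0..l}) (\<lambda>x. l\<^sub>2 + \<mu>\<^sub>1 x)" if "0 < l" "l < L" for l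
    using H1.m_loc[OF that] by simp
  have "(\<integral>\<^sup>+x. ennreal (\<mu>\<^sub>1 x) \<partial>lebesgue_on {0..L}) \<le> (\<integral>\<^sup>+x. ennreal (l\<^sub>2 + \<mu>\<^sub>1 x) \<partial>lebesgue_on {0..L})"
    using l_pos by (intro nn_integral_mono ennreal_leI) simp
  then show "(\<integral>\<^sup>+x. ennreal (l\<^sub>2 + \<mu>\<^sub>1 x) \<partial>lebesgue_on {0..L}) = \<infinity>"
    using H1.m_inf by (simp add: top_unique)
qed (rule L_pos)

abbreviation "pe \<equiv> steady_state L l\<^sub>1 l\<^sub>2 \<mu>\<^sub>1 \<mu>\<^sub>2"

text \<open>Both age profiles are multiples of survival functions, with factors dictated by the
  boundary conditions: \<open>l\<^sub>1 * p0\<close> and \<open>c2\<close>. The zeroth equation is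
  then the balance of flows, and \<open>p0\<close> is the normalization to mass one.\<close>

lemma steady_state:
  "pe \<in> D" "eqX L (A pe) zeroX" "nonnegX L pe" "normX L pe = 1"
proof -
  have s1: "survival1 l\<^sub>2 \<mu>\<^sub>1 x = HS.surv x" for x
    by (simp add: survival1_def HS.surv_def HS.cum_def set_integral_lebesgue_on)
  have s2: "survival2 \<mu>\<^sub>2 x = H2.surv x" for x
    by (simp add: survival2_def H2.surv_def H2.cum_def set_integral_lebesgue_on)
  define C0 where "C0 = (LINT x|lebesgue_on {0..L}. HS.surv x)"
  define C1 where "C1 = (LINT x|lebesgue_on {0..L}. H2.surv x)"
  define p0 where "p0 = 1 / ((1 + l\<^sub>1 * C0) * (1 + l\<^sub>2 * C1))"
  define p1 where "p1 = (\<lambda>x. l\<^sub>1 * p0 * HS.surv x)"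
  define c2 where "c2 = l\<^sub>2 * p0 * (1 + l\<^sub>1 * C0)"
  define p2 where "p2 = (\<lambda>x. l\<^sub>2 * p0 * H2.surv x + l\<^sub>1 * l\<^sub>2 * p0 * H2.surv x * C0)"
  have pe: "pe = (p0, p1, p2)"
    by (simp add: steady_state_def Let_def s1 s2 set_integral_lebesgue_on C0_def C1_def p0_def p1_def p2_def)
  have C: "0 \<le> C0" "0 \<le> C1"
    by (auto simp: C0_def C1_def HS.surv_def H2.surv_def intro!: integral_nonneg_AE)
  then have "0 < 1 + l\<^sub>1 * C0" "0 < 1 + l\<^sub>2 * C1"
    using l_pos by (auto intro!: add_pos_nonneg)
  then have p: "0 < 1 + l\<^sub>1 * C0" "0 < 1 + l\<^sub>2 * C1" "0 < p0"
    by (simp_all add: p0_def)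
  have p2e: "p2 x = c2 * H2.surv x" for x by (simp add: p2_def c2_def algebra_simps)
  have "p1 \<in> borel_measurable (lebesgue_on {0..L})" "p2 \<in> borel_measurable (lebesgue_on {0..L})"
    unfolding p1_def p2_def using HS.surv_measurable H2.surv_measurable by measurable
  note S1 = HS.scaled_surv[of p1 "l\<^sub>1 * p0", OF AE_I2 this(1), OF p1_def[THEN fun_cong]]
    and S2 = H2.scaled_surv[of p2 c2, OF AE_I2 this(2), OF p2e]
  \<comment> \<open>The outflow at the summed rate is \<open>l\<^sub>1 * p0\<close>; removing the
    share that leaves by failure, \<open>l\<^sub>2\<close> times the integral of \<open>p1\<close>,
    isolates the repairs.\<close>
  have i1: "integrable (lebesgue_on {0..L}) (\<lambda>x. \<mu>\<^sub>1 x * p1 x)"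
    "(LINT x|lebesgue_on {0..L}. \<mu>\<^sub>1 x * p1 x) = l\<^sub>1 * p0 - l\<^sub>2 * (l\<^sub>1 * p0 * C0)"
  proof -
    have eq: "(\<lambda>x. \<mu>\<^sub>1 x * p1 x) = (\<lambda>x. (l\<^sub>2 + \<mu>\<^sub>1 x) * p1 x - l\<^sub>2 * p1 x)"
      by (simp add: fun_eq_iff algebra_simps)
    show "integrable (lebesgue_on {0..L}) (\<lambda>x. \<mu>\<^sub>1 x * p1 x)"
      unfolding eq using S1(4,6) by simp
    show "(LINT x|lebesgue_on {0..L}. \<mu>\<^sub>1 x * p1 x) = l\<^sub>1 * p0 - l\<^sub>2 * (l\<^sub>1 * p0 * C0)"
      unfolding eq using S1(4-7) by (simp add: C0_def)
  qed
  show "pe \<in> D"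
    unfolding pe domA_iff
    using S1(1,3,7) S2(1,3,4) i1(1) by (simp add: C0_def[symmetric] c2_def algebra_simps)
  have "AE x in lebesgue_on {0..L}. - weak_deriv L p1 x - (\<mu>\<^sub>1 x + l\<^sub>2) * p1 x = 0"
    using S1(2) by eventually_elim (simp add: algebra_simps)
  moreover have "AE x in lebesgue_on {0..L}. - weak_deriv L p2 x - \<mu>\<^sub>2 x * p2 x = 0"
    using S2(2) by eventually_elim simp
  ultimately show "eqX L (A pe) zeroX"
    unfolding pe opA_eq zeroX_def eqX_iff
    using i1(2) S2(5) by (simp add: c2_def algebra_simps)
  have nn: "0 \<le> p1 x" "0 \<le> p2 x" for x
    using p l_pos C by (auto simp: p1_def p2e c2_def HS.surv_def H2.surv_def)
  show "nonnegX L pe"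
    unfolding pe nonnegX_iff using nn p by simp
  have "normX L pe = p0 + l\<^sub>1 * p0 * C0 + c2 * C1"
    unfolding pe normX_eq using nn p S1(7) S2(7) by (simp add: C0_def C1_def)
  also have "\<dots> = p0 * ((1 + l\<^sub>1 * C0) * (1 + l\<^sub>2 * C1))" by (simp add: c2_def algebra_simps)
  also have "\<dots> = 1" using p by (simp add: p0_def)
  finally show "normX L pe = 1" .
qed

end


subsection \<open>Density of the non-negative part of the domain\<close>

text \<open>The squared positive part is the simplest C^1 function with a one-sided support. Both
  the boundary layer and the ramp are built from it.\<close>

lemma DERIV_max_square:
  "((\<lambda>y::real. (max 0 y)\<^sup>2) has_real_derivative 2 * max 0 y) (at y)"
proof (cases y "0::real" rule: linorder_cases)
  case less
  have "((\<lambda>y::real. 0) has_real_derivative 2 * max 0 y) (at y)" using less by simp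
  then show ?thesis
    by (rule has_field_derivative_transform_within_open[of _ _ _ "{..<0}"]) (use less in auto)
next
  case greater
  have "((\<lambda>y::real. y\<^sup>2) has_real_derivative 2 * max 0 y) (at y)"
    using greater by (auto intro!: derivative_eq_intros)
  then show ?thesis
    by (rule has_field_derivative_transform_within_open[of _ _ _ "{0<..}"]) (use greater in auto)
next
  case equal
  have "((\<lambda>h::real. ((max 0 (0 + h))\<^sup>2 - (max 0 0)\<^sup>2) / h) \<longlongrightarrow> 0) (at 0)"
  proof (rule Lim_null_comparison)
    show "\<forall>\<^sub>F h in at 0. norm (((max 0 (0 + h))\<^sup>2 - (max 0 0)\<^sup>2) / h) \<le> \<bar>h::real\<bar>"
      by (intro always_eventually allI) (auto simp: max_def power2_eq_square)
    show "((\<lambda>h::real. \<bar>h\<bar>) \<longlongrightarrow> 0) (at 0)" by (intro tendsto_eq_intros) auto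
  qed
  then show ?thesis using equal by (simp add: DERIV_def)
qed

text \<open>Truncation at zero does not move the approximant away from the non-negative
  \<open>f\<close>, and the sliding average keeps the sign. A uniform error
  \<open>e / (2 * L)\<close> over an interval of length \<open>L\<close> costs the other half of
  \<open>e\<close>.\<close>

lemma L1_approx_C1c_nonneg:
  assumes L: "0 < L" and f: "integrable (lebesgue_on {0..L}) f"
    and f0: "AE x in lebesgue_on {0..L}. 0 \<le> f x" and e: "0 < e"
  shows "\<exists>\<phi> \<phi>'. C1c L \<phi> \<phi>' \<and> (\<forall>x. 0 \<le> \<phi> x) \<and> (LINT x|lebesgue_on {0..L}. \<bar>\<phi> x - f x\<bar>) < e"
proof -
  obtain \<psi>' where \<psi>': "compact_supp_cont 0 L \<psi>'" "(LINT x|lebesgue_on {0..L}. \<bar>f x - \<psi>' x\<bar>) < e/2"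
    using L1_approx_continuous[OF L f, of "e/2"] e by auto
  define \<psi> where "\<psi> = (\<lambda>x. max 0 (\<psi>' x))"
  have \<psi>: "compact_supp_cont 0 L \<psi>"
    unfolding \<psi>_def by (rule compact_supp_cont_comp[OF \<psi>'(1)]) (auto intro!: continuous_intros)
  obtain \<phi> \<phi>' where \<phi>: "C1c L \<phi> \<phi>'" "\<And>x. \<exists>\<xi>. \<phi> x = \<psi> \<xi> \<and> \<bar>\<psi> \<xi> - \<psi> x\<bar> < e / (2 * L)"
    using C1c_approx[OF \<psi>, of "e / (2 * L)"] e L by auto
  note i = f compact_supp_cont_integrable[OF \<psi>'(1), of 0 L] compact_supp_cont_integrable[OF \<psi>, of 0 L]
    compact_supp_cont_integrable[OF C1c_compact_supp_cont[OF \<phi>(1)], of 0 L]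
  have "(LINT x|lebesgue_on {0..L}. \<bar>\<phi> x - f x\<bar>)
      \<le> (LINT x|lebesgue_on {0..L}. e / (2 * L) + \<bar>f x - \<psi>' x\<bar>)"
  proof (rule integral_mono_AE)
    show "AE x in lebesgue_on {0..L}. \<bar>\<phi> x - f x\<bar> \<le> e / (2 * L) + \<bar>f x - \<psi>' x\<bar>"
      using f0
    proof eventually_elim
      case (elim x)
      have "\<bar>\<phi> x - \<psi> x\<bar> \<le> e / (2 * L)" using \<phi>(2)[of x] by auto
      moreover have "\<bar>\<psi> x - f x\<bar> \<le> \<bar>f x - \<psi>' x\<bar>" using elim by (auto simp: \<psi>_def max_def)
      ultimately show ?case by linarith
    qed
  qed (use i in auto)
  also have "\<dots> = e / 2 + (LINT x|lebesgue_on {0..L}. \<bar>f x - \<psi>' x\<bar>)"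
    using i L by (simp add: measure_restrict_space)
  also have "\<dots> < e" using \<psi>'(2) by simp
  finally have "(LINT x|lebesgue_on {0..L}. \<bar>\<phi> x - f x\<bar>) < e" .
  moreover have "0 \<le> \<phi> x" for x using \<phi>(2)[of x] by (auto simp: \<psi>_def)
  ultimately show ?thesis using \<phi>(1) by blast
qed

text \<open>A C^1 function with value one at 0, dead beyond \<open>\<eta>\<close>: adding a multiple
  of it prescribes a trace at arbitrarily small L^1 cost.\<close>

lemma boundary_layer:
  fixes L \<eta> :: real
  assumes \<eta>: "0 < \<eta>" "\<eta> < L"
  defines "\<zeta> \<equiv> \<lambda>x. (max 0 (1 - x / \<eta>))\<^sup>2"
  shows "(\<zeta> has_real_derivative (- 2 / \<eta> * max 0 (1 - x / \<eta>))) (at x)"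
    and "(LINT x|lebesgue_on {0..L}. \<zeta> x) \<le> \<eta>"
    and "continuous_on S \<zeta>"
proof -
  show "(\<zeta> has_real_derivative (- 2 / \<eta> * max 0 (1 - x / \<eta>))) (at x)"
    unfolding \<zeta>_def
    by (rule DERIV_cong[OF DERIV_chain2[OF DERIV_max_square]])
      (use \<eta> in \<open>auto intro!: derivative_eq_intros\<close>)
  show c: "continuous_on S \<zeta>" for S
    unfolding \<zeta>_def using \<eta> by (intro continuous_intros) auto
  have "(LINT x|lebesgue_on {0..L}. \<zeta> x) \<le> (LINT x|lebesgue_on {0..L}. indicator {0..\<eta>} x * 1)"
  proof (rule integral_mono)
    show "integrable (lebesgue_on {0..L}) (\<lambda>x. indicator {0..\<eta>} x * (1::real))"
      using \<eta> by (intro integrable_indicator_lebesgue_on) auto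
    fix x assume "x \<in> space (lebesgue_on {0..L})"
    then have x: "0 \<le> x" by simp
    show "\<zeta> x \<le> indicator {0..\<eta>} x * 1"
    proof (cases "x \<le> \<eta>")
      case True
      then have "0 \<le> 1 - x / \<eta>" "1 - x / \<eta> \<le> 1" using x \<eta> by (auto simp: field_simps)
      then have "\<zeta> x \<le> 1" by (simp add: \<zeta>_def max_def power_le_one)
      then show ?thesis using True x by simp
    next
      case False
      then have "1 - x / \<eta> \<le> 0" using \<eta> by (simp add: field_simps)
      then have "\<zeta> x = 0" by (simp add: \<zeta>_def max_def)
      then show ?thesis by simp
    qed
  qed (intro continuous_imp_integrable_real c)
  also have "\<dots> = (LINT x|lebesgue_on {0..\<eta>}. 1)"
    using \<eta> by (intro integral_indicator_lebesgue_on) auto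
  also have "\<dots> = \<eta>" using \<eta> by (simp add: measure_restrict_space)
  finally show "(LINT x|lebesgue_on {0..L}. \<zeta> x) \<le> \<eta>" .
qed

context hazard_rate
begin

lemma C1_vanishing_near_end:
  assumes w: "\<And>x. (w has_real_derivative w' x) (at x)" and w': "continuous_on UNIV w'"
    and l: "0 < l" "l < L" and 0: "\<And>x. l < x \<Longrightarrow> w x = 0"
  shows "w \<in> W11 L" "trace0 L w = w 0" "integrable (lebesgue_on {0..L}) (\<lambda>x. m x * w x)"
    "integrable (lebesgue_on {0..L}) w"
proof -
  have cw: "continuous_on S w" for S
    using w by (meson DERIV_isCont continuous_at_imp_continuous_on)
  have cw': "continuous_on S w'" for S using w' by (rule continuous_on_subset) simp
  show wi: "integrable (lebesgue_on {0..L}) w"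
    by (intro continuous_imp_integrable_real cw)
  have "AE x in lebesgue_on {0..L}. w x = w 0 + (LINT y|lebesgue_on {0..x}. w' y)"
  proof (rule AE_I2)
    fix x assume "x \<in> space (lebesgue_on {0..L})"
    then have "(LINT y|lebesgue_on {0..x}. w' y) = w x - w 0"
      by (intro integral_FTC_lebesgue_on cw') (auto intro: has_field_derivative_at_within w)
    then show "w x = w 0 + (LINT y|lebesgue_on {0..x}. w' y)" by simp
  qed
  from W11_I[OF L continuous_imp_integrable_real[OF cw'] wi this]
  show "w \<in> W11 L" "trace0 L w = w 0" by auto
  have "integrable (lebesgue_on {0..L}) (\<lambda>x. indicator {0..l} x * (w x * m x))"
    using l by (intro integrable_indicator_lebesgue_on integrable_continuous_mult m_loc cw) auto
  moreover have "indicator {0..l} x * (w x * m x) = m x * w x" if "x \<in> {0..L}" for x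
    using that 0[of x] by (auto split: split_indicator)
  ultimately show "integrable (lebesgue_on {0..L}) (\<lambda>x. m x * w x)"
    by (subst Bochner_Integration.integrable_cong[OF refl, where g="\<lambda>x. indicator {0..l} x * (w x * m x)"]) auto
qed

text \<open>Functions in \<open>C1c\<close> are dense but have trace zero; a boundary layer of
  height \<open>c\<close> corrects this. The sum vanishes near \<open>L\<close>, so its product with
  the unbounded rate stays integrable.\<close>

lemma approx_with_trace:
  assumes f: "integrable (lebesgue_on {0..L}) f" and f0: "AE x in lebesgue_on {0..L}. 0 \<le> f x"
    and e: "0 < e" and c: "0 \<le> c"
  shows "\<exists>w. w \<in> W11 L \<and> trace0 L w = c \<and> integrable (lebesgue_on {0..L}) (\<lambda>x. m x * w x)
    \<and> integrable (lebesgue_on {0..L}) w \<and> (\<forall>x. 0 \<le> w x) \<and> (LINT x|lebesgue_on {0..L}. \<bar>w x - f x\<bar>) < e"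
proof -
  obtain \<phi> \<phi>' where \<phi>: "C1c L \<phi> \<phi>'" "\<And>x. 0 \<le> \<phi> x" "(LINT x|lebesgue_on {0..L}. \<bar>\<phi> x - f x\<bar>) < e/2"
    using L1_approx_C1c_nonneg[OF L f f0, of "e/2"] e by auto
  obtain a b where ab: "0 < a" "b < L" "\<And>x. x \<notin> {a..b} \<Longrightarrow> \<phi> x = 0"
    and c\<phi>': "continuous_on UNIV \<phi>'" and d\<phi>: "\<And>x. (\<phi> has_real_derivative \<phi>' x) (at x)"
    using \<phi>(1) unfolding C1c_def by metis
  \<comment> \<open>The first bound keeps the layer away from \<open>L\<close>; the second makes its
    cost \<open>c * \<eta>\<close> at most \<open>e / 2\<close>, with \<open>c + 1\<close> guarding
    against \<open>c = 0\<close>.\<close>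
  define \<eta> where "\<eta> = min (L / 2) (e / (2 * (c + 1)))"
  have \<eta>: "0 < \<eta>" "\<eta> < L" "\<eta> * (c + 1) \<le> e / 2"
  proof -
    show "0 < \<eta>" "\<eta> < L" using L e c by (auto simp: \<eta>_def)
    have "\<eta> \<le> e / (2 * (c + 1))" by (simp add: \<eta>_def)
    then show "\<eta> * (c + 1) \<le> e / 2" using c by (simp add: field_simps)
  qed
  define \<zeta> where "\<zeta> = (\<lambda>x. (max 0 (1 - x / \<eta>))\<^sup>2)"
  note \<zeta> = boundary_layer[OF \<eta>(1,2), folded \<zeta>_def]
  define w where "w = (\<lambda>x. \<phi> x + c * \<zeta> x)"
  have dw: "(w has_real_derivative (\<phi>' x + c * (- 2 / \<eta> * max 0 (1 - x / \<eta>)))) (at x)" for x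
    unfolding w_def by (intro DERIV_add DERIV_cmult d\<phi> \<zeta>(1))
  have cw: "continuous_on UNIV (\<lambda>x. \<phi>' x + c * (- 2 / \<eta> * max 0 (1 - x / \<eta>)))"
    using \<eta> by (intro continuous_intros c\<phi>') auto
  have w0: "w x = 0" if x: "max \<eta> b < x" for x
  proof -
    from x have "1 - x / \<eta> \<le> 0" using \<eta> by (simp add: field_simps)
    then have "\<zeta> x = 0" by (simp add: \<zeta>_def max_def)
    then show "w x = 0" using x ab(3)[of x] by (simp add: w_def)
  qed
  have "0 < max \<eta> b" "max \<eta> b < L" using \<eta> ab by auto
  note W = C1_vanishing_near_end[OF dw cw this w0]
  have \<zeta>0: "0 \<le> \<zeta> x" for x by (simp add: \<zeta>_def)
  note i = compact_supp_cont_integrable[OF C1c_compact_supp_cont[OF \<phi>(1)], of 0 L] f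
    continuous_imp_integrable_real[OF \<zeta>(3), of 0 L]
  have "(LINT x|lebesgue_on {0..L}. \<bar>w x - f x\<bar>)
    \<le> (LINT x|lebesgue_on {0..L}. \<bar>\<phi> x - f x\<bar> + c * \<zeta> x)"
  proof (rule integral_mono)
    show "\<bar>w x - f x\<bar> \<le> \<bar>\<phi> x - f x\<bar> + c * \<zeta> x" for x
    proof -
      have "0 \<le> c * \<zeta> x" using c \<zeta>0 by simp
      then show ?thesis unfolding w_def by linarith
    qed
  qed (use i W(4) in auto)
  also have "\<dots> = (LINT x|lebesgue_on {0..L}. \<bar>\<phi> x - f x\<bar>) + c * (LINT x|lebesgue_on {0..L}. \<zeta> x)"
    using i by simp
  also have "\<dots> < e"
  proof -
    have "c * (LINT x|lebesgue_on {0..L}. \<zeta> x) \<le> c * \<eta>" using \<zeta>(2) c by (rule mult_left_mono)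
    also have "\<dots> \<le> e / 2" using \<eta> by (simp add: algebra_simps)
    finally show ?thesis using \<phi>(3) by simp
  qed
  finally have "(LINT x|lebesgue_on {0..L}. \<bar>w x - f x\<bar>) < e" .
  moreover have "w 0 = c" using ab(1) ab(3)[of 0] by (simp add: w_def \<zeta>_def)
  moreover have "0 \<le> w x" for x using \<phi>(2) c \<zeta>0 by (simp add: w_def)
  ultimately show ?thesis using W by metis
qed

end

context repair_system
begin

text \<open>The trace demanded of the third entry involves the integral of the second, so the second
  is approximated before it. The zeroth entry is kept unchanged.\<close>

lemma nonneg_domA_dense:
  assumes p: "p \<in> spaceX L" "nonnegX L p" and e: "0 < e"
  shows "\<exists>q\<in>D. nonnegX L q \<and> normX L (diffX q p) < e"
proof -
  obtain a f g where pe: "p = (a, f, g)" by (cases p)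
  have fg: "integrable (lebesgue_on {0..L}) f" "integrable (lebesgue_on {0..L}) g" "0 \<le> a"
    "AE x in lebesgue_on {0..L}. 0 \<le> f x" "AE x in lebesgue_on {0..L}. 0 \<le> g x"
    using p unfolding pe spaceX_iff nonnegX_iff by auto
  obtain w1 where w1: "w1 \<in> W11 L" "trace0 L w1 = l\<^sub>1 * a" "integrable (lebesgue_on {0..L}) (\<lambda>x. \<mu>\<^sub>1 x * w1 x)"
    "\<forall>x. 0 \<le> w1 x" "(LINT x|lebesgue_on {0..L}. \<bar>w1 x - f x\<bar>) < e/2"
    using H1.approx_with_trace[OF fg(1,4), of "e/2" "l\<^sub>1 * a"] e fg(3) l_pos by auto
  have "0 \<le> (LINT x|lebesgue_on {0..L}. w1 x)" using w1(4) by (intro integral_nonneg_AE) auto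
  then have "0 \<le> l\<^sub>2 * a + l\<^sub>2 * (LINT x|lebesgue_on {0..L}. w1 x)" using fg(3) l_pos by simp
  then obtain w2 where w2: "w2 \<in> W11 L" "trace0 L w2 = l\<^sub>2 * a + l\<^sub>2 * (LINT x|lebesgue_on {0..L}. w1 x)"
    "integrable (lebesgue_on {0..L}) (\<lambda>x. \<mu>\<^sub>2 x * w2 x)"
    "\<forall>x. 0 \<le> w2 x" "(LINT x|lebesgue_on {0..L}. \<bar>w2 x - g x\<bar>) < e/2"
    using H2.approx_with_trace[OF fg(2,5), of "e/2" "l\<^sub>2 * a + l\<^sub>2 * (LINT x|lebesgue_on {0..L}. w1 x)"] e by auto
  have "(a, w1, w2) \<in> D" using w1 w2 by (simp add: domA_iff)
  moreover have "nonnegX L (a, w1, w2)" using w1 w2 fg(3) by (simp add: nonnegX_iff)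
  moreover have "normX L (diffX (a, w1, w2) p) < e"
    unfolding pe diffX.simps normX_eq using w1(5) w2(5) by simp
  ultimately show ?thesis by blast
qed

end


subsection \<open>The state space\<close>

lemma spaceX_algebra:
  assumes "p \<in> spaceX L" "q \<in> spaceX L"
  shows "addX p q \<in> spaceX L" "scaleX c p \<in> spaceX L" "diffX p q \<in> spaceX L"
  using assms by (cases p; cases q; auto simp: spaceX_iff)+

lemma diffX_conv_addX: "diffX p q = addX p (scaleX (- 1) q)"
  by (cases p; cases q) auto

lemma normX_nonneg: "0 \<le> normX L p"
  by (cases p) (auto simp only: normX_eq intro!: add_nonneg_nonneg integral_nonneg_AE)

lemma normX_scaleX: "normX L (scaleX c p) = \<bar>c\<bar> * normX L p"
  by (cases p) (simp add: normX_eq abs_mult algebra_simps del: normX.simps)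

lemma normX_addX_le:
  assumes "p \<in> spaceX L" "q \<in> spaceX L"
  shows "normX L (addX p q) \<le> normX L p + normX L q"
proof -
  obtain a f g b u v where pq: "p = (a, f, g)" "q = (b, u, v)" by (cases p; cases q)
  have i: "integrable (lebesgue_on {0..L}) f" "integrable (lebesgue_on {0..L}) g"
    "integrable (lebesgue_on {0..L}) u" "integrable (lebesgue_on {0..L}) v"
    using assms by (auto simp: pq spaceX_iff)
  have "(LINT x|lebesgue_on {0..L}. \<bar>y x + z x\<bar>)
      \<le> (LINT x|lebesgue_on {0..L}. \<bar>y x\<bar>) + (LINT x|lebesgue_on {0..L}. \<bar>z x\<bar>)"
    if "integrable (lebesgue_on {0..L}) y" "integrable (lebesgue_on {0..L}) z" for y z :: "real \<Rightarrow> real"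
  proof -
    have "(LINT x|lebesgue_on {0..L}. \<bar>y x + z x\<bar>) \<le> (LINT x|lebesgue_on {0..L}. \<bar>y x\<bar> + \<bar>z x\<bar>)"
      using that by (intro integral_mono) auto
    then show ?thesis using that by simp
  qed
  from this[OF i(1,3)] this[OF i(2,4)] show ?thesis
    unfolding pq addX.simps normX_eq by linarith
qed

lemma normX_triangle:
  assumes "p \<in> spaceX L" "q \<in> spaceX L" "r \<in> spaceX L"
  shows "normX L (diffX p r) \<le> normX L (diffX p q) + normX L (diffX q r)"
proof -
  have "diffX p r = addX (diffX p q) (diffX q r)" by (cases p; cases q; cases r) auto
  then show ?thesis
    using normX_addX_le[of "diffX p q" L "diffX q r"] assms spaceX_algebra by metis
qed

lemma normX_diffX_commute: "normX L (diffX p q) = normX L (diffX q p)"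
  by (cases p; cases q) (simp add: normX_eq abs_minus_commute del: normX.simps)

lemma eqX_refl: "eqX L p p"
  by (cases p) simp

lemma eqX_sym: "eqX L p q \<Longrightarrow> eqX L q p"
  by (cases p; cases q) (simp add: eqX_iff eq_commute del: eqX.simps)

lemma eqX_trans [trans]: "eqX L p q \<Longrightarrow> eqX L q r \<Longrightarrow> eqX L p r"
  by (cases p; cases q; cases r) (auto simp add: eqX_iff simp del: eqX.simps)

lemma eqX_addX: "eqX L p p' \<Longrightarrow> eqX L q q' \<Longrightarrow> eqX L (addX p q) (addX p' q')"
  by (cases p; cases q; cases p'; cases q') (auto simp add: eqX_iff simp del: eqX.simps)

lemma eqX_scaleX: "eqX L p p' \<Longrightarrow> eqX L (scaleX c p) (scaleX c p')"
  by (cases p; cases p') (auto simp add: eqX_iff simp del: eqX.simps)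

lemma eqX_diffX: "eqX L p p' \<Longrightarrow> eqX L q q' \<Longrightarrow> eqX L (diffX p q) (diffX p' q')"
  unfolding diffX_conv_addX by (intro eqX_addX eqX_scaleX)

lemma normX_diffX_eq_0:
  assumes "eqX L p q"
  shows "normX L (diffX p q) = 0"
proof -
  obtain a f g b u v where pq: "p = (a, f, g)" "q = (b, u, v)" by (cases p; cases q)
  have "(LINT x|lebesgue_on {0..L}. \<bar>y x - z x\<bar>) = 0"
    if "AE x in lebesgue_on {0..L}. y x = z x" for y z :: "real \<Rightarrow> real"
    by (rule integral_eq_zero_AE) (use that in auto)
  then show ?thesis
    using assms unfolding pq diffX.simps normX_eq eqX_iff by auto
qed

lemma normX_cong:
  assumes "p \<in> spaceX L" "q \<in> spaceX L" "eqX L p q"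
  shows "normX L p = normX L q"
proof -
  have z: "(0, \<lambda>x. 0, \<lambda>x. 0) \<in> spaceX L" by (simp add: spaceX_iff)
  have "normX L (diffX p (0, \<lambda>x. 0, \<lambda>x. 0)) = normX L p" for p by (cases p) simp
  note this[of p] this[of q]
  moreover have "normX L (diffX p q) = 0" "normX L (diffX q p) = 0"
    using assms normX_diffX_eq_0 normX_diffX_commute by metis+
  ultimately show ?thesis
    using normX_triangle[OF assms(1,2) z] normX_triangle[OF assms(2,1) z] by linarith
qed

section \<open>The pairing with bounded weights and total mass\<close>

lemma pairX_linear:
  assumes u: "continuous_on {0..L} u" "continuous_on {0..L} v" and pq: "p \<in> spaceX L" "q \<in> spaceX L"
  shows "pairX L c u v (diffX p q) = pairX L c u v p - pairX L c u v q"
    "pairX L c u v (scaleX r p) = r * pairX L c u v p"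
proof -
  obtain a f g b f' g' where e: "p = (a, f, g)" "q = (b, f', g')" by (cases p; cases q)
  have i: "integrable (lebesgue_on {0..L}) (\<lambda>x. u x * f x)" "integrable (lebesgue_on {0..L}) (\<lambda>x. v x * g x)"
    "integrable (lebesgue_on {0..L}) (\<lambda>x. u x * f' x)" "integrable (lebesgue_on {0..L}) (\<lambda>x. v x * g' x)"
    using pq u by (auto simp: e spaceX_iff integrable_continuous_mult)
  show "pairX L c u v (diffX p q) = pairX L c u v p - pairX L c u v q"
    using i by (simp add: e algebra_simps)
  have "(LINT x|lebesgue_on {0..L}. y x * (r * z x)) = r * (LINT x|lebesgue_on {0..L}. y x * z x)" for y z :: "real \<Rightarrow> real"
    unfolding integral_mult_right_zero[symmetric]
    by (rule Bochner_Integration.integral_cong) auto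
  then show "pairX L c u v (scaleX r p) = r * pairX L c u v p"
    by (simp add: e algebra_simps)
qed

lemma pairX_bound:
  assumes u: "continuous_on {0..L} u" "continuous_on {0..L} v" and p: "p \<in> spaceX L"
    and B: "\<bar>c\<bar> \<le> 1" "\<And>x. x \<in> {0..L} \<Longrightarrow> \<bar>u x\<bar> \<le> 1" "\<And>x. x \<in> {0..L} \<Longrightarrow> \<bar>v x\<bar> \<le> 1"
  shows "\<bar>pairX L c u v p\<bar> \<le> normX L p"
proof -
  obtain a f g where e: "p = (a, f, g)" by (cases p)
  have *: "\<bar>LINT x|lebesgue_on {0..L}. y x * z x\<bar> \<le> (LINT x|lebesgue_on {0..L}. \<bar>z x\<bar>)"
    if "continuous_on {0..L} y" "\<And>x. x \<in> {0..L} \<Longrightarrow> \<bar>y x\<bar> \<le> 1" "integrable (lebesgue_on {0..L}) z" for y z :: "real \<Rightarrow> real"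
  proof (rule order_trans[OF integral_abs_bound integral_mono])
    show "integrable (lebesgue_on {0..L}) (\<lambda>x. \<bar>y x * z x\<bar>)"
      using that by (intro integrable_abs integrable_continuous_mult)
    show "integrable (lebesgue_on {0..L}) (\<lambda>x. \<bar>z x\<bar>)" using that by simp
    fix x assume "x \<in> space (lebesgue_on {0..L})"
    then show "\<bar>y x * z x\<bar> \<le> \<bar>z x\<bar>"
      using that(2)[of x] by (simp add: abs_mult mult_left_le_one_le)
  qed
  have "\<bar>c * a\<bar> \<le> \<bar>a\<bar>" using B(1) by (simp add: abs_mult mult_left_le_one_le)
  moreover have "\<bar>LINT x|lebesgue_on {0..L}. u x * f x\<bar> \<le> (LINT x|lebesgue_on {0..L}. \<bar>f x\<bar>)"
    "\<bar>LINT x|lebesgue_on {0..L}. v x * g x\<bar> \<le> (LINT x|lebesgue_on {0..L}. \<bar>g x\<bar>)"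
    using p u B by (auto simp: e spaceX_iff intro!: *)
  ultimately show ?thesis unfolding e pairX.simps normX_eq by linarith
qed

text \<open>Unlike the norm, this is linear, yet it agrees with the norm on non-negative states;
  conservation can therefore be derived by testing.\<close>

definition massX :: "real \<Rightarrow> state \<Rightarrow> real" where
  "massX L = pairX L 1 (\<lambda>_. 1) (\<lambda>_. 1)"

lemma massX_nonneg: "nonnegX L p \<Longrightarrow> p \<in> spaceX L \<Longrightarrow> massX L p = normX L p"
proof -
  assume nn: "nonnegX L p" and p: "p \<in> spaceX L"
  obtain a f g where e: "p = (a, f, g)" by (cases p)
  have *: "(LINT x|lebesgue_on {0..L}. z x) = (LINT x|lebesgue_on {0..L}. \<bar>z x\<bar>)"
    if "AE x in lebesgue_on {0..L}. 0 \<le> z x" "integrable (lebesgue_on {0..L}) z" for z :: "real \<Rightarrow> real"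
    by (rule integral_cong_AE) (use that in \<open>auto elim: eventually_mono\<close>)
  have "(LINT x|lebesgue_on {0..L}. f x) = (LINT x|lebesgue_on {0..L}. \<bar>f x\<bar>)"
    "(LINT x|lebesgue_on {0..L}. g x) = (LINT x|lebesgue_on {0..L}. \<bar>g x\<bar>)" "0 \<le> a"
    using nn p unfolding e nonnegX_iff spaceX_iff by (blast intro: *)+
  then show ?thesis
    unfolding e massX_def pairX.simps normX_eq by simp
qed

lemma massX_diffX: "p \<in> spaceX L \<Longrightarrow> q \<in> spaceX L \<Longrightarrow> massX L (diffX p q) = massX L p - massX L q"
  unfolding massX_def by (intro pairX_linear) auto

lemma massX_le: "p \<in> spaceX L \<Longrightarrow> \<bar>massX L p\<bar> \<le> normX L p"
  unfolding massX_def by (intro pairX_bound) auto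

lemma pairX_cong:
  assumes u: "continuous_on {0..L} u" "continuous_on {0..L} v" and pq: "p \<in> spaceX L" "q \<in> spaceX L"
    and B: "\<bar>c\<bar> \<le> 1" "\<And>x. x \<in> {0..L} \<Longrightarrow> \<bar>u x\<bar> \<le> 1" "\<And>x. x \<in> {0..L} \<Longrightarrow> \<bar>v x\<bar> \<le> 1"
    and eq: "eqX L p q"
  shows "pairX L c u v p = pairX L c u v q"
  using pairX_bound[OF u spaceX_algebra(3)[OF pq], of c] B normX_diffX_eq_0[OF eq]
    pairX_linear(1)[OF u pq, of c] by simp

text \<open>Pointwise positive and negative parts do not overlap, so no norm is lost. This is what
  later gives both parts of a massless state exactly half of its norm.\<close>

lemma nonneg_parts:
  assumes "r \<in> spaceX L"
  obtains p q where "p \<in> spaceX L" "q \<in> spaceX L" "nonnegX L p" "nonnegX L q" "diffX p q = r"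
    "normX L p + normX L q = normX L r"
proof -
  obtain a f g where e: "r = (a, f, g)" by (cases r)
  define P where "P = (\<lambda>x::real. max 0 x)"
  define p where "p = (P a, \<lambda>x. P (f x), \<lambda>x. P (g x))"
  define q where "q = (P (- a), \<lambda>x. P (- f x), \<lambda>x. P (- g x))"
  have fg: "integrable (lebesgue_on {0..L}) f" "integrable (lebesgue_on {0..L}) g"
    using assms by (auto simp: e spaceX_iff)
  have i: "integrable (lebesgue_on {0..L}) (\<lambda>x. P (f x))" "integrable (lebesgue_on {0..L}) (\<lambda>x. P (- f x))"
    "integrable (lebesgue_on {0..L}) (\<lambda>x. P (g x))" "integrable (lebesgue_on {0..L}) (\<lambda>x. P (- g x))"
    using fg by (auto simp: P_def)
  have P: "0 \<le> P x" "P x - P (- x) = x" "\<bar>P x\<bar> + \<bar>P (- x)\<bar> = \<bar>x\<bar>" for x by (auto simp: P_def)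
  show thesis
  proof
    show "p \<in> spaceX L" "q \<in> spaceX L" using i by (auto simp: p_def q_def spaceX_iff)
    show "nonnegX L p" "nonnegX L q" using P by (auto simp: p_def q_def nonnegX_iff simp del: nonnegX.simps)
    show "diffX p q = r" using P by (simp add: p_def q_def e)
    have "(LINT x|lebesgue_on {0..L}. \<bar>P (z x)\<bar>) + (LINT x|lebesgue_on {0..L}. \<bar>P (- z x)\<bar>) = (LINT x|lebesgue_on {0..L}. \<bar>z x\<bar>)"
      if "integrable (lebesgue_on {0..L}) (\<lambda>x. P (z x))" "integrable (lebesgue_on {0..L}) (\<lambda>x. P (- z x))" for z :: "real \<Rightarrow> real"
      using that by (simp add: P(3) flip: Bochner_Integration.integral_add)
    from this[OF i(1,2)] this[OF i(3,4)] show "normX L p + normX L q = normX L r"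
      using P(3)[of a] unfolding p_def q_def e normX_eq by linarith
  qed
qed


subsection \<open>Orbits of the semigroup\<close>

locale repair_semigroup = repair_system +
  fixes T :: "real \<Rightarrow> state \<Rightarrow> state"
  assumes C0: "C0_semigroup L T" and positive: "positive_semigroup L T"
    and contraction: "contraction_semigroup L T" and generates: "generates L D A T"
begin

lemma T_space: "0 \<le> t \<Longrightarrow> p \<in> spaceX L \<Longrightarrow> T t p \<in> spaceX L"
  using C0 unfolding C0_semigroup_def by blast

lemma T_scaleX: "0 \<le> t \<Longrightarrow> p \<in> spaceX L \<Longrightarrow> eqX L (T t (scaleX c p)) (scaleX c (T t p))"
  using C0 unfolding C0_semigroup_def by blast

lemma T_diffX:
  assumes "0 \<le> t" "p \<in> spaceX L" "q \<in> spaceX L"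
  shows "eqX L (T t (diffX p q)) (diffX (T t p) (T t q))"
proof -
  have "eqX L (T t (addX p (scaleX (- 1) q))) (addX (T t p) (T t (scaleX (- 1) q)))"
    using C0 assms spaceX_algebra(2)[OF assms(3,3)] unfolding C0_semigroup_def by blast
  also have "eqX L \<dots> (addX (T t p) (scaleX (- 1) (T t q)))"
    by (intro eqX_addX eqX_refl T_scaleX assms)
  finally show ?thesis by (simp add: diffX_conv_addX)
qed

lemma T_zero: "p \<in> spaceX L \<Longrightarrow> eqX L (T 0 p) p"
  using C0 unfolding C0_semigroup_def by blast

lemma T_add: "0 \<le> s \<Longrightarrow> 0 \<le> t \<Longrightarrow> p \<in> spaceX L \<Longrightarrow> eqX L (T (s + t) p) (T s (T t p))"
  using C0 unfolding C0_semigroup_def by blast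

lemma T_nonneg: "0 \<le> t \<Longrightarrow> p \<in> spaceX L \<Longrightarrow> nonnegX L p \<Longrightarrow> nonnegX L (T t p)"
  using positive unfolding positive_semigroup_def by blast

lemma T_contraction: "0 \<le> t \<Longrightarrow> p \<in> spaceX L \<Longrightarrow> normX L (T t p) \<le> normX L p"
  using contraction unfolding contraction_semigroup_def by blast

lemma T_contraction_diff:
  assumes "0 \<le> t" "p \<in> spaceX L" "q \<in> spaceX L"
  shows "normX L (diffX (T t p) (T t q)) \<le> normX L (diffX p q)"
  using normX_cong[OF _ _ T_diffX[OF assms]] T_contraction[OF assms(1) spaceX_algebra(3)[OF assms(2,3)]]
    spaceX_algebra(3)[OF assms(2,3)] spaceX_algebra(3)[OF T_space T_space] T_space assms by simp

text \<open>The distance of the difference quotient from the generator. Since \<open>T t\<close> is a contraction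
  commuting with the generator, its value at \<open>p\<close> bounds its values along the whole orbit of \<open>p\<close>; hence
  one-step estimates can be summed up without differentiating in time.\<close>

definition quot_err :: "state \<Rightarrow> real \<Rightarrow> real" where
  "quot_err p h = normX L (diffX (scaleX (1 / h) (diffX (T h p) p)) (A p))"

lemma generator_iff:
  assumes "p \<in> spaceX L" "q \<in> spaceX L"
  shows "((\<lambda>h. normX L (diffX (scaleX (1 / h) (diffX (T h p) p)) q)) \<longlongrightarrow> 0) (at_right 0)
    \<longleftrightarrow> p \<in> D \<and> eqX L q (A p)"
  using generates assms unfolding generates_def by blast

lemma quot_err_tendsto:
  assumes "p \<in> D"
  shows "(quot_err p \<longlongrightarrow> 0) (at_right 0)"
  unfolding quot_err_def
  using generator_iff[OF domA_spaceX[OF assms] opA_spaceX[OF assms]] assms eqX_refl by blast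

text \<open>The quotient at \<open>T t p\<close> is \<open>T t\<close> applied to the quotient at
  \<open>p\<close>, so it converges to \<open>T t (A p)\<close>. Since \<open>generates\<close> is
  an equivalence, existence of this limit already puts \<open>T t p\<close> into the domain and
  identifies \<open>A (T t p)\<close>.\<close>

lemma quot_err_orbit:
  assumes p: "p \<in> D" and t: "0 \<le> t"
  shows "T t p \<in> D" and "\<And>h. 0 < h \<Longrightarrow> quot_err (T t p) h \<le> quot_err p h"
proof -
  note X = domA_spaceX[OF p] and AX = opA_spaceX[OF p]
  note [simp] = X AX T_space t spaceX_algebra
  have le: "normX L (diffX (scaleX (1 / h) (diffX (T h (T t p)) (T t p))) (T t (A p))) \<le> quot_err p h"
    if h: "0 < h" for h
  proof -
    define r where "r = scaleX (1 / h) (diffX (T h p) p)"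
    have rX: "r \<in> spaceX L" using h by (simp add: r_def spaceX_algebra(2)[of _ L p])
    have "eqX L (T h (T t p)) (T (h + t) p)" using h by (intro eqX_sym[OF T_add]) auto
    also have "T (h + t) p = T (t + h) p" by (simp add: add.commute)
    also have "eqX L (T (t + h) p) (T t (T h p))" using h by (intro T_add) auto
    finally have 1: "eqX L (T h (T t p)) (T t (T h p))" .
    have "eqX L (scaleX (1 / h) (diffX (T h (T t p)) (T t p))) (scaleX (1 / h) (diffX (T t (T h p)) (T t p)))"
      by (intro eqX_scaleX eqX_diffX 1 eqX_refl)
    also have "eqX L \<dots> (scaleX (1 / h) (T t (diffX (T h p) p)))"
      using h by (intro eqX_scaleX eqX_sym[OF T_diffX]) auto
    also have "eqX L \<dots> (T t r)"
      unfolding r_def using h by (intro eqX_sym[OF T_scaleX]) auto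
    finally have 2: "eqX L (scaleX (1 / h) (diffX (T h (T t p)) (T t p))) (T t r)" .
    have sX: "scaleX (1 / h) (diffX (T h (T t p)) (T t p)) \<in> spaceX L"
      using h by (simp add: spaceX_algebra(2)[of _ L p])
    have "normX L (diffX (scaleX (1 / h) (diffX (T h (T t p)) (T t p))) (T t (A p)))
      = normX L (diffX (T t r) (T t (A p)))"
      using sX rX by (intro normX_cong eqX_diffX 2 eqX_refl) auto
    also have "\<dots> \<le> normX L (diffX r (A p))" using rX by (intro T_contraction_diff) auto
    finally show ?thesis by (simp add: r_def quot_err_def)
  qed
  have "((\<lambda>h. normX L (diffX (scaleX (1 / h) (diffX (T h (T t p)) (T t p))) (T t (A p)))) \<longlongrightarrow> 0) (at_right 0)"
  proof (rule tendsto_sandwich[OF _ _ tendsto_const quot_err_tendsto[OF p]])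
    show "\<forall>\<^sub>F h in at_right 0. normX L (diffX (scaleX (1 / h) (diffX (T h (T t p)) (T t p))) (T t (A p))) \<le> quot_err p h"
      using le by (auto simp: eventually_at_filter)
  qed (auto simp: normX_nonneg)
  then have *: "T t p \<in> D" "eqX L (T t (A p)) (A (T t p))"
    using generator_iff[of "T t p" "T t (A p)"] by auto
  show "T t p \<in> D" by fact
  fix h :: real assume h: "0 < h"
  have sX: "scaleX (1 / h) (diffX (T h (T t p)) (T t p)) \<in> spaceX L"
    using h by (simp add: spaceX_algebra(2)[of _ L p])
  have "quot_err (T t p) h = normX L (diffX (scaleX (1 / h) (diffX (T h (T t p)) (T t p))) (T t (A p)))"
    unfolding quot_err_def using sX opA_spaceX[OF *(1)]
    by (intro normX_cong eqX_diffX eqX_refl eqX_sym[OF *(2)]) auto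
  then show "quot_err (T t p) h \<le> quot_err p h" using le[OF h] by simp
qed

text \<open>One explicit Euler step for the tested evolution. Weights bounded by one make the
  pairing at most the norm, so the defect is \<open>h\<close> times \<open>quot_err\<close>.\<close>

lemma pairX_step:
  assumes q: "q \<in> D" and h: "0 < h"
    and u: "continuous_on {0..L} u" "continuous_on {0..L} v"
    and B: "\<bar>c\<bar> \<le> 1" "\<And>x. x \<in> {0..L} \<Longrightarrow> \<bar>u x\<bar> \<le> 1" "\<And>x. x \<in> {0..L} \<Longrightarrow> \<bar>v x\<bar> \<le> 1"
  shows "\<bar>pairX L c u v (T h q) - (pairX L c u v q + h * pairX L c u v (A q))\<bar> \<le> h * quot_err q h"
proof -
  note X = domA_spaceX[OF q] and AX = opA_spaceX[OF q]
  have TX: "T h q \<in> spaceX L" using h X by (intro T_space) auto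
  have dX: "diffX (T h q) q \<in> spaceX L" by (rule spaceX_algebra(3)[OF TX X])
  have sX: "scaleX (1 / h) (diffX (T h q) q) \<in> spaceX L" by (rule spaceX_algebra(2)[OF dX dX])
  let ?P = "pairX L c u v"
  have "\<bar>?P (diffX (scaleX (1 / h) (diffX (T h q) q)) (A q))\<bar> \<le> quot_err q h"
    unfolding quot_err_def using spaceX_algebra(3)[OF sX AX] by (intro pairX_bound u B) auto
  also have "?P (diffX (scaleX (1 / h) (diffX (T h q) q)) (A q)) = 1 / h * (?P (T h q) - ?P q) - ?P (A q)"
    using pairX_linear(1)[OF u sX AX] pairX_linear(2)[OF u dX dX] pairX_linear(1)[OF u TX X] by simp
  finally have "h * \<bar>1 / h * (?P (T h q) - ?P q) - ?P (A q)\<bar> \<le> h * quot_err q h"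
    using h by (intro mult_left_mono) auto
  moreover have "h * \<bar>1 / h * (?P (T h q) - ?P q) - ?P (A q)\<bar> = \<bar>h * (1 / h * (?P (T h q) - ?P q) - ?P (A q))\<bar>"
    using h by (simp add: abs_mult)
  moreover have "h * (1 / h * (?P (T h q) - ?P q) - ?P (A q)) = ?P (T h q) - (?P q + h * ?P (A q))"
    using h by (simp add: field_simps)
  ultimately show ?thesis by simp
qed

lemma quot_err_sequence:
  assumes "p \<in> D" "0 < t"
  shows "(\<lambda>n. quot_err p (t / real (Suc n))) \<longlonglongrightarrow> 0"
proof -
  have "filterlim (\<lambda>n. t / real (Suc n)) (at_right 0) sequentially"
    unfolding filterlim_at
  proof (intro conjI always_eventually allI)
    have "(\<lambda>n. t * inverse (real (Suc n))) \<longlonglongrightarrow> t * 0"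
      by (intro tendsto_intros LIMSEQ_inverse_real_of_nat)
    then show "(\<lambda>n. t / real (Suc n)) \<longlonglongrightarrow> 0" by (simp add: divide_inverse)
  qed (use assms(2) in auto)
  from filterlim_compose[OF quot_err_tendsto[OF assms(1)] this] show ?thesis .
qed

section \<open>Conservation of mass and invariance of the steady state\<close>

lemma T_step_eq:
  assumes "p \<in> spaceX L" "0 < h"
  shows "eqX L (T (real (Suc j) * h) p) (T h (T (real j * h) p))"
proof -
  have "real (Suc j) * h = h + real j * h" by (simp add: algebra_simps)
  then show ?thesis using T_add[of h "real j * h" p] assms by simp
qed

text \<open>For the constant weight one every coefficient in \<open>pairX_opA\<close> cancels: what
  leaves one entry enters another.\<close>

lemma massX_opA: "q \<in> D \<Longrightarrow> massX L (A q) = 0"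
  using pairX_opA(1)[of "fst q" "fst (snd q)" "snd (snd q)" "\<lambda>_. 1" "\<lambda>_. 0" "\<lambda>_. 1" "\<lambda>_. 0" 1]
  by (simp add: massX_def)

text \<open>Each of \<open>Suc n\<close> steps of length \<open>t / Suc n\<close> changes the mass
  by at most \<open>h * quot_err p h\<close>, with the error taken at the initial state. The total
  \<open>t * quot_err p h\<close> tends to zero.\<close>

lemma massX_T_domA:
  assumes p: "p \<in> D" and t: "0 < t"
  shows "massX L (T t p) = massX L p"
proof -
  note X = domA_spaceX[OF p]
  have "\<bar>massX L (T t p) - massX L p\<bar> \<le> t * quot_err p (t / real (Suc n))" for n
  proof -
    define h where "h = t / real (Suc n)"
    have h: "0 < h" using t by (simp add: h_def)
    have st: "\<bar>massX L (T (real j * h) p) - massX L p\<bar> \<le> real j * (h * quot_err p h)" for j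
    proof (induction j)
      case 0
      have "massX L (T 0 p) = massX L p"
        unfolding massX_def using X T_space T_zero by (intro pairX_cong) auto
      then show ?case by simp
    next
      case (Suc j)
      have j: "0 \<le> real j * h" using h by simp
      note q = quot_err_orbit[OF p j]
      have "massX L (T (real (Suc j) * h) p) = massX L (T h (T (real j * h) p))"
        unfolding massX_def using X T_space h j T_step_eq[OF X h, of j]
        by (intro pairX_cong) auto
      moreover have "\<bar>massX L (T h (T (real j * h) p)) - massX L (T (real j * h) p)\<bar> \<le> h * quot_err (T (real j * h) p) h"
        using pairX_step[OF q(1) h, of "\<lambda>_. 1" "\<lambda>_. 1" 1] massX_opA[OF q(1)] by (simp add: massX_def)
      moreover have "h * quot_err (T (real j * h) p) h \<le> h * quot_err p h"
        using q(2)[OF h] h by simp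
      ultimately show ?case using Suc by (simp add: algebra_simps)
    qed
    have nh: "real (Suc n) * h = t" by (simp add: h_def)
    then have "real (Suc n) * (h * quot_err p h) = t * quot_err p h" by (metis mult.assoc)
    then show ?thesis using st[of "Suc n"] unfolding nh h_def[symmetric] by linarith
  qed
  moreover have "(\<lambda>n. t * quot_err p (t / real (Suc n))) \<longlonglongrightarrow> t * 0"
    by (intro tendsto_intros quot_err_sequence p t)
  ultimately have "\<bar>massX L (T t p) - massX L p\<bar> \<le> t * 0"
    by (intro tendsto_lowerbound[of _ _ sequentially]) auto
  then show ?thesis by simp
qed

text \<open>Mass and \<open>T t\<close> are both non-expansive, so the identity passes to limits of
  domain elements; the approximation available is the one for non-negative states.\<close>

lemma massX_T_nonneg:
  assumes p: "p \<in> spaceX L" "nonnegX L p" and t: "0 < t"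
  shows "massX L (T t p) = massX L p"
proof -
  have "\<bar>massX L (T t p) - massX L p\<bar> \<le> e" if e: "e > 0" for e
  proof -
    obtain q where q: "q \<in> D" "normX L (diffX q p) < e / 2"
      using nonneg_domA_dense[OF p, of "e/2"] e by auto
    note X = domA_spaceX[OF q(1)]
    have "\<bar>massX L q - massX L p\<bar> \<le> normX L (diffX q p)"
      using massX_le[OF spaceX_algebra(3)[OF X p(1)]] massX_diffX[OF X p(1)] by simp
    moreover have "\<bar>massX L (T t q) - massX L (T t p)\<bar> \<le> normX L (diffX (T t q) (T t p))"
      using massX_le[OF spaceX_algebra(3)] massX_diffX T_space X p(1) t by (metis less_imp_le)
    moreover have "normX L (diffX (T t q) (T t p)) \<le> normX L (diffX q p)"
      using t X p by (intro T_contraction_diff) auto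
    ultimately show ?thesis using massX_T_domA[OF q(1) t] q(2) by linarith
  qed
  then show ?thesis
    by (metis abs_le_zero_iff dense_ge eq_iff_diff_eq_0)
qed

text \<open>With \<open>A pe\<close> zero almost everywhere, \<open>quot_err pe h\<close> is the
  norm of the quotient itself. By contraction each further step adds at most
  \<open>h * quot_err pe h\<close> to the displacement, and the sum over all steps tends to
  zero.\<close>

lemma T_steady_state:
  assumes t: "0 \<le> t"
  shows "normX L (diffX (T t pe) pe) = 0"
proof (cases "t = 0")
  case True
  then show ?thesis using normX_diffX_eq_0 T_zero steady_state(1) domA_spaceX by blast
next
  case False
  then have t: "0 < t" using t by simp
  note X = domA_spaceX[OF steady_state(1)] and AX = opA_spaceX[OF steady_state(1)]
  have "normX L (diffX (T t pe) pe) \<le> t * quot_err pe (t / real (Suc n))" for n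
  proof -
    define h where "h = t / real (Suc n)"
    have h: "0 < h" using t by (simp add: h_def)
    have dX: "diffX (T h pe) pe \<in> spaceX L" using h X by (intro spaceX_algebra T_space) auto
    have sX: "scaleX (1 / h) (diffX (T h pe) pe) \<in> spaceX L" by (rule spaceX_algebra(2)[OF dX dX])
    have zX: "zeroX \<in> spaceX L" by (simp add: zeroX_def spaceX_iff)
    have "quot_err pe h = normX L (diffX (scaleX (1 / h) (diffX (T h pe) pe)) zeroX)"
      unfolding quot_err_def 
      by (rule normX_cong[OF spaceX_algebra(3)[OF sX AX] spaceX_algebra(3)[OF sX zX]
            eqX_diffX[OF eqX_refl steady_state(2)]])
    also have "diffX r zeroX = r" for r by (cases r) (simp add: zeroX_def)
    finally have one: "normX L (diffX (T h pe) pe) = h * quot_err pe h"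
      using h by (simp add: normX_scaleX)
    have st: "normX L (diffX (T (real j * h) pe) pe) \<le> real j * (h * quot_err pe h)" for j
    proof (induction j)
      case 0
      show ?case using normX_diffX_eq_0[OF T_zero[OF X]] by simp
    next
      case (Suc j)
      have j: "0 \<le> real j * h" using h by simp
      note TX = T_space[OF j X] T_space[OF less_imp_le[OF h] X]
        T_space[OF less_imp_le[OF h] T_space[OF j X]]
      have sj: "0 \<le> real (Suc j) * h" using h by simp
      have "normX L (diffX (T (real (Suc j) * h) pe) pe) = normX L (diffX (T h (T (real j * h) pe)) pe)"
        by (rule normX_cong[OF spaceX_algebra(3)[OF T_space[OF sj X] X] spaceX_algebra(3)[OF TX(3) X]
              eqX_diffX[OF T_step_eq[OF X h, of j] eqX_refl]])
      also have "\<dots> \<le> normX L (diffX (T h (T (real j * h) pe)) (T h pe)) + normX L (diffX (T h pe) pe)"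
        by (intro normX_triangle TX X)
      also have "normX L (diffX (T h (T (real j * h) pe)) (T h pe)) \<le> normX L (diffX (T (real j * h) pe) pe)"
        using h by (intro T_contraction_diff TX X) auto
      finally show ?case using Suc one by (simp add: algebra_simps)
    qed
    have nh: "real (Suc n) * h = t" by (simp add: h_def)
    then have "real (Suc n) * (h * quot_err pe h) = t * quot_err pe h" by (metis mult.assoc)
    then show ?thesis using st[of "Suc n"] unfolding nh h_def[symmetric] by linarith
  qed
  moreover have "(\<lambda>n. t * quot_err pe (t / real (Suc n))) \<longlonglongrightarrow> t * 0"
    by (intro tendsto_intros quot_err_sequence steady_state t)
  ultimately have "normX L (diffX (T t pe) pe) \<le> t * 0"
    by (intro tendsto_lowerbound[of _ _ sequentially]) auto
  then show ?thesis using normX_nonneg[of L "diffX (T t pe) pe"] by simp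
qed

end


subsection \<open>Convergence to the steady state\<close>

context repair_semigroup
begin

section \<open>Lower bound for the zeroth entry after time \<open>2 * L\<close>\<close>

definition ramp :: "real \<Rightarrow> real" where
  "ramp y = (max 0 (y - L))\<^sup>2 / (4 * L\<^sup>2)"

definition ramp' :: "real \<Rightarrow> real" where
  "ramp' y = 2 * max 0 (y - L) / (4 * L\<^sup>2)"

lemma DERIV_ramp: "(ramp has_real_derivative ramp' y) (at y)"
proof -
  have "((\<lambda>y. (max 0 (y - L))\<^sup>2) has_real_derivative 2 * max 0 (y - L)) (at y)"
    by (rule DERIV_cong[OF DERIV_chain2[OF DERIV_max_square]])
      (auto intro!: derivative_eq_intros)
  then show ?thesis
    unfolding ramp_def[abs_def] ramp'_def by (rule DERIV_cdivide)
qed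

text \<open>With remaining time at most \<open>2 * L\<close> and age at most \<open>L\<close>,
  arguments never exceed \<open>3 * L\<close>; the divisor \<open>4 * L\<^sup>2\<close> in
  \<open>ramp\<close> makes its value there exactly one.\<close>

lemma ramp_bounds:
  shows "0 \<le> ramp y" "0 \<le> ramp' y" "y \<le> 3 * L \<Longrightarrow> ramp y \<le> 1" "y \<le> L \<Longrightarrow> ramp y = 0"
    "2 * L \<le> y \<Longrightarrow> 1 / 4 \<le> ramp y"
proof -
  show "0 \<le> ramp y" "0 \<le> ramp' y" using L_pos by (auto simp: ramp_def ramp'_def)
  show "ramp y = 0" if "y \<le> L" using that by (simp add: ramp_def max_def)
  show "ramp y \<le> 1" if "y \<le> 3 * L"
  proof -
    have "(max 0 (y - L))\<^sup>2 \<le> (2 * L)\<^sup>2" using that L_pos by (intro power_mono) auto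
    then show ?thesis using L_pos by (simp add: ramp_def power_mult_distrib)
  qed
  show "1 / 4 \<le> ramp y" if "2 * L \<le> y"
  proof -
    have "L\<^sup>2 \<le> (max 0 (y - L))\<^sup>2" using that L_pos by (intro power_mono) auto
    then show ?thesis using L_pos by (simp add: ramp_def field_simps)
  qed
qed

text \<open>Squaring \<open>max 0 (y + h - L) \<le> max 0 (y - L) + h\<close> gives a first-order
  Taylor bound even across the kink. The remainder is quadratic in \<open>h\<close>, so it vanishes
  after summation over the steps.\<close>

lemma ramp_increment:
  assumes "0 \<le> h"
  shows "ramp (y + h) \<le> ramp y + h * ramp' y + h\<^sup>2 / (4 * L\<^sup>2)"
proof -
  define m where "m = max 0 (y - L)"
  have "max 0 (y + h - L) \<le> m + h" using assms by (auto simp: m_def)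
  then have "(max 0 (y + h - L))\<^sup>2 \<le> (m + h)\<^sup>2" by (intro power_mono) auto
  also have "\<dots> = m\<^sup>2 + h * (2 * m) + h\<^sup>2" by (simp add: power2_eq_square algebra_simps)
  finally have "(max 0 (y + h - L))\<^sup>2 / (4 * L\<^sup>2) \<le> (m\<^sup>2 + h * (2 * m) + h\<^sup>2) / (4 * L\<^sup>2)"
    using L_pos by (intro divide_right_mono) auto
  then show ?thesis by (simp add: ramp_def ramp'_def m_def add_divide_distrib)
qed

lemma continuous_ramp: "continuous_on S (\<lambda>x. ramp (s + x))" "continuous_on S (\<lambda>x. ramp' (s + x))"
  unfolding ramp_def ramp'_def using L_pos by (intro continuous_intros; simp)+

text \<open>A component in a repair state of age \<open>x\<close> whose failure clock does not ring for \<open>L\<close> units of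
  time has been repaired by then. The weight \<open>ramp (s + x)\<close> is a smooth lower bound for the
  indicator of \<open>L \<le> s + x\<close>, i.e. of being repaired within the remaining time \<open>s\<close>.\<close>

definition ramp_pair :: "real \<Rightarrow> state \<Rightarrow> real" where
  "ramp_pair s = pairX L 1 (\<lambda>x. ramp (s + x)) (\<lambda>x. ramp (s + x))"

text \<open>Discrete form of the subsolution property: as time advances by \<open>h\<close>, the
  remaining time drops from \<open>s + h\<close> to \<open>s\<close>. Repair terms are non-negative
  because the ramp is at most one, and terms entering at age zero are non-negative as well; both are
  discarded. The remaining losses have rate at most \<open>l\<^sub>1 + l\<^sub>2\<close>, so
  \<open>1 - (l\<^sub>1 + l\<^sub>2) * h\<close> is the first-order probability that no clock
  rings.\<close>

lemma ramp_pair_step: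
  assumes q: "q \<in> D" "nonnegX L q" and s: "0 \<le> s" "s + h \<le> 2 * L" and h: "0 < h" "(l\<^sub>1 + l\<^sub>2) * h \<le> 1"
  shows "(1 - (l\<^sub>1 + l\<^sub>2) * h) * ramp_pair (s + h) q - h\<^sup>2 / (4 * L\<^sup>2) * normX L q
    \<le> ramp_pair s q + h * ramp_pair s (A q)"
proof -
  obtain q0 q1 q2 where qe: "q = (q0, q1, q2)" by (cases q)
  define \<Lambda> where "\<Lambda> = l\<^sub>1 + l\<^sub>2"
  define C where "C = h\<^sup>2 / (4 * L\<^sup>2)"
  define r where "r = (\<lambda>x. ramp (s + x))"
  define r' where "r' = (\<lambda>x. ramp' (s + x))"
  define R where "R = (\<lambda>x. ramp (s + h + x))"
  have \<Lambda>: "0 < \<Lambda>" "0 \<le> 1 - \<Lambda> * h" "1 - \<Lambda> * h \<le> 1" using l_pos h by (auto simp: \<Lambda>_def)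
  have C: "0 \<le> C" by (simp add: C_def)
  have qi: "integrable (lebesgue_on {0..L}) q1" "integrable (lebesgue_on {0..L}) q2"
    using domA_spaceX[OF q(1)] by (auto simp: qe spaceX_iff)
  have q0: "0 \<le> q0" "AE x in lebesgue_on {0..L}. 0 \<le> q1 x" "AE x in lebesgue_on {0..L}. 0 \<le> q2 x"
    using q(2) unfolding qe nonnegX_iff by auto
  have cr: "continuous_on {0..L} r" "continuous_on {0..L} r'" "continuous_on {0..L} R"
    unfolding r_def r'_def R_def by (rule continuous_ramp)+
  have dr: "(r has_real_derivative r' x) (at x within {0..L})" for x
    unfolding r_def r'_def
    by (rule has_field_derivative_at_within, rule DERIV_cong[OF DERIV_chain2[OF DERIV_ramp]])
      (auto intro!: derivative_eq_intros)
  note opA = pairX_opA[OF q(1)[unfolded qe] dr cr(2) dr cr(2), of 1]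
  have rb: "0 \<le> r x" "0 \<le> r' x" "r x \<le> 1" "0 \<le> R x" if "x \<in> {0..L}" for x
    using that s h ramp_bounds by (auto simp: r_def r'_def R_def)
  have inc: "(1 - \<Lambda> * h) * R x - C \<le> (1 - \<Lambda> * h) * r x + h * r' x" if x: "x \<in> {0..L}" for x
  proof -
    define B where "B = 1 - \<Lambda> * h"
    define d where "d = h * r' x + C"
    have "R x \<le> r x + d"
      using ramp_increment[of h "s + x"] h by (simp add: r_def r'_def R_def C_def d_def ac_simps)
    then have "B * R x \<le> B * r x + B * d"
      using \<Lambda> unfolding B_def by (metis distrib_left mult_left_mono)
    moreover have "B * d \<le> 1 * d"
      unfolding B_def d_def using \<Lambda> rb(2)[OF x] h C by (intro mult_right_mono) auto
    ultimately show ?thesis unfolding B_def[symmetric] using d_def by linarith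
  qed
  let ?g1 = "\<lambda>x. (r' x + \<mu>\<^sub>1 x * (1 - r x) - l\<^sub>2 * r x + l\<^sub>2 * r 0) * q1 x"
  let ?g2 = "\<lambda>x. (r' x + \<mu>\<^sub>2 x * (1 - r x)) * q2 x"
  \<comment> \<open>Serves both age entries: \<open>z\<close> is the density and \<open>w\<close>
    its coefficient from \<open>pairX_opA\<close>, of which only the lower bound
    \<open>r' x - \<Lambda> * r x\<close> matters.\<close>
  have b: "(LINT x|lebesgue_on {0..L}. (1 - \<Lambda> * h) * (R x * z x) - C * \<bar>z x\<bar>)
    \<le> (LINT x|lebesgue_on {0..L}. r x * z x + h * (w x * z x))"
    if z: "integrable (lebesgue_on {0..L}) z" "AE x in lebesgue_on {0..L}. 0 \<le> z x"
      and w: "integrable (lebesgue_on {0..L}) (\<lambda>x. w x * z x)"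
      and wr: "\<And>x. x \<in> {0..L} \<Longrightarrow> r' x - \<Lambda> * r x \<le> w x" for z w :: "real \<Rightarrow> real"
  proof (rule integral_mono_AE)
    show "integrable (lebesgue_on {0..L}) (\<lambda>x. (1 - \<Lambda> * h) * (R x * z x) - C * \<bar>z x\<bar>)"
      using integrable_continuous_mult[OF z(1) cr(3)] z(1) by simp
    show "integrable (lebesgue_on {0..L}) (\<lambda>x. r x * z x + h * (w x * z x))"
      using integrable_continuous_mult[OF z(1) cr(1)] w by simp
    show "AE x in lebesgue_on {0..L}. (1 - \<Lambda> * h) * (R x * z x) - C * \<bar>z x\<bar> \<le> r x * z x + h * (w x * z x)"
    proof (rule lebesgue_on_mono[OF z(2)])
      fix x assume zx: "0 \<le> z x" and x: "x \<in> {0..L}"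
      have "h * (r' x - \<Lambda> * r x) \<le> h * w x" using wr[OF x] h by (intro mult_left_mono) auto
      then have "(1 - \<Lambda> * h) * R x - C \<le> r x + h * w x" using inc[OF x] by (simp add: algebra_simps)
      then have "((1 - \<Lambda> * h) * R x - C) * z x \<le> (r x + h * w x) * z x"
        using zx by (rule mult_right_mono)
      then show "(1 - \<Lambda> * h) * (R x * z x) - C * \<bar>z x\<bar> \<le> r x * z x + h * (w x * z x)"
        using zx by (simp add: algebra_simps)
    qed
  qed
  have "r' x - \<Lambda> * r x \<le> r' x + \<mu>\<^sub>1 x * (1 - r x) - l\<^sub>2 * r x + l\<^sub>2 * r 0" if x: "x \<in> {0..L}" for x
  proof -
    have "0 \<le> \<mu>\<^sub>1 x * (1 - r x)" "0 \<le> l\<^sub>1 * r x" "0 \<le> l\<^sub>2 * r 0"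
      using H1.m_nonneg[OF x] rb[OF x] rb[of 0] l_pos L_pos by auto
    then show ?thesis by (simp add: \<Lambda>_def algebra_simps)
  qed
  note b1 = b[OF qi(1) q0(2) opA(2) this]
  have "r' x - \<Lambda> * r x \<le> r' x + \<mu>\<^sub>2 x * (1 - r x)" if x: "x \<in> {0..L}" for x
  proof -
    have "0 \<le> \<mu>\<^sub>2 x * (1 - r x)" "0 \<le> \<Lambda> * r x"
      using H2.m_nonneg[OF x] rb[OF x] \<Lambda> by auto
    then show ?thesis by linarith
  qed
  note b2 = b[OF qi(2) q0(3) opA(3) this]
  have i: "integrable (lebesgue_on {0..L}) (\<lambda>x. R x * q1 x)" "integrable (lebesgue_on {0..L}) (\<lambda>x. R x * q2 x)"
    "integrable (lebesgue_on {0..L}) (\<lambda>x. r x * q1 x)" "integrable (lebesgue_on {0..L}) (\<lambda>x. r x * q2 x)"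
    using integrable_continuous_mult qi cr by auto
  note b1' = b1[unfolded Bochner_Integration.integral_add[OF i(3) integrable_mult_right[OF opA(2)]]
      Bochner_Integration.integral_diff[OF integrable_mult_right[OF i(1)] integrable_mult_right[OF integrable_abs[OF qi(1)]]]
      integral_mult_right_zero]
  note b2' = b2[unfolded Bochner_Integration.integral_add[OF i(4) integrable_mult_right[OF opA(3)]]
      Bochner_Integration.integral_diff[OF integrable_mult_right[OF i(2)] integrable_mult_right[OF integrable_abs[OF qi(2)]]]
      integral_mult_right_zero]
  have n0: "(1 - \<Lambda> * h) * q0 - C * q0 \<le> q0 + h * ((- (l\<^sub>1 + l\<^sub>2) * 1 + l\<^sub>1 * r 0 + l\<^sub>2 * r 0) * q0)"
  proof -
    have "0 \<le> C * q0" "0 \<le> h * ((l\<^sub>1 * r 0 + l\<^sub>2 * r 0) * q0)"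
      using C q0 h l_pos rb[of 0] L_pos by auto
    then show ?thesis by (simp add: \<Lambda>_def algebra_simps)
  qed
  have 1: "ramp_pair (s + h) q = q0 + (LINT x|lebesgue_on {0..L}. R x * q1 x) + (LINT x|lebesgue_on {0..L}. R x * q2 x)"
    unfolding ramp_pair_def qe pairX.simps R_def by simp
  have 2: "ramp_pair s q = q0 + (LINT x|lebesgue_on {0..L}. r x * q1 x) + (LINT x|lebesgue_on {0..L}. r x * q2 x)"
    unfolding ramp_pair_def qe pairX.simps r_def by simp
  have 3: "ramp_pair s (A q) = (- (l\<^sub>1 + l\<^sub>2) * 1 + l\<^sub>1 * r 0 + l\<^sub>2 * r 0) * q0
    + (LINT x|lebesgue_on {0..L}. ?g1 x) + (LINT x|lebesgue_on {0..L}. ?g2 x)"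
    unfolding ramp_pair_def qe r_def[symmetric] by (rule opA(1))
  have 4: "normX L q = q0 + (LINT x|lebesgue_on {0..L}. \<bar>q1 x\<bar>) + (LINT x|lebesgue_on {0..L}. \<bar>q2 x\<bar>)"
    unfolding qe normX_eq using q0 by simp
  show ?thesis
    unfolding 1 2 3 4 C_def[symmetric] \<Lambda>_def[symmetric] distrib_left
    using b1' b2' n0[unfolded \<Lambda>_def[symmetric]] by linarith
qed

text \<open>Along the Euler scheme the weight runs from remaining time \<open>2 * L\<close> down to
  0. Initially the pairing is at least a quarter of the norm; finally it is the zeroth entry alone.
  The damping factors multiply to a power that tends to
  \<open>exp (- \<Lambda> * \<tau>)\<close>.\<close>

lemma fst_T_lower_domA:
  assumes p: "p \<in> D" "nonnegX L p"
  shows "exp (- 2 * L * (l\<^sub>1 + l\<^sub>2)) / 4 * normX L p \<le> fst (T (2 * L) p)"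
proof -
  note X = domA_spaceX[OF p(1)]
  define \<Lambda> where "\<Lambda> = l\<^sub>1 + l\<^sub>2"
  define \<tau> where "\<tau> = 2 * L"
  have \<tau>: "0 < \<tau>" using L_pos by (simp add: \<tau>_def)
  \<comment> \<open>The total error of \<open>Suc n\<close> steps: the defect of the difference
    quotient and the Taylor remainder of the ramp, both evaluated at the initial state.\<close>
  define \<delta> where "\<delta> = (\<lambda>n. \<tau> * quot_err p (\<tau> / real (Suc n)) + \<tau> * (\<tau> / real (Suc n)) / (4 * L\<^sup>2) * normX L p)"
  have ramp1: "\<bar>ramp (s + x)\<bar> \<le> 1" if "x \<in> {0..L}" "s \<le> \<tau>" for s x
    using that ramp_bounds(1,3)[of "s + x"] by (auto simp: \<tau>_def)
  have cong: "ramp_pair s q = ramp_pair s q'"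
    if "q \<in> spaceX L" "q' \<in> spaceX L" "eqX L q q'" "s \<le> \<tau>" for s q q'
    unfolding ramp_pair_def using that ramp1 by (intro pairX_cong continuous_ramp) auto
  have main: "(1 - \<Lambda> * \<tau> / real (Suc n)) ^ Suc n * (normX L p / 4) - \<delta> n \<le> fst (T \<tau> p)"
    if n: "\<Lambda> * \<tau> \<le> real (Suc n)" for n
  proof -
    define h where "h = \<tau> / real (Suc n)"
    have h: "0 < h" "\<Lambda> * h \<le> 1" using \<tau> n by (auto simp: h_def field_simps)
    have nh: "real (Suc n) * h = \<tau>" by (simp add: h_def)
    define err where "err = h * quot_err p h + h\<^sup>2 / (4 * L\<^sup>2) * normX L p"
    define B where "B = 1 - \<Lambda> * h"
    have \<Lambda>0: "0 \<le> \<Lambda>" using l_pos by (simp add: \<Lambda>_def)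
    have B: "0 \<le> B" "B \<le> 1" using h \<Lambda>0 by (auto simp: B_def)
    have err: "0 \<le> err" using h normX_nonneg by (auto simp: err_def quot_err_def intro!: add_nonneg_nonneg)
    \<comment> \<open>Since \<open>0 \<le> B \<le> 1\<close>, earlier errors are not amplified by
      later steps and simply add up. The bound on \<open>n\<close> in \<open>main\<close> is what
      makes \<open>B\<close> non-negative.\<close>
    have st: "B ^ j * ramp_pair \<tau> p - real j * err \<le> ramp_pair (\<tau> - real j * h) (T (real j * h) p)"
      if "j \<le> Suc n" for j
      using that
    proof (induction j)
      case 0
      have "ramp_pair \<tau> (T 0 p) = ramp_pair \<tau> p" using X T_space T_zero by (intro cong) auto
      then show ?case by simp
    next
      case (Suc j)
      define q where "q = T (real j * h) p"
      define s where "s = \<tau> - real (Suc j) * h"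
      have j: "0 \<le> real j * h" using h by simp
      have le: "real (Suc j) * h \<le> real (Suc n) * h" using Suc.prems h by (intro mult_right_mono) auto
      have s: "0 \<le> s" "s + h = \<tau> - real j * h" "s + h \<le> 2 * L" "s \<le> \<tau>"
      proof -
        show "0 \<le> s" using le unfolding s_def nh by simp
        show *: "s + h = \<tau> - real j * h" by (simp add: s_def algebra_simps)
        show "s + h \<le> 2 * L" "s \<le> \<tau>" using * j h(1) unfolding \<tau>_def by linarith+
      qed
      have q: "q \<in> D" "quot_err q h \<le> quot_err p h" "nonnegX L q" "normX L q \<le> normX L p"
        unfolding q_def using quot_err_orbit[OF p(1) j] h T_nonneg[OF j X p(2)] T_contraction[OF j X] by auto
      note qX = domA_spaceX[OF q(1)]
      have "ramp_pair s (T (real (Suc j) * h) p) = ramp_pair s (T h q)"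
        unfolding q_def using X T_space h j s(4) T_step_eq[OF X h(1), of j] by (intro cong) auto
      moreover have "\<bar>ramp_pair s (T h q) - (ramp_pair s q + h * ramp_pair s (A q))\<bar> \<le> h * quot_err q h"
        unfolding ramp_pair_def using s ramp1 by (intro pairX_step q h continuous_ramp) auto
      moreover have "h * quot_err q h \<le> h * quot_err p h" using q(2) h by simp
      moreover have "B * ramp_pair (s + h) q - h\<^sup>2 / (4 * L\<^sup>2) * normX L q \<le> ramp_pair s q + h * ramp_pair s (A q)"
        unfolding B_def \<Lambda>_def using h s by (intro ramp_pair_step q) (auto simp: \<Lambda>_def)
      moreover have "h\<^sup>2 / (4 * L\<^sup>2) * normX L q \<le> h\<^sup>2 / (4 * L\<^sup>2) * normX L p"
        using q(4) by (intro mult_left_mono) auto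
      moreover have "B * (B ^ j * ramp_pair \<tau> p - real j * err) \<le> B * ramp_pair (s + h) q"
        using Suc B(1) s(2) by (intro mult_left_mono) (auto simp: q_def)
      moreover have "B * (real j * err) \<le> real j * err"
        using B err by (intro mult_left_le_one_le) auto
      moreover have "B * (B ^ j * ramp_pair \<tau> p - real j * err) = B ^ Suc j * ramp_pair \<tau> p - B * (real j * err)"
        "real (Suc j) * err = real j * err + err"
        by (simp_all add: algebra_simps)
      ultimately show ?case unfolding s_def[symmetric] using err_def by linarith
    qed
    obtain a f g where pe: "p = (a, f, g)" by (cases p)
    have fg: "integrable (lebesgue_on {0..L}) f" "integrable (lebesgue_on {0..L}) g" "0 \<le> a"
      "AE x in lebesgue_on {0..L}. 0 \<le> f x" "AE x in lebesgue_on {0..L}. 0 \<le> g x"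
      using X p(2) unfolding pe spaceX_iff nonnegX_iff by auto
    have start: "normX L p / 4 \<le> ramp_pair \<tau> p"
    proof -
      have *: "(LINT x|lebesgue_on {0..L}. \<bar>z x\<bar>) / 4 \<le> (LINT x|lebesgue_on {0..L}. ramp (\<tau> + x) * z x)"
        if z: "integrable (lebesgue_on {0..L}) z" "AE x in lebesgue_on {0..L}. 0 \<le> z x" for z :: "real \<Rightarrow> real"
      proof -
        have "(LINT x|lebesgue_on {0..L}. \<bar>z x\<bar> / 4) \<le> (LINT x|lebesgue_on {0..L}. ramp (\<tau> + x) * z x)"
        proof (rule integral_mono_AE)
          show "integrable (lebesgue_on {0..L}) (\<lambda>x. ramp (\<tau> + x) * z x)"
            by (intro integrable_continuous_mult z continuous_ramp)
          show "AE x in lebesgue_on {0..L}. \<bar>z x\<bar> / 4 \<le> ramp (\<tau> + x) * z x"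
          proof (rule lebesgue_on_mono[OF z(2)])
            fix x assume zx: "0 \<le> z x" and x: "x \<in> {0..L}"
            have "1 / 4 * z x \<le> ramp (\<tau> + x) * z x"
              using x zx ramp_bounds(5)[of "\<tau> + x"] by (intro mult_right_mono) (auto simp: \<tau>_def)
            then show "\<bar>z x\<bar> / 4 \<le> ramp (\<tau> + x) * z x" using zx by simp
          qed
        qed (use z in auto)
        then show ?thesis by simp
      qed
      have "\<bar>a\<bar> / 4 \<le> 1 * a" using fg(3) by simp
      from add_mono[OF add_mono[OF this *[OF fg(1,4)]] *[OF fg(2,5)]] show ?thesis
        unfolding pe ramp_pair_def pairX.simps normX_eq add_divide_distrib .
    qed
    \<comment> \<open>With no time left, all ages lie in \<open>{0..L}\<close>, where the ramp is
      zero.\<close>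
    have finish: "ramp_pair 0 q = fst q" for q
    proof -
      obtain b u v where q: "q = (b, u, v)" by (cases q)
      have "(LINT x|lebesgue_on {0..L}. ramp (0 + x) * z x) = 0" for z :: "real \<Rightarrow> real"
        by (rule integral_eq_zero_AE) (auto simp: ramp_bounds(4) intro!: AE_I2)
      then show ?thesis unfolding q ramp_pair_def pairX.simps by simp
    qed
    have "B ^ Suc n * (normX L p / 4) \<le> B ^ Suc n * ramp_pair \<tau> p"
      using start B by (intro mult_left_mono) auto
    moreover have "B ^ Suc n * ramp_pair \<tau> p - real (Suc n) * err \<le> fst (T \<tau> p)"
      using st[of "Suc n"] unfolding nh by (simp only: diff_self finish order_refl)
    moreover have "real (Suc n) * err = \<delta> n"
    proof -
      have "real (Suc n) * err = (real (Suc n) * h) * quot_err p h + (real (Suc n) * h) * h / (4 * L\<^sup>2) * normX L p"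
        by (simp only: err_def power2_eq_square distrib_left times_divide_eq_right times_divide_eq_left mult.assoc)
      then show ?thesis unfolding nh by (simp only: \<delta>_def h_def)
    qed
    moreover have "B = 1 - \<Lambda> * \<tau> / real (Suc n)" by (simp add: B_def h_def)
    note this[symmetric]
    ultimately show ?thesis unfolding \<open>1 - \<Lambda> * \<tau> / real (Suc n) = B\<close> by linarith
  qed
  have "(\<lambda>n. (1 + (- \<Lambda> * \<tau>) / real n) ^ n) \<longlonglongrightarrow> exp (- \<Lambda> * \<tau>)"
    by (rule tendsto_exp_limit_sequentially)
  from LIMSEQ_Suc[OF this]
  have l1: "(\<lambda>n. (1 - \<Lambda> * \<tau> / real (Suc n)) ^ Suc n) \<longlonglongrightarrow> exp (- \<Lambda> * \<tau>)" by simp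
  have l2: "\<delta> \<longlonglongrightarrow> 0"
  proof -
    have "\<delta> \<longlonglongrightarrow> \<tau> * 0 + \<tau> * 0 / (4 * L\<^sup>2) * normX L p"
      unfolding \<delta>_def
      by (intro tendsto_intros quot_err_sequence p \<tau> LIMSEQ_Suc[OF lim_const_over_n]) (use L_pos in auto)
    then show ?thesis by simp
  qed
  have "(\<lambda>n. (1 - \<Lambda> * \<tau> / real (Suc n)) ^ Suc n * (normX L p / 4) - \<delta> n)
    \<longlonglongrightarrow> exp (- \<Lambda> * \<tau>) * (normX L p / 4) - 0"
    by (intro tendsto_intros l1 l2)
  moreover have "\<forall>\<^sub>F n in sequentially. (1 - \<Lambda> * \<tau> / real (Suc n)) ^ Suc n * (normX L p / 4) - \<delta> n \<le> fst (T \<tau> p)"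
  proof -
    obtain n0 :: nat where "\<Lambda> * \<tau> \<le> n0" using real_arch_simple by blast
    then have "\<Lambda> * \<tau> \<le> real (Suc n)" if "n \<ge> n0" for n using that by linarith
    then show ?thesis using main unfolding eventually_sequentially by blast
  qed
  ultimately have "exp (- \<Lambda> * \<tau>) * (normX L p / 4) - 0 \<le> fst (T \<tau> p)"
    by (intro tendsto_upperbound) auto
  then show ?thesis by (simp add: \<Lambda>_def \<tau>_def algebra_simps)
qed

lemma abs_fst_le_normX: "\<bar>fst p\<bar> \<le> normX L p"
proof -
  have "0 \<le> (LINT x|lebesgue_on {0..L}. \<bar>z x\<bar>)" for z :: "real \<Rightarrow> real"
    by (intro integral_nonneg_AE) auto
  then show ?thesis by (cases p) (simp add: normX_eq del: normX.simps)
qed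

text \<open>Two losses of at most \<open>e / 2\<close>: one from the norm of \<open>p\<close>, using
  that the constant is at most one, and one from the zeroth entry of the image, by
  contraction.\<close>

lemma fst_T_lower:
  assumes p: "p \<in> spaceX L" "nonnegX L p"
  shows "exp (- 2 * L * (l\<^sub>1 + l\<^sub>2)) / 4 * normX L p \<le> fst (T (2 * L) p)"
proof (rule field_le_epsilon)
  define c where "c = exp (- 2 * L * (l\<^sub>1 + l\<^sub>2)) / 4"
  have c: "0 \<le> c" "c \<le> 1"
  proof -
    have "exp (- 2 * L * (l\<^sub>1 + l\<^sub>2)) \<le> 1" using l_pos L_pos by simp
    then show "0 \<le> c" "c \<le> 1" unfolding c_def by (simp, linarith)
  qed
  fix e :: real assume e: "0 < e"
  obtain q where q: "q \<in> D" "nonnegX L q" "normX L (diffX q p) < e / 2"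
    using nonneg_domA_dense[OF p, of "e/2"] e by auto
  note X = domA_spaceX[OF q(1)]
  have z: "(0, \<lambda>x. 0, \<lambda>x. 0) \<in> spaceX L" by (simp add: spaceX_iff)
  have d0: "normX L (diffX r (0, \<lambda>x. 0, \<lambda>x. 0)) = normX L r" for r by (cases r) simp
  have "normX L p \<le> normX L (diffX q p) + normX L q"
    using normX_triangle[OF p(1) X z] d0[of p] d0[of q] normX_diffX_commute[of L p q] by linarith
  then have "c * normX L p \<le> c * normX L q + c * normX L (diffX q p)"
    using c mult_left_mono[of "normX L p" "normX L (diffX q p) + normX L q" c] by (simp add: algebra_simps)
  moreover have "c * normX L (diffX q p) \<le> 1 * normX L (diffX q p)"
    using c normX_nonneg by (intro mult_right_mono) auto
  moreover have "c * normX L q \<le> fst (T (2 * L) q)"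
    unfolding c_def by (rule fst_T_lower_domA[OF q(1,2)])
  moreover have "\<bar>fst (diffX (T (2 * L) q) (T (2 * L) p))\<bar> \<le> normX L (diffX q p)"
    using abs_fst_le_normX T_contraction_diff[of "2 * L" q p] L_pos X p(1) by (meson less_imp_le mult_pos_pos order_trans zero_less_numeral)
  moreover have "fst (diffX u v) = fst u - fst v" for u v :: state by (cases u; cases v) simp
  ultimately show "exp (- 2 * L * (l\<^sub>1 + l\<^sub>2)) / 4 * normX L p \<le> fst (T (2 * L) p) + e"
    unfolding c_def[symmetric] using q(3) by (smt (verit) field_sum_of_halves)
qed

text \<open>Mass zero gives the positive and negative parts equal norms. Both images carry at least
  \<open>c * normX L r / 2\<close> in the zeroth entry, and this common amount cancels in the
  difference.\<close>

lemma T_contracts_massless: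
  assumes r: "r \<in> spaceX L" "massX L r = 0"
  shows "normX L (T (2 * L) r) \<le> (1 - exp (- 2 * L * (l\<^sub>1 + l\<^sub>2)) / 4) * normX L r"
proof -
  define c where "c = exp (- 2 * L * (l\<^sub>1 + l\<^sub>2)) / 4"
  define \<tau> where "\<tau> = 2 * L"
  have \<tau>: "0 \<le> \<tau>" using L_pos by (simp add: \<tau>_def)
  obtain p q where pq: "p \<in> spaceX L" "q \<in> spaceX L" "nonnegX L p" "nonnegX L q" "diffX p q = r"
    "normX L p + normX L q = normX L r"
    using nonneg_parts[OF r(1)] .
  have "massX L p - massX L q = 0" using massX_diffX[OF pq(1,2)] pq(5) r(2) by simp
  then have half: "normX L p = normX L r / 2" "normX L q = normX L r / 2"
    using massX_nonneg[OF pq(3,1)] massX_nonneg[OF pq(4,2)] pq(6) by linarith+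
  obtain a f g where a: "T \<tau> p = (a, f, g)" by (cases "T \<tau> p")
  obtain b u v where b: "T \<tau> q = (b, u, v)" by (cases "T \<tau> q")
  have low: "c * (normX L r / 2) \<le> a" "c * (normX L r / 2) \<le> b"
    using fst_T_lower[OF pq(1,3)] fst_T_lower[OF pq(2,4)] a b by (simp_all add: c_def \<tau>_def half)
  have X: "T \<tau> p \<in> spaceX L" "T \<tau> q \<in> spaceX L" using T_space \<tau> pq by auto
  then have i: "integrable (lebesgue_on {0..L}) f" "integrable (lebesgue_on {0..L}) g"
    "integrable (lebesgue_on {0..L}) u" "integrable (lebesgue_on {0..L}) v"
    by (auto simp: a b spaceX_iff)
  have tri: "(LINT x|lebesgue_on {0..L}. \<bar>y x - z x\<bar>)
      \<le> (LINT x|lebesgue_on {0..L}. \<bar>y x\<bar>) + (LINT x|lebesgue_on {0..L}. \<bar>z x\<bar>)"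
    if "integrable (lebesgue_on {0..L}) y" "integrable (lebesgue_on {0..L}) z" for y z :: "real \<Rightarrow> real"
  proof -
    have "(LINT x|lebesgue_on {0..L}. \<bar>y x - z x\<bar>) \<le> (LINT x|lebesgue_on {0..L}. \<bar>y x\<bar> + \<bar>z x\<bar>)"
      using that by (intro integral_mono) auto
    then show ?thesis using that by simp
  qed
  have c0: "0 \<le> c * (normX L r / 2)" using normX_nonneg[of L r] by (simp add: c_def)
  \<comment> \<open>For non-negative numbers \<open>\<bar>a - b\<bar>\<close> is the sum minus twice
    the smaller one, and the smaller one is at least \<open>c * normX L r / 2\<close>.\<close>
  then have ab: "\<bar>a - b\<bar> \<le> \<bar>a\<bar> + \<bar>b\<bar> - c * normX L r" using low by linarith
  have "normX L (T \<tau> r) = normX L (diffX (T \<tau> p) (T \<tau> q))"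
    using T_diffX[OF \<tau> pq(1,2)] T_space[OF \<tau> r(1)] spaceX_algebra(3)[OF X] pq(5)
    by (intro normX_cong) auto
  also have "\<dots> \<le> normX L (T \<tau> p) + normX L (T \<tau> q) - c * normX L r"
    using add_mono[OF add_mono[OF ab tri[OF i(1,3)]] tri[OF i(2,4)]]
    unfolding a b diffX.simps normX_eq by (simp only: algebra_simps)
  also have "\<dots> \<le> normX L p + normX L q - c * normX L r"
    using T_contraction[OF \<tau> pq(1)] T_contraction[OF \<tau> pq(2)] by simp
  also have "\<dots> = (1 - c) * normX L r" using pq(6) by (simp add: algebra_simps)
  finally show ?thesis by (simp add: c_def \<tau>_def)
qed

text \<open>The orbit and \<open>pe\<close> both have mass one, so their difference is massless and
  shrinks by \<open>\<theta>\<close> in each period \<open>\<tau>\<close>; between multiples of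
  \<open>\<tau>\<close> it does not grow. The initial distance is at most 2, the sum of two unit
  norms.\<close>

lemma exponential_convergence:
  assumes \<phi>: "\<phi> \<in> spaceX L" "nonnegX L \<phi>" "normX L \<phi> = 1"
  shows "\<exists>\<epsilon> M. 0 < \<epsilon> \<and> 1 \<le> M \<and> (\<forall>t\<ge>0. normX L (diffX (T t \<phi>) pe) \<le> M * exp (- \<epsilon> * t))"
proof -
  define \<theta> where "\<theta> = 1 - exp (- 2 * L * (l\<^sub>1 + l\<^sub>2)) / 4"
  define \<tau> where "\<tau> = 2 * L"
  have \<tau>: "0 < \<tau>" using L_pos by (simp add: \<tau>_def)
  have \<theta>: "0 < \<theta>" "\<theta> < 1"
  proof -
    have "exp (- 2 * L * (l\<^sub>1 + l\<^sub>2)) \<le> 1" using l_pos L_pos by simp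
    then show "0 < \<theta>" unfolding \<theta>_def by linarith
    show "\<theta> < 1" by (simp add: \<theta>_def)
  qed
  note peX = domA_spaceX[OF steady_state(1)]
  define d where "d = (\<lambda>t. normX L (diffX (T t \<phi>) pe))"
  have mass: "massX L (T t \<phi>) = 1" if "0 \<le> t" for t
  proof (cases "t = 0")
    case True
    have "massX L (T 0 \<phi>) = massX L \<phi>"
      unfolding massX_def using \<phi> T_space T_zero by (intro pairX_cong) auto
    then show ?thesis using True massX_nonneg \<phi> by simp
  next
    case False
    then show ?thesis using massX_T_nonneg[OF \<phi>(1,2), of t] massX_nonneg \<phi> that by simp
  qed
  have d_add: "d (s + t) \<le> normX L (T s (diffX (T t \<phi>) pe))" if st: "0 \<le> s" "0 \<le> t" for s t
  proof -
    note TX = T_space[OF st(2) \<phi>(1)] T_space[OF st(1) T_space[OF st(2) \<phi>(1)]] T_space[OF st(1) peX]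
    have stX: "T (s + t) \<phi> \<in> spaceX L" using st by (intro T_space \<phi>) auto
    have "d (s + t) = normX L (diffX (T s (T t \<phi>)) pe)"
      unfolding d_def
      by (rule normX_cong[OF spaceX_algebra(3)[OF stX peX] spaceX_algebra(3)[OF TX(2) peX]
            eqX_diffX[OF T_add[OF st \<phi>(1)] eqX_refl]])
    also have "\<dots> \<le> normX L (diffX (T s (T t \<phi>)) (T s pe)) + normX L (diffX (T s pe) pe)"
      by (intro normX_triangle TX peX)
    also have "\<dots> = normX L (diffX (T s (T t \<phi>)) (T s pe))" using T_steady_state[OF st(1)] by simp
    also have "\<dots> = normX L (T s (diffX (T t \<phi>) pe))"
      using normX_cong[OF T_space[OF st(1) spaceX_algebra(3)[OF TX(1) peX]] spaceX_algebra(3)[OF TX(2,3)]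
          T_diffX[OF st(1) TX(1) peX]] by simp
    finally show ?thesis .
  qed
  have iter: "d (real n * \<tau>) \<le> \<theta> ^ n * 2" for n
  proof (induction n)
    case 0
    have z: "zeroX \<in> spaceX L" by (simp add: zeroX_def spaceX_iff)
    have "diffX r zeroX = r" "normX L (diffX zeroX r) = normX L r" for r
      by (cases r; simp add: zeroX_def)+
    then have "normX L (diffX (T 0 \<phi>) pe) \<le> normX L (T 0 \<phi>) + normX L pe"
      using normX_triangle[OF T_space[OF order_refl \<phi>(1)] z peX] by simp
    also have "\<dots> \<le> 2" using T_contraction[OF order_refl \<phi>(1)] \<phi>(3) steady_state(4) by simp
    finally show ?case by (simp add: d_def)
  next
    case (Suc n)
    have n: "0 \<le> real n * \<tau>" using \<tau> by simp
    note TX = T_space[OF n \<phi>(1)]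
    have "massX L (diffX (T (real n * \<tau>) \<phi>) pe) = 0"
      using massX_diffX[OF TX peX] mass[OF n] massX_nonneg[OF steady_state(3) peX] steady_state(4) by simp
    from T_contracts_massless[OF spaceX_algebra(3)[OF TX peX] this]
    have "normX L (T \<tau> (diffX (T (real n * \<tau>) \<phi>) pe)) \<le> \<theta> * d (real n * \<tau>)"
      by (simp add: \<tau>_def \<theta>_def d_def)
    moreover have "real (Suc n) * \<tau> = \<tau> + real n * \<tau>" by (simp add: algebra_simps)
    ultimately have "d (real (Suc n) * \<tau>) \<le> \<theta> * d (real n * \<tau>)"
      using d_add[of \<tau> "real n * \<tau>"] \<tau> n by simp
    also have "\<dots> \<le> \<theta> * (\<theta> ^ n * 2)" using Suc \<theta> by (intro mult_left_mono) auto
    finally show ?case by (simp add: mult.assoc)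
  qed
  \<comment> \<open>Chosen so that \<open>\<theta>\<close> to the power \<open>t / \<tau>\<close> is
    \<open>exp (- \<epsilon> * t)\<close>. Rounding \<open>t / \<tau>\<close> down costs at most one
    factor \<open>1 / \<theta>\<close>, whence the constant \<open>2 / \<theta>\<close>.\<close>
  define \<epsilon> where "\<epsilon> = - ln \<theta> / \<tau>"
  have \<epsilon>: "0 < \<epsilon>" using \<theta> \<tau> by (simp add: \<epsilon>_def divide_neg_pos)
  have "d t \<le> 2 / \<theta> * exp (- \<epsilon> * t)" if t: "0 \<le> t" for t
  proof -
    define n where "n = nat \<lfloor>t / \<tau>\<rfloor>"
    have n: "real n \<le> t / \<tau>" "t / \<tau> < real n + 1"
      using t \<tau> by (auto simp: n_def of_nat_nat)
    define s where "s = t - real n * \<tau>"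
    have s: "0 \<le> s" using n \<tau> by (simp add: s_def field_simps)
    have nt: "0 \<le> real n * \<tau>" using \<tau> by simp
    have "d (s + real n * \<tau>) \<le> d (real n * \<tau>)"
      using d_add[OF s nt] T_contraction[OF s spaceX_algebra(3)[OF T_space[OF nt \<phi>(1)] peX]]
      by (simp add: d_def)
    then have "d t \<le> \<theta> ^ n * 2" using iter[of n] by (simp add: s_def)
    also have "\<theta> ^ n = exp (real n * ln \<theta>)" using \<theta> by (simp add: exp_of_nat_mult)
    also have "\<dots> \<le> exp ((t / \<tau> - 1) * ln \<theta>)"
    proof -
      have "real n * ln \<theta> \<le> (t / \<tau> - 1) * ln \<theta>"
        using n \<theta> by (intro mult_right_mono_neg) auto
      then show ?thesis by simp
    qed
    also have "(t / \<tau> - 1) * ln \<theta> = - \<epsilon> * t - ln \<theta>" by (simp add: \<epsilon>_def algebra_simps)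
    also have "exp (- \<epsilon> * t - ln \<theta>) = exp (- \<epsilon> * t) / \<theta>" using \<theta> by (simp add: exp_diff)
    finally show ?thesis by (simp add: mult.commute)
  qed
  moreover have "1 \<le> 2 / \<theta>" using \<theta> by simp
  ultimately show ?thesis using \<epsilon> unfolding d_def by blast
qed

end

theorem theorem2p2:
  fixes L lam\<^sub>1 lam\<^sub>2 :: real
    and \<mu>\<^sub>1 \<mu>\<^sub>2 :: "real \<Rightarrow> real"
    and N :: nat
    and T :: "real \<Rightarrow> state \<Rightarrow> state"
    and \<phi> :: state
  assumes "0 < L" and "0 < lam\<^sub>1" and "0 < lam\<^sub>2"
    and "\<And>x. x \<in> {0..L} \<Longrightarrow> 0 \<le> \<mu>\<^sub>1 x"
    and "\<And>x. x \<in> {0..L} \<Longrightarrow> 0 \<le> \<mu>\<^sub>2 x"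
    and "\<And>l. 0 < l \<Longrightarrow> l < L \<Longrightarrow> set_integrable lebesgue {0..l} \<mu>\<^sub>1"
    and "\<And>l. 0 < l \<Longrightarrow> l < L \<Longrightarrow> set_integrable lebesgue {0..l} \<mu>\<^sub>2"
    and "(\<integral>\<^sup>+x\<in>{0..L}. ennreal (\<mu>\<^sub>1 x) \<partial>lebesgue) = \<infinity>"
    and "(\<integral>\<^sup>+x\<in>{0..L}. ennreal (\<mu>\<^sub>2 x) \<partial>lebesgue) = \<infinity>"
    and "0 < N"
    and "\<exists>c. ((\<lambda>x. \<mu>\<^sub>1 x * (L - x) ^ N) \<longlongrightarrow> c) (at_left L)"
    and "\<exists>c. ((\<lambda>x. \<mu>\<^sub>2 x * (L - x) ^ N) \<longlongrightarrow> c) (at_left L)"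
    and "C0_semigroup L T"
    and "positive_semigroup L T"
    and "contraction_semigroup L T"
    and "generates L (domA L lam\<^sub>1 lam\<^sub>2 \<mu>\<^sub>1 \<mu>\<^sub>2) (opA L lam\<^sub>1 lam\<^sub>2 \<mu>\<^sub>1 \<mu>\<^sub>2) T"
    and "\<phi> \<in> spaceX L" and "nonnegX L \<phi>" and "normX L \<phi> = 1"
  shows "steady_state L lam\<^sub>1 lam\<^sub>2 \<mu>\<^sub>1 \<mu>\<^sub>2 \<in> domA L lam\<^sub>1 lam\<^sub>2 \<mu>\<^sub>1 \<mu>\<^sub>2
    \<and> eqX L (opA L lam\<^sub>1 lam\<^sub>2 \<mu>\<^sub>1 \<mu>\<^sub>2 (steady_state L lam\<^sub>1 lam\<^sub>2 \<mu>\<^sub>1 \<mu>\<^sub>2)) zeroX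
    \<and> (\<exists>\<epsilon>\<^sub>0 M\<^sub>0. 0 < \<epsilon>\<^sub>0 \<and> 1 \<le> M\<^sub>0 \<and>
      (\<forall>t\<ge>0. normX L (diffX (T t \<phi>) (steady_state L lam\<^sub>1 lam\<^sub>2 \<mu>\<^sub>1 \<mu>\<^sub>2)) \<le> M\<^sub>0 * exp (- \<epsilon>\<^sub>0 * t)))"
proof -
  have hazard: "hazard_rate L m"
    if "\<And>x. x \<in> {0..L} \<Longrightarrow> 0 \<le> m x"
      "\<And>l. 0 < l \<Longrightarrow> l < L \<Longrightarrow> set_integrable lebesgue {0..l} m"
      "(\<integral>\<^sup>+x\<in>{0..L}. ennreal (m x) \<partial>lebesgue) = \<infinity>" for m
  proof
    show "integrable (lebesgue_on {0..l}) m" if "0 < l" "l < L" for l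
      using \<open>\<And>l. 0 < l \<Longrightarrow> l < L \<Longrightarrow> set_integrable lebesgue {0..l} m\<close>[OF that]
      by (simp add: set_integrable_lebesgue_on)
    show "(\<integral>\<^sup>+x. ennreal (m x) \<partial>lebesgue_on {0..L}) = \<infinity>"
      using that(3) by (simp add: nn_integral_restrict_space)
  qed (use that(1) \<open>0 < L\<close> in auto)
  interpret H1: hazard_rate L \<mu>\<^sub>1 by (rule hazard) fact+
  interpret H2: hazard_rate L \<mu>\<^sub>2 by (rule hazard) fact+
  interpret repair_semigroup L \<mu>\<^sub>1 \<mu>\<^sub>2 lam\<^sub>1 lam\<^sub>2 T
    by unfold_locales fact+
  show ?thesis
    using steady_state(1,2) exponential_convergence[OF \<open>\<phi> \<in> spaceX L\<close> \<open>nonnegX L \<phi>\<close> \<open>normX L \<phi> = 1\<close>]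
    by blast
qed


end
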